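(* Let $\mathbb K$ be a commutative unital ring. (i) For every associative pair $(\mathbb A^+,\mathbb A^-)$ over $\mathbb K$ there exists an associative geometry $\mathcal X$ over $\mathbb K$ with base point $(o^+,o^-)$ having $(\mathbb A^+,\mathbb A^-)$ (up to isomorphism) as associated associative pair. (ii) For every unital associative $\mathbb K$-algebra $(\mathbb A,1)$ there exists an associative geometry $\mathcal X$ over $\mathbb K$ with a transversal triple $(o^+,\Delta,o^-)$ having $(\mathbb A,1)$ (up to isomorphism) as associated algebra.
   Context: An associative geometry over $\mathbb K$ is a complete lattice $\mathcal X$ (join $\lor$, meet $\land$, least element $0$, greatest element $1$) with maps $\Gamma:\mathcal X^5\to\mathcal X$ and $\Pi_s:\mathcal X^3\to\mathcal X$ ($s\in\mathbb K$) satisfying axioms (1)–(6) below. Notation: $L_{xayb}(z):=M_{xabz}(y):=R_{aybz}(x):=\Gamma(x,a,y,b,z)$; $x\top y$ (transversal) iff $x\land y=0$ and $x\lor y=1$; $C_a=U_a=\{x: x\top a\}$, $C_{ab}=C_a\cap C_b$. (1) For all $x,y,z,u,v,a,b$: $\Gamma(\Gamma(x,a,y,b,z),a,u,b,v)=\Gamma(x,a,\Gamma(u,a,z,b,y),b,v)=\Gamma(x,a,y,b,\Gamma(z,a,u,b,v))$. (2) $\Gamma(x,a,y,b,z)=\Gamma(z,b,y,a,x)=\Gamma(a,x,y,z,b)$ for all $x,a,y,b,z$. (3) For all $x,a,y,b,z$ the pairs $(L_{xayb},L_{yaxb})$, $(M_{xabz},M_{zabx})$, $(R_{aybz},R_{azby})$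 are structural, where a pair $g:\mathcal X\to\mathcal Y$, $h:\mathcal Y\to\mathcal X$ is structural if $g(\Gamma(x,h(u),y,h(v),z))=\Gamma(g(x),u,g(y),v,g(z))$ and $g(\Pi_r(x,h(u),y))=\Pi_r(g(x),u,g(y))$ for all $r\in\mathbb K$ and all arguments, and the same with $g$ and $h$ interchanged. (4) (i) $\Gamma(a,a,y,b,b)=a\lor b$ for all $a,b,y$; (ii) $\Gamma(a,b,y,a,b)=a\land b$ for all $a,b,y$; (iii) if $x\in C_{ab}$ then $\Gamma(x,a,x,b,z)=z=\Gamma(z,b,x,a,x)$; (iv) if $a\top x$, $y\top b$ then $\Gamma(x,a,y,b,b)=b$; (v) if $a\top y$, $b\top x$ then $\Gamma(x,a,y,b,a)=a$. (5) For all $a\in\mathcal X$, $r\in\mathbb K$: $C_a$ is stable under $\Pi_r$ (i.e. $(x,y)\mapsto\Pi_r(x,a,y)$), and $C_a$ is an affine space (possibly empty) over $\mathbb K$ with additive torsor structure $x-y+z=\Gamma(x,a,y,a,z)$ and scalar action $(1-r)x+ry=\Pi_r(x,a,y)$. (6) For all $a,b$: $\Gamma(U_a,a,U_b,b,U_a)\subset U_a$ and $\Gamma(U_b,a,U_a,b,U_b)\subset U_b$. A base point is a pair $(o^+,o^-)$ with $o^+\top o^-$; a transversal triple is a triple of mutually transversal elements. An associative pair over $\mathbb K$ is a pair $(\mathbb A^+,\mathbb A^-)$ of $\mathbb K$-modules with trilinear maps $\langle\cdot,\cdot,\cdot\rangle^\pm:\mathbb A^\pm\times\mathbb A^\mp\times\mathbb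 A^\pm\to\mathbb A^\pm$ such that $\langle xy\langle zuv\rangle^\pm\rangle^\pm=\langle\langle xyz\rangle^\pm uv\rangle^\pm=\langle x\langle uzy\rangle^\mp v\rangle^\pm$. Isomorphisms are pairs of $\mathbb K$-linear bijections compatible with these products. The associative pair associated to $(\mathcal X;o^+,o^-)$ is $\mathbb A^+=U_{o^-}$ (with origin $o^+$), $\mathbb A^-=U_{o^+}$ (with origin $o^-$), with $\langle xbz\rangle^+=\Gamma(x,o^-,b,o^+,z)$ and $\langle ayc\rangle^-=\Gamma(a,o^-,y,o^+,c)$. The algebra associated to $\mathcal X$ with transversal triple $(a,b,c)$ is the $\mathbb K$-module $U_c$ with origin $a$, unit $b$ and product $xz=\Gamma(x,a,b,c,z)$. *)

theory Defs
  imports "HOL-Algebra.Module" "HOL-Algebra.QuotRing" "HOL-Algebra.Complete_Lattice"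
begin

section \<open>Modules, associative algebras and associative pairs\<close>

definition linear_map ::
  "('k, 'r) ring_scheme \<Rightarrow> ('k, 'a, 'm) module_scheme \<Rightarrow> ('k, 'b, 'n) module_scheme \<Rightarrow> ('a \<Rightarrow> 'b) \<Rightarrow> bool"
where
  "linear_map K M N f \<longleftrightarrow>
     f \<in> carrier M \<rightarrow> carrier N \<and>
     (\<forall>x\<in>carrier M. \<forall>y\<in>carrier M. f (x \<oplus>\<^bsub>M\<^esub> y) = f x \<oplus>\<^bsub>N\<^esub> f y) \<and>
     (\<forall>r\<in>carrier K. \<forall>x\<in>carrier M. f (r \<odot>\<^bsub>M\<^esub> x) = r \<odot>\<^bsub>N\<^esub> f x)"

definition trilinear_map ::
  "('k, 'r) ring_scheme \<Rightarrow> ('k, 'a, 'm) module_scheme \<Rightarrow> ('k, 'b, 'n) module_scheme \<Rightarrow>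
   ('k, 'c, 'o) module_scheme \<Rightarrow> ('k, 'd, 'p) module_scheme \<Rightarrow> ('a \<Rightarrow> 'b \<Rightarrow> 'c \<Rightarrow> 'd) \<Rightarrow> bool"
where
  "trilinear_map K M N P Q f \<longleftrightarrow>
     (\<forall>y\<in>carrier N. \<forall>z\<in>carrier P. linear_map K M Q (\<lambda>x. f x y z)) \<and>
     (\<forall>x\<in>carrier M. \<forall>z\<in>carrier P. linear_map K N Q (\<lambda>y. f x y z)) \<and>
     (\<forall>x\<in>carrier M. \<forall>y\<in>carrier N. linear_map K P Q (\<lambda>z. f x y z))"

text \<open>
  The locale \<^locale>\<open>algebra\<close> of the library only covers commutative algebras.
\<close>

locale unital_assoc_algebra = module K A + ring A
  for K :: "('k, 'r) ring_scheme" and A :: "('k, 'a, 'm) module_scheme" +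
  assumes smult_mult_left:
      "\<lbrakk> r \<in> carrier K; x \<in> carrier A; y \<in> carrier A \<rbrakk> \<Longrightarrow>
        (r \<odot>\<^bsub>A\<^esub> x) \<otimes>\<^bsub>A\<^esub> y = r \<odot>\<^bsub>A\<^esub> (x \<otimes>\<^bsub>A\<^esub> y)"
    and smult_mult_right:
      "\<lbrakk> r \<in> carrier K; x \<in> carrier A; y \<in> carrier A \<rbrakk> \<Longrightarrow>
        x \<otimes>\<^bsub>A\<^esub> (r \<odot>\<^bsub>A\<^esub> y) = r \<odot>\<^bsub>A\<^esub> (x \<otimes>\<^bsub>A\<^esub> y)"

text \<open>\<^const>\<open>ring_iso\<close> includes preservation of the unit element.\<close>

definition algebra_iso ::
  "('k, 'r) ring_scheme \<Rightarrow> ('k, 'a, 'm) module_scheme \<Rightarrow> ('k, 'b, 'n) module_scheme \<Rightarrow> ('a \<Rightarrow> 'b) \<Rightarrow> bool"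
where
  "algebra_iso K A B f \<longleftrightarrow> f \<in> ring_iso A B \<and> linear_map K A B f"

text \<open>In a module record standing for \<open>\<bbbA>\<^sup>\<plusminus>\<close> the fields for multiplication and unit are ignored.\<close>

locale associative_pair = plus: module K A + minus: module K B
  for K :: "('k, 'r) ring_scheme"
    and A :: "('k, 'a, 'm) module_scheme"
    and B :: "('k, 'b, 'n) module_scheme" +
  fixes tp :: "'a \<Rightarrow> 'b \<Rightarrow> 'a \<Rightarrow> 'a" and tm :: "'b \<Rightarrow> 'a \<Rightarrow> 'b \<Rightarrow> 'b"
  assumes tp_trilinear: "trilinear_map K A B A A tp"
    and tm_trilinear: "trilinear_map K B A B B tm"
    and tp_assoc:
      "\<And>x y z u v. \<lbrakk> x \<in> carrier A; y \<in> carrier B; z \<in> carrier A; u \<in> carrier B; v \<in> carrier A \<rbrakk> \<Longrightarrow>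
        tp x y (tp z u v) = tp (tp x y z) u v \<and> tp (tp x y z) u v = tp x (tm u z y) v"
    and tm_assoc:
      "\<And>x y z u v. \<lbrakk> x \<in> carrier B; y \<in> carrier A; z \<in> carrier B; u \<in> carrier A; v \<in> carrier B \<rbrakk> \<Longrightarrow>
        tm x y (tm z u v) = tm (tm x y z) u v \<and> tm (tm x y z) u v = tm x (tp u z y) v"

definition associative_pair_iso ::
  "('k, 'r) ring_scheme \<Rightarrow>
   ('k, 'a, 'm) module_scheme \<Rightarrow> ('k, 'b, 'n) module_scheme \<Rightarrow>
   ('a \<Rightarrow> 'b \<Rightarrow> 'a \<Rightarrow> 'a) \<Rightarrow> ('b \<Rightarrow> 'a \<Rightarrow> 'b \<Rightarrow> 'b) \<Rightarrow>
   ('k, 'c, 'o) module_scheme \<Rightarrow> ('k, 'd, 'p) module_scheme \<Rightarrow>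
   ('c \<Rightarrow> 'd \<Rightarrow> 'c \<Rightarrow> 'c) \<Rightarrow> ('d \<Rightarrow> 'c \<Rightarrow> 'd \<Rightarrow> 'd) \<Rightarrow>
   ('a \<Rightarrow> 'c) \<Rightarrow> ('b \<Rightarrow> 'd) \<Rightarrow> bool"
where
  "associative_pair_iso K A B tp tm A' B' tp' tm' f g \<longleftrightarrow>
     bij_betw f (carrier A) (carrier A') \<and> linear_map K A A' f \<and>
     bij_betw g (carrier B) (carrier B') \<and> linear_map K B B' g \<and>
     (\<forall>x\<in>carrier A. \<forall>y\<in>carrier B. \<forall>z\<in>carrier A. f (tp x y z) = tp' (f x) (g y) (f z)) \<and>
     (\<forall>x\<in>carrier B. \<forall>y\<in>carrier A. \<forall>z\<in>carrier B. g (tm x y z) = tm' (g x) (f y) (g z))"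


section \<open>Affine spaces\<close>

text \<open>
  A set \<open>C\<close> with a ternary operation \<open>t\<close> (to be read as \<open>x - y + z\<close>) and binary operations \<open>d r\<close>
  (to be read as \<open>(1 - r) x + r y\<close>) can be linearized at any \<open>p \<in> C\<close>: \<open>p\<close> becomes the origin,
  \<open>x + z = t x p z\<close> and \<open>r y = d r p y\<close>.  It is a (possibly empty) affine space if all
  linearizations are modules in which \<open>t\<close> and \<open>d\<close> are given by the above formulas.
\<close>

definition linearization ::
  "'x set \<Rightarrow> ('x \<Rightarrow> 'x \<Rightarrow> 'x \<Rightarrow> 'x) \<Rightarrow> ('k \<Rightarrow> 'x \<Rightarrow> 'x \<Rightarrow> 'x) \<Rightarrow> 'x \<Rightarrow> ('k, 'x) module"
where
  "linearization C t d p =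
     \<lparr> carrier = C, monoid.mult = undefined, one = undefined,
       zero = p, add = (\<lambda>x z. t x p z), smult = (\<lambda>r y. d r p y) \<rparr>"

definition affine_space ::
  "('k, 'r) ring_scheme \<Rightarrow> 'x set \<Rightarrow> ('x \<Rightarrow> 'x \<Rightarrow> 'x \<Rightarrow> 'x) \<Rightarrow> ('k \<Rightarrow> 'x \<Rightarrow> 'x \<Rightarrow> 'x) \<Rightarrow> bool"
where
  "affine_space K C t d \<longleftrightarrow>
     (\<forall>p\<in>C. let M = linearization C t d p in
        module K M \<and>
        (\<forall>x\<in>C. \<forall>y\<in>C. \<forall>z\<in>C. t x y z = (x \<ominus>\<^bsub>M\<^esub> y) \<oplus>\<^bsub>M\<^esub> z) \<and>
        (\<forall>r\<in>carrier K. \<forall>x\<in>C. \<forall>y\<in>C.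
           d r x y = ((\<one>\<^bsub>K\<^esub> \<ominus>\<^bsub>K\<^esub> r) \<odot>\<^bsub>M\<^esub> x) \<oplus>\<^bsub>M\<^esub> (r \<odot>\<^bsub>M\<^esub> y)))"


section \<open>Associative geometries\<close>

text \<open>\<open>gam X x a y b z\<close> is \<open>\<Gamma>(x,a,y,b,z)\<close> and \<open>dil X r x a y\<close> is \<open>\<Pi>\<^sub>r(x,a,y)\<close>.\<close>

record ('x, 'k) geometry = "'x gorder" +
  gam :: "'x \<Rightarrow> 'x \<Rightarrow> 'x \<Rightarrow> 'x \<Rightarrow> 'x \<Rightarrow> 'x" ("\<Gamma>\<index>")
  dil :: "'k \<Rightarrow> 'x \<Rightarrow> 'x \<Rightarrow> 'x \<Rightarrow> 'x"

definition transversal :: "('x, 'm) gorder_scheme \<Rightarrow> 'x \<Rightarrow> 'x \<Rightarrow> bool" where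
  "transversal X x y \<longleftrightarrow> x \<sqinter>\<^bsub>X\<^esub> y = \<bottom>\<^bsub>X\<^esub> \<and> x \<squnion>\<^bsub>X\<^esub> y = \<top>\<^bsub>X\<^esub>"

definition U :: "('x, 'm) gorder_scheme \<Rightarrow> 'x \<Rightarrow> 'x set" where
  "U X a = {x \<in> carrier X. transversal X x a}"

definition semi_structural ::
  "('k, 'r) ring_scheme \<Rightarrow> ('x, 'k, 'm) geometry_scheme \<Rightarrow> ('y, 'k, 'n) geometry_scheme \<Rightarrow>
   ('x \<Rightarrow> 'y) \<Rightarrow> ('y \<Rightarrow> 'x) \<Rightarrow> bool"
where
  "semi_structural K X Y g h \<longleftrightarrow>
     (\<forall>x\<in>carrier X. \<forall>u\<in>carrier Y. \<forall>y\<in>carrier X. \<forall>v\<in>carrier Y. \<forall>z\<in>carrier X.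
        g (gam X x (h u) y (h v) z) = gam Y (g x) u (g y) v (g z)) \<and>
     (\<forall>r\<in>carrier K. \<forall>x\<in>carrier X. \<forall>u\<in>carrier Y. \<forall>y\<in>carrier X.
        g (dil X r x (h u) y) = dil Y r (g x) u (g y))"

definition structural_pair ::
  "('k, 'r) ring_scheme \<Rightarrow> ('x, 'k, 'm) geometry_scheme \<Rightarrow> ('y, 'k, 'n) geometry_scheme \<Rightarrow>
   ('x \<Rightarrow> 'y) \<Rightarrow> ('y \<Rightarrow> 'x) \<Rightarrow> bool"
where
  "structural_pair K X Y g h \<longleftrightarrow>
     g \<in> carrier X \<rightarrow> carrier Y \<and> h \<in> carrier Y \<rightarrow> carrier X \<and>
     semi_structural K X Y g h \<and> semi_structural K Y X h g"

locale associative_geometry = K: cring K + complete_lattice X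
  for K :: "('k, 'r) ring_scheme" and X :: "('x, 'k, 'm) geometry_scheme" (structure) +
  assumes gam_closed:
      "\<lbrakk> x \<in> carrier X; a \<in> carrier X; y \<in> carrier X; b \<in> carrier X; z \<in> carrier X \<rbrakk> \<Longrightarrow>
        \<Gamma> x a y b z \<in> carrier X"
    and dil_closed:
      "\<lbrakk> r \<in> carrier K; x \<in> carrier X; a \<in> carrier X; y \<in> carrier X \<rbrakk> \<Longrightarrow>
        dil X r x a y \<in> carrier X"
    and para_assoc:
      "\<lbrakk> x \<in> carrier X; y \<in> carrier X; z \<in> carrier X; u \<in> carrier X; v \<in> carrier X;
         a \<in> carrier X; b \<in> carrier X \<rbrakk> \<Longrightarrow>
        \<Gamma> (\<Gamma> x a y b z) a u b v = \<Gamma> x a (\<Gamma> u a z b y) b v \<and>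
        \<Gamma> x a (\<Gamma> u a z b y) b v = \<Gamma> x a y b (\<Gamma> z a u b v)"
    and gam_symmetry:
      "\<lbrakk> x \<in> carrier X; a \<in> carrier X; y \<in> carrier X; b \<in> carrier X; z \<in> carrier X \<rbrakk> \<Longrightarrow>
        \<Gamma> x a y b z = \<Gamma> z b y a x \<and> \<Gamma> z b y a x = \<Gamma> a x y z b"
    and L_structural:
      "\<lbrakk> x \<in> carrier X; a \<in> carrier X; y \<in> carrier X; b \<in> carrier X \<rbrakk> \<Longrightarrow>
        structural_pair K X X (\<lambda>z. \<Gamma> x a y b z) (\<lambda>z. \<Gamma> y a x b z)"
    and M_structural:
      "\<lbrakk> x \<in> carrier X; a \<in> carrier X; b \<in> carrier X; z \<in> carrier X \<rbrakk> \<Longrightarrow>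
        structural_pair K X X (\<lambda>y. \<Gamma> x a y b z) (\<lambda>y. \<Gamma> z a y b x)"
    and R_structural:
      "\<lbrakk> a \<in> carrier X; y \<in> carrier X; b \<in> carrier X; z \<in> carrier X \<rbrakk> \<Longrightarrow>
        structural_pair K X X (\<lambda>x. \<Gamma> x a y b z) (\<lambda>x. \<Gamma> x a z b y)"
    and diagonal_join:
      "\<lbrakk> a \<in> carrier X; b \<in> carrier X; y \<in> carrier X \<rbrakk> \<Longrightarrow> \<Gamma> a a y b b = a \<squnion> b"
    and diagonal_meet:
      "\<lbrakk> a \<in> carrier X; b \<in> carrier X; y \<in> carrier X \<rbrakk> \<Longrightarrow> \<Gamma> a b y a b = a \<sqinter> b"
    and diagonal_idem:
      "\<lbrakk> a \<in> carrier X; b \<in> carrier X; x \<in> U X a \<inter> U X b; z \<in> carrier X \<rbrakk> \<Longrightarrow>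
        \<Gamma> x a x b z = z \<and> \<Gamma> z b x a x = z"
    and diagonal_right:
      "\<lbrakk> a \<in> carrier X; b \<in> carrier X; x \<in> carrier X; y \<in> carrier X;
         transversal X a x; transversal X y b \<rbrakk> \<Longrightarrow> \<Gamma> x a y b b = b"
    and diagonal_left:
      "\<lbrakk> a \<in> carrier X; b \<in> carrier X; x \<in> carrier X; y \<in> carrier X;
         transversal X a y; transversal X b x \<rbrakk> \<Longrightarrow> \<Gamma> x a y b a = a"
    and dil_stable:
      "\<lbrakk> a \<in> carrier X; r \<in> carrier K; x \<in> U X a; y \<in> U X a \<rbrakk> \<Longrightarrow> dil X r x a y \<in> U X a"
    and affine:
      "a \<in> carrier X \<Longrightarrow>
        affine_space K (U X a) (\<lambda>x y z. \<Gamma> x a y a z) (\<lambda>r x y. dil X r x a y)"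
    and semitorsor_left:
      "\<lbrakk> a \<in> carrier X; b \<in> carrier X; x \<in> U X a; y \<in> U X b; z \<in> U X a \<rbrakk> \<Longrightarrow>
        \<Gamma> x a y b z \<in> U X a"
    and semitorsor_right:
      "\<lbrakk> a \<in> carrier X; b \<in> carrier X; x \<in> U X b; y \<in> U X a; z \<in> U X b \<rbrakk> \<Longrightarrow>
        \<Gamma> x a y b z \<in> U X b"

definition base_point :: "('x, 'm) gorder_scheme \<Rightarrow> 'x \<Rightarrow> 'x \<Rightarrow> bool" where
  "base_point X p m \<longleftrightarrow> p \<in> carrier X \<and> m \<in> carrier X \<and> transversal X p m"

definition transversal_triple :: "('x, 'm) gorder_scheme \<Rightarrow> 'x \<Rightarrow> 'x \<Rightarrow> 'x \<Rightarrow> bool" where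
  "transversal_triple X a b c \<longleftrightarrow>
     a \<in> carrier X \<and> b \<in> carrier X \<and> c \<in> carrier X \<and>
     transversal X a b \<and> transversal X b c \<and> transversal X a c"

text \<open>The module \<open>U\<^sub>a\<close> with origin \<open>p\<close>.\<close>

definition U_module :: "('x, 'k, 'm) geometry_scheme \<Rightarrow> 'x \<Rightarrow> 'x \<Rightarrow> ('k, 'x) module" where
  "U_module X a p = linearization (U X a) (\<lambda>x y z. gam X x a y a z) (\<lambda>r x y. dil X r x a y) p"

text \<open>
  The associative pair of \<open>(X; p, m)\<close>, where \<open>p = o\<^sup>+\<close> and \<open>m = o\<^sup>-\<close>, consists of the modules
  \<open>U_module X m p\<close> and \<open>U_module X p m\<close>.  Both of its products are restrictions of the same ternary
  map \<open>(x, y, z) \<mapsto> \<Gamma>(x, o\<^sup>-, y, o\<^sup>+, z)\<close>.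
\<close>

definition pair_product :: "('x, 'k, 'm) geometry_scheme \<Rightarrow> 'x \<Rightarrow> 'x \<Rightarrow> 'x \<Rightarrow> 'x \<Rightarrow> 'x \<Rightarrow> 'x" where
  "pair_product X p m x y z = gam X x m y p z"

text \<open>The algebra of the transversal triple \<open>(a, b, c)\<close>.\<close>

definition triple_algebra :: "('x, 'k, 'm) geometry_scheme \<Rightarrow> 'x \<Rightarrow> 'x \<Rightarrow> 'x \<Rightarrow> ('k, 'x) module" where
  "triple_algebra X a b c =
     (U_module X c a) \<lparr> monoid.mult := (\<lambda>x z. gam X x a b c z), one := b \<rparr>"


section \<open>The types of the points of the geometries to be constructed\<close>

text \<open>
  HOL cannot quantify existentially over types, so the existence of a geometry is asserted on types
  large enough to carry it.  For an algebra \<open>A\<close>, these are sets of elements of \<open>A \<oplus> A\<close>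
  (submodules of \<open>A\<^sup>2\<close>).  For a pair \<open>(A\<^sup>+, A\<^sup>-)\<close>, these are sets of elements of an
  associative algebra of matrices with off-diagonal entries in \<open>A\<^sup>+\<close> and \<open>A\<^sup>-\<close> and diagonal
  entries in \<open>End(A\<^sup>+) \<times> End(A\<^sup>-)\<close> (right ideals of a standard imbedding of the pair).
\<close>

type_synonym 'a algebra_point = "('a \<times> 'a) set"

type_synonym ('a, 'b) pair_point =
  "((('a \<Rightarrow> 'a) \<times> ('b \<Rightarrow> 'b)) \<times> 'a \<times> 'b \<times> (('a \<Rightarrow> 'a) \<times> ('b \<Rightarrow> 'b))) set"

end

theory Submission
  imports Defs
begin

text \<open>
  The Grassmannian of all submodules of a \<open>K\<close>-module \<open>W\<close> stable under a set \<open>\<Omega>\<close> of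
  \<open>K\<close>-linear operators is an associative geometry, with \<open>\<Gamma>\<close> and \<open>\<Pi>\<^sub>r\<close> defined by
  elementwise additive conditions.  The structurality axioms hold because the partial maps of \<open>\<Gamma>\<close>
  are images under linear relations, the partner being the image under the converse relation.
  If \<open>W = p \<oplus> q\<close>, the complements of \<open>q\<close> are the graphs of the
  \<open>\<Omega>\<close>-equivariant maps \<open>p \<rightarrow> q\<close>; on graphs \<open>\<Gamma>(x, q, p, q, z)\<close> is addition and
  \<open>\<Gamma>(x, q, y, p, z)\<close> is the composition \<open>x \<circ> y \<circ> z\<close>.  It remains to choose \<open>W\<close> and
  \<open>\<Omega>\<close> such that \<open>p\<close> is generated by one element whose possible images are the elements of the
  given algebra or pair: \<open>A\<^sup>2\<close> as a left \<open>A\<close>-module, and a standard imbedding of the pair as a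
  right module over itself.
\<close>

section \<open>Grassmannians as associative geometries\<close>

text \<open>The fact behind the choice of \<open>W\<close> is that, for an idempotent e of a ring R,
  the R-linear maps from eR to (1 - e)R are the left multiplications by elements of (1 - e)Re. For a
  pair, this corner has to be the plus module and e R (1 - e) the minus module. The obstacle is that
  a pair has neither a unit nor products of two elements, so the diagonal corners have to be
  invented. Their elements are recorded by how they act: an entry of the first corner multiplies
  plus elements from the right and minus elements from the left, hence it is a couple of maps, tied
  together by those associative laws that the matrix product imposes. The unit e is then available
  at once and closure is a calculation, while the off-diagonal corners, the only ones visible in the
  result, stay the same. A second constraint is that \<open>\<Gamma>\<close> must be total. Formulas
  with projections make sense only for transversal arguments, therefore everything is phrased with
  relations, and maps enter only through graphs.\<close>

context module
begin

text \<open>Lets \<open>algebra\<close> normalise identities in a module, using the laws of the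
  additive group and the distribution of scalars over sums and negatives. Most witnesses for
  membership in \<open>rel_gam\<close> and \<open>rel_dil\<close> are checked this way.\<close>

lemmas module_simprules [algebra ring "zero M" "add M" "a_inv M" "a_minus M" "one M" "mult M"] =
  M.a_closed M.zero_closed M.a_inv_closed M.minus_closed M.a_assoc M.l_zero M.l_neg M.a_comm M.minus_eq
  M.r_zero M.r_neg M.r_neg2 M.r_neg1 M.minus_add M.minus_minus M.a_lcomm
  smult_closed smult_r_distr smult_r_minus smult_r_null

lemma minus_zero_right [simp]: "x \<in> carrier M \<Longrightarrow> x \<ominus>\<^bsub>M\<^esub> \<zero>\<^bsub>M\<^esub> = x"
  by (simp add: M.minus_eq)

lemma linear_map_minus:
  assumes "linear_map R M M T" "x \<in> carrier M" "y \<in> carrier M"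
  shows "T (x \<ominus>\<^bsub>M\<^esub> y) = T x \<ominus>\<^bsub>M\<^esub> T y"
proof -
  have T: "T x \<in> carrier M" "T y \<in> carrier M" "T (x \<ominus>\<^bsub>M\<^esub> y) \<in> carrier M"
    using assms unfolding linear_map_def by auto
  have "T x = T ((x \<ominus>\<^bsub>M\<^esub> y) \<oplus>\<^bsub>M\<^esub> y)"
    using assms by (intro arg_cong[of _ _ T]) algebra
  also have "\<dots> = T (x \<ominus>\<^bsub>M\<^esub> y) \<oplus>\<^bsub>M\<^esub> T y"
    using assms unfolding linear_map_def by auto
  finally have *: "T x = T (x \<ominus>\<^bsub>M\<^esub> y) \<oplus>\<^bsub>M\<^esub> T y" .
  show ?thesis unfolding * using T by algebra
qed

end

text \<open>\<open>\<Omega>\<close> is a bare set of operators rather than a ring acting on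
  \<open>W\<close>. Only invariance of submodules and equivariance of maps matter, so the matrices
  used for pairs never have to be shown to form a ring.\<close>

locale operator_module = module K W
  for K :: "('k, 'r) ring_scheme" and W :: "('k, 'w, 'm) module_scheme" (structure) +
  fixes \<Omega> :: "('w \<Rightarrow> 'w) set"
  assumes op_linear: "T \<in> \<Omega> \<Longrightarrow> linear_map K W W T"
begin

definition points :: "'w set set" where
  "points = {S. submodule S K W \<and> (\<forall>T\<in>\<Omega>. T ` S \<subseteq> S)}"

text \<open>
  Equivalently \<open>w = \<zeta> + \<alpha> = \<xi> + \<beta> = \<alpha> + \<eta> + \<beta>\<close> with \<open>\<xi>, \<alpha>, \<eta>, \<beta>, \<zeta>\<close> in \<open>x, a, y, b, z\<close>.
\<close>

definition rel_gam :: "'w set \<Rightarrow> 'w set \<Rightarrow> 'w set \<Rightarrow> 'w set \<Rightarrow> 'w set \<Rightarrow> 'w set" where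
  "rel_gam x a y b z =
     {w \<in> carrier W. \<exists>\<alpha>\<in>a. \<exists>\<beta>\<in>b. w \<ominus> \<alpha> \<in> z \<and> w \<ominus> \<beta> \<in> x \<and> w \<ominus> \<alpha> \<ominus> \<beta> \<in> y}"

text \<open>With \<eta> = \<xi> + \<alpha> the element is (1 - r) \<xi> + r \<eta>: an affine
  combination of points of \<open>x\<close> and \<open>y\<close> that agree modulo
  \<open>a\<close>.\<close>

definition rel_dil :: "'k \<Rightarrow> 'w set \<Rightarrow> 'w set \<Rightarrow> 'w set \<Rightarrow> 'w set" where
  "rel_dil r x a y = {\<xi> \<oplus> r \<odot> \<alpha> | \<xi> \<alpha>. \<xi> \<in> x \<and> \<alpha> \<in> a \<and> \<xi> \<oplus> \<alpha> \<in> y}"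

definition geom :: "('w set, 'k) geometry" where
  "geom = \<lparr> carrier = points, eq = (=), le = (\<subseteq>), gam = rel_gam, dil = rel_dil \<rparr>"

lemma geom_simps [simp]:
  "carrier geom = points" "eq geom = (=)" "le geom = (\<subseteq>)" "gam geom = rel_gam" "dil geom = rel_dil"
  by (simp_all add: geom_def)

section \<open>The complete lattice of invariant submodules\<close>

lemma pointsD:
  assumes "S \<in> points"
  shows "S \<subseteq> carrier W" "\<zero> \<in> S"
    "\<And>u v. u \<in> S \<Longrightarrow> v \<in> S \<Longrightarrow> u \<oplus> v \<in> S"
    "\<And>u. u \<in> S \<Longrightarrow> \<ominus> u \<in> S"
    "\<And>u v. u \<in> S \<Longrightarrow> v \<in> S \<Longrightarrow> u \<ominus> v \<in> S"
    "\<And>r u. r \<in> carrier K \<Longrightarrow> u \<in> S \<Longrightarrow> r \<odot> u \<in> S"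
    "\<And>T u. T \<in> \<Omega> \<Longrightarrow> u \<in> S \<Longrightarrow> T u \<in> S"
proof -
  have S: "submodule S K W" using assms by (simp add: points_def)
  note E = submoduleE[OF S]
  show "S \<subseteq> carrier W" "\<And>u v. u \<in> S \<Longrightarrow> v \<in> S \<Longrightarrow> u \<oplus> v \<in> S" "\<And>u. u \<in> S \<Longrightarrow> \<ominus> u \<in> S"
    "\<And>r u. r \<in> carrier K \<Longrightarrow> u \<in> S \<Longrightarrow> r \<odot> u \<in> S"
    using E by auto
  then show "\<And>u v. u \<in> S \<Longrightarrow> v \<in> S \<Longrightarrow> u \<ominus> v \<in> S"
    by (simp add: M.minus_eq)
  obtain u where "u \<in> S" using E by auto
  then have "u \<oplus> \<ominus> u \<in> S" "u \<in> carrier W" using E by auto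
  then show "\<zero> \<in> S" by (simp add: M.r_neg)
  show "\<And>T u. T \<in> \<Omega> \<Longrightarrow> u \<in> S \<Longrightarrow> T u \<in> S" using assms by (auto simp: points_def)
qed

lemma points_carrier: "S \<in> points \<Longrightarrow> u \<in> S \<Longrightarrow> u \<in> carrier W"
  using pointsD(1) by blast

lemma pointsI:
  assumes sub: "S \<subseteq> carrier W" and zero: "\<zero> \<in> S"
    and add: "\<And>u v. u \<in> S \<Longrightarrow> v \<in> S \<Longrightarrow> u \<oplus> v \<in> S"
    and smult: "\<And>r u. r \<in> carrier K \<Longrightarrow> u \<in> S \<Longrightarrow> r \<odot> u \<in> S"
    and op: "\<And>T u. T \<in> \<Omega> \<Longrightarrow> u \<in> S \<Longrightarrow> T u \<in> S"
  shows "S \<in> points"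
proof -
  have "\<ominus> u \<in> S" if "u \<in> S" for u
  proof -
    have "(\<ominus>\<^bsub>K\<^esub> \<one>\<^bsub>K\<^esub>) \<odot> u = \<ominus> u" using that sub by (subst smult_l_minus) auto
    then show ?thesis using smult[of "\<ominus>\<^bsub>K\<^esub> \<one>\<^bsub>K\<^esub>" u] that by simp
  qed
  then have "submodule S K W" using assms by (intro submoduleI) auto
  then show ?thesis using op by (auto simp: points_def)
qed

lemma op_add:
  "T \<in> \<Omega> \<Longrightarrow> u \<in> carrier W \<Longrightarrow> v \<in> carrier W \<Longrightarrow> T (u \<oplus> v) = T u \<oplus> T v"
  and op_smult: "T \<in> \<Omega> \<Longrightarrow> r \<in> carrier K \<Longrightarrow> u \<in> carrier W \<Longrightarrow> T (r \<odot> u) = r \<odot> T u"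
  and op_closed: "T \<in> \<Omega> \<Longrightarrow> u \<in> carrier W \<Longrightarrow> T u \<in> carrier W"
  using op_linear[of T] unfolding linear_map_def by auto

lemma op_minus:
  "T \<in> \<Omega> \<Longrightarrow> u \<in> carrier W \<Longrightarrow> v \<in> carrier W \<Longrightarrow> T (u \<ominus> v) = T u \<ominus> T v"
  using linear_map_minus op_linear by blast

lemma op_zero: "T \<in> \<Omega> \<Longrightarrow> T \<zero> = \<zero>"
  using op_minus[of T \<zero> \<zero>] op_closed[of T \<zero>] by (simp add: M.minus_eq M.r_neg)

lemma zero_point: "{\<zero>} \<in> points"
  by (rule pointsI) (auto simp: op_zero)

lemma carrier_point: "carrier W \<in> points"
  by (rule pointsI) (auto simp: op_closed)

lemma Inter_point:
  assumes "\<A> \<subseteq> points" "\<A> \<noteq> {}"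
  shows "\<Inter>\<A> \<in> points"
proof (rule pointsI)
  show "\<Inter>\<A> \<subseteq> carrier W" using assms points_carrier by blast
  have A: "S \<in> points" if "S \<in> \<A>" for S using that assms by blast
  show "\<zero> \<in> \<Inter>\<A>" using pointsD(2)[OF A] by blast
  show "u \<oplus> v \<in> \<Inter>\<A>" if "u \<in> \<Inter>\<A>" "v \<in> \<Inter>\<A>" for u v
    using that pointsD(3)[OF A] by (intro InterI) auto
  show "r \<odot> u \<in> \<Inter>\<A>" if "r \<in> carrier K" "u \<in> \<Inter>\<A>" for r u
    using that pointsD(6)[OF A] by (intro InterI) auto
  show "T u \<in> \<Inter>\<A>" if "T \<in> \<Omega>" "u \<in> \<Inter>\<A>" for T u
    using that pointsD(7)[OF A] by (intro InterI) auto
qed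

lemma inter_point: "x \<in> points \<Longrightarrow> y \<in> points \<Longrightarrow> x \<inter> y \<in> points"
  using Inter_point[of "{x, y}"] by simp

definition sum_set :: "'w set \<Rightarrow> 'w set \<Rightarrow> 'w set" where
  "sum_set x y = {u \<oplus> v | u v. u \<in> x \<and> v \<in> y}"

lemma sum_setI: "u \<in> x \<Longrightarrow> v \<in> y \<Longrightarrow> u \<oplus> v \<in> sum_set x y"
  by (auto simp: sum_set_def)

lemma sum_point:
  assumes x: "x \<in> points" and y: "y \<in> points"
  shows "sum_set x y \<in> points"
proof (rule pointsI)
  note [simp] = points_carrier[OF x] points_carrier[OF y]
  show "sum_set x y \<subseteq> carrier W" by (auto simp: sum_set_def)
  show "\<zero> \<in> sum_set x y"
    using sum_setI[OF pointsD(2)[OF x] pointsD(2)[OF y]] by simp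
  fix u v assume "u \<in> sum_set x y" "v \<in> sum_set x y"
  then obtain a b c d where *: "u = a \<oplus> b" "v = c \<oplus> d" "a \<in> x" "b \<in> y" "c \<in> x" "d \<in> y"
    unfolding sum_set_def by auto
  then have "u \<oplus> v = (a \<oplus> c) \<oplus> (b \<oplus> d)" "a \<oplus> c \<in> x" "b \<oplus> d \<in> y"
    using pointsD(3)[OF x] pointsD(3)[OF y] by (auto simp: M.a_ac)
  then show "u \<oplus> v \<in> sum_set x y" unfolding sum_set_def by blast
next
  note [simp] = points_carrier[OF x] points_carrier[OF y]
  fix r u assume r: "r \<in> carrier K" and "u \<in> sum_set x y"
  then obtain a b where *: "u = a \<oplus> b" "a \<in> x" "b \<in> y" unfolding sum_set_def by auto
  then have "r \<odot> u = r \<odot> a \<oplus> r \<odot> b" "r \<odot> a \<in> x" "r \<odot> b \<in> y"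
    using r pointsD(6)[OF x] pointsD(6)[OF y] by (auto simp: smult_r_distr)
  then show "r \<odot> u \<in> sum_set x y" unfolding sum_set_def by blast
next
  note [simp] = points_carrier[OF x] points_carrier[OF y]
  fix T u assume T: "T \<in> \<Omega>" and "u \<in> sum_set x y"
  then obtain a b where *: "u = a \<oplus> b" "a \<in> x" "b \<in> y" unfolding sum_set_def by auto
  then have "T u = T a \<oplus> T b" "T a \<in> x" "T b \<in> y"
    using T pointsD(7)[OF x] pointsD(7)[OF y] by (auto simp: op_add)
  then show "T u \<in> sum_set x y" unfolding sum_set_def by blast
qed

text \<open>Intersections suffice: the criterion asks for a greatest element and for infima of
  nonempty families, so infinite sums never occur.\<close>

lemma geom_complete_lattice: "complete_lattice geom"
proof -
  interpret partial_order geom by standard auto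
  show ?thesis
  proof (rule complete_lattice_criterion1)
    have "greatest geom (carrier W) (carrier geom)"
      using carrier_point pointsD(1) by (auto simp: greatest_def)
    then show "\<exists>g. greatest geom g (carrier geom)" by blast
  next
    fix A assume A: "A \<subseteq> carrier geom" "A \<noteq> {}"
    then have "greatest geom (\<Inter>A) (Lower geom A)"
      using Inter_point[of A] by (auto simp: greatest_def Lower_def)
    then show "\<exists>i. greatest geom i (Lower geom A)" by blast
  qed
qed

sublocale geom: complete_lattice geom
  by (rule geom_complete_lattice)

lemma geom_meet:
  assumes "x \<in> points" "y \<in> points"
  shows "x \<sqinter>\<^bsub>geom\<^esub> y = x \<inter> y"
proof -
  have "greatest geom (x \<inter> y) (Lower geom {x, y})"
    using assms inter_point by (auto simp: greatest_def Lower_def)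
  moreover have "greatest geom (x \<sqinter>\<^bsub>geom\<^esub> y) (Lower geom {x, y})"
    unfolding meet_def using assms by (intro geom.inf_of_two_greatest) auto
  ultimately show ?thesis by (intro geom.greatest_unique)
qed

lemma geom_join:
  assumes x: "x \<in> points" and y: "y \<in> points"
  shows "x \<squnion>\<^bsub>geom\<^esub> y = sum_set x y"
proof -
  have "u \<in> sum_set x y" if "u \<in> x" for u
    using sum_setI[OF that pointsD(2)[OF y]] points_carrier[OF x that] by simp
  moreover have "u \<in> sum_set x y" if "u \<in> y" for u
    using sum_setI[OF pointsD(2)[OF x] that] points_carrier[OF y that] by simp
  moreover have "sum_set x y \<subseteq> z" if "z \<in> points" "x \<subseteq> z" "y \<subseteq> z" for z
    using that pointsD(3) unfolding sum_set_def by blast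
  ultimately have "least geom (sum_set x y) (Upper geom {x, y})"
    using x y sum_point by (auto simp: least_def Upper_def)
  moreover have "least geom (x \<squnion>\<^bsub>geom\<^esub> y) (Upper geom {x, y})"
    unfolding join_def using assms by (intro geom.sup_of_two_least) auto
  ultimately show ?thesis by (intro geom.least_unique)
qed

lemma geom_bottom: "\<bottom>\<^bsub>geom\<^esub> = {\<zero>}"
proof -
  have "least geom {\<zero>} (carrier geom)"
    using zero_point pointsD(2) by (auto simp: least_def)
  then show ?thesis by (rule geom.least_unique[OF geom.bottom_least])
qed

lemma geom_top: "\<top>\<^bsub>geom\<^esub> = carrier W"
proof -
  have "greatest geom (carrier W) (carrier geom)"
    using carrier_point pointsD(1) by (auto simp: greatest_def)
  then show ?thesis by (rule geom.greatest_unique[OF geom.top_greatest])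
qed

text \<open>Transversality in elementary form. Membership in \<open>points\<close> is included, so
  that a single hypothesis carries all that later rules need, and only the two nontrivial inclusions
  are recorded.\<close>

definition compl :: "'w set \<Rightarrow> 'w set \<Rightarrow> bool" where
  "compl x y \<longleftrightarrow> x \<in> points \<and> y \<in> points \<and> x \<inter> y \<subseteq> {\<zero>} \<and> carrier W \<subseteq> sum_set x y"

lemma transversal_iff:
  assumes "x \<in> points" "y \<in> points"
  shows "transversal geom x y \<longleftrightarrow> compl x y"
  using assms geom_meet[OF assms] geom_join[OF assms] pointsD(1)[OF sum_point[OF assms]]
    pointsD(2)[of x] pointsD(2)[of y]
  by (auto simp: transversal_def geom_bottom geom_top compl_def)

lemma U_iff: "a \<in> points \<Longrightarrow> x \<in> U geom a \<longleftrightarrow> compl x a"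
  by (cases "x \<in> points") (auto simp: U_def transversal_iff compl_def)

lemma complD:
  assumes "compl x y"
  shows "x \<in> points" "y \<in> points" "\<And>u. u \<in> x \<Longrightarrow> u \<in> y \<Longrightarrow> u = \<zero>"
  using assms by (auto simp: compl_def)

lemma compl_decomp:
  assumes "compl x y" "w \<in> carrier W"
  obtains u v where "w = u \<oplus> v" "u \<in> x" "v \<in> y"
  using assms by (auto simp: compl_def sum_set_def)

lemma complI:
  assumes "x \<in> points" "y \<in> points" "\<And>u. u \<in> x \<Longrightarrow> u \<in> y \<Longrightarrow> u = \<zero>"
    "\<And>w. w \<in> carrier W \<Longrightarrow> \<exists>u\<in>x. \<exists>v\<in>y. w = u \<oplus> v"
  shows "compl x y"
  using assms unfolding compl_def sum_set_def by blast

lemma compl_sym: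
  assumes "compl x y"
  shows "compl y x"
proof (rule complI)
  note xy = complD[OF assms]
  show "y \<in> points" "x \<in> points" "\<And>u. u \<in> y \<Longrightarrow> u \<in> x \<Longrightarrow> u = \<zero>"
    using xy by auto
  fix w assume "w \<in> carrier W"
  then obtain u v where uv: "w = u \<oplus> v" "u \<in> x" "v \<in> y" using compl_decomp[OF assms] by blast
  then have "w = v \<oplus> u" using M.a_comm points_carrier xy by simp
  then show "\<exists>u\<in>y. \<exists>v\<in>x. w = u \<oplus> v" using uv by blast
qed

text \<open>The modular law: if w in \<open>y\<close> splits as u + v along \<open>x\<close> and
  \<open>a\<close>, then v = w - u lies in \<open>y\<close> and in \<open>a\<close>, hence vanishes.
  This halves the later work, since an identity between two complements of \<open>a\<close> follows
  from the one inclusion whose witnesses are easy to write down.\<close>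

lemma compl_eq:
  assumes "compl x a" "compl y a" "x \<subseteq> y"
  shows "x = y"
proof (intro equalityI assms(3) subsetI)
  fix w assume w: "w \<in> y"
  note x = complD[OF assms(1)] and y = complD[OF assms(2)]
  then have wW: "w \<in> carrier W" using w points_carrier by blast
  then obtain u v where uv: "w = u \<oplus> v" "u \<in> x" "v \<in> a" using compl_decomp[OF assms(1)] by blast
  then have c: "u \<in> carrier W" "v \<in> carrier W" using x points_carrier by auto
  have "w \<ominus> u = v" unfolding uv(1) using c by algebra
  then have "v \<in> y" using w uv(2) assms(3) pointsD(5)[OF y(1)] by blast
  then have "v = \<zero>" using y uv by blast
  then show "w \<in> x" using uv c by simp
qed

section \<open>Symmetries and closure properties of the two operations\<close>

lemma gamI:
  assumes "w \<in> carrier W" "\<alpha> \<in> a" "\<beta> \<in> b" "w \<ominus> \<alpha> = \<zeta>" "\<zeta> \<in> z" "w \<ominus> \<beta> = \<xi>" "\<xi> \<in> x" "\<zeta> \<ominus> \<beta> = \<eta>" "\<eta> \<in> y"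
  shows "w \<in> rel_gam x a y b z"
  unfolding rel_gam_def using assms by blast

lemma gamE:
  assumes "w \<in> rel_gam x a y b z"
  obtains \<alpha> \<beta> where "w \<in> carrier W" "\<alpha> \<in> a" "\<beta> \<in> b" "w \<ominus> \<alpha> \<in> z" "w \<ominus> \<beta> \<in> x" "w \<ominus> \<alpha> \<ominus> \<beta> \<in> y"
  using assms unfolding rel_gam_def by blast

lemma gam_swap_subset:
  assumes "a \<in> points" "b \<in> points"
  shows "rel_gam x a y b z \<subseteq> rel_gam z b y a x"
proof
  fix w assume "w \<in> rel_gam x a y b z"
  then obtain \<alpha> \<beta> where m: "w \<in> carrier W" "\<alpha> \<in> a" "\<beta> \<in> b" "w \<ominus> \<alpha> \<in> z" "w \<ominus> \<beta> \<in> x" "w \<ominus> \<alpha> \<ominus> \<beta> \<in> y"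
    by (rule gamE)
  then have c: "\<alpha> \<in> carrier W" "\<beta> \<in> carrier W" using assms points_carrier by auto
  show "w \<in> rel_gam z b y a x"
    by (rule gamI[OF m(1,3,2) refl m(5) refl m(4) _ m(6)]) (use m(1) c in algebra)
qed

lemma gam_swap:
  "a \<in> points \<Longrightarrow> b \<in> points \<Longrightarrow> rel_gam x a y b z = rel_gam z b y a x"
  using gam_swap_subset by (intro equalityI)

text \<open>Shifts and remainders trade places: \<xi> = w - \<beta> and \<zeta> = w - \<alpha>
  become the shifts, leaving the remainders \<beta> and \<alpha>. The middle remainder \<eta> turns
  into its negative, which \<open>y\<close> also contains.\<close>

lemma gam_flip_subset:
  assumes "a \<in> points" "b \<in> points" "y \<in> points"
  shows "rel_gam x a y b z \<subseteq> rel_gam a x y z b"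
proof
  fix w assume "w \<in> rel_gam x a y b z"
  then obtain \<alpha> \<beta> where m: "w \<in> carrier W" "\<alpha> \<in> a" "\<beta> \<in> b" "w \<ominus> \<alpha> \<in> z" "w \<ominus> \<beta> \<in> x" "w \<ominus> \<alpha> \<ominus> \<beta> \<in> y"
    by (rule gamE)
  then have c: "\<alpha> \<in> carrier W" "\<beta> \<in> carrier W" using assms points_carrier by auto
  show "w \<in> rel_gam a x y z b"
  proof (rule gamI[OF m(1,5,4) _ m(3) _ m(2) _ pointsD(4)[OF assms(3) m(6)]])
    show "w \<ominus> (w \<ominus> \<beta>) = \<beta>" "w \<ominus> (w \<ominus> \<alpha>) = \<alpha>" "\<beta> \<ominus> (w \<ominus> \<alpha>) = \<ominus> (w \<ominus> \<alpha> \<ominus> \<beta>)"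
      using m(1) c by algebra+
  qed
qed

lemma gam_flip:
  assumes "x \<in> points" "a \<in> points" "y \<in> points" "b \<in> points" "z \<in> points"
  shows "rel_gam x a y b z = rel_gam a x y z b"
  using assms gam_flip_subset by (intro equalityI)

lemma gam_point:
  assumes "x \<in> points" "a \<in> points" "y \<in> points" "b \<in> points" "z \<in> points"
  shows "rel_gam x a y b z \<in> points"
proof (rule pointsI)
  show "rel_gam x a y b z \<subseteq> carrier W" unfolding rel_gam_def by blast
  have "\<zero> \<in> x" "\<zero> \<in> a" "\<zero> \<in> y" "\<zero> \<in> b" "\<zero> \<in> z" using assms pointsD(2) by auto
  then show "\<zero> \<in> rel_gam x a y b z"
    by (intro gamI[of \<zero> \<zero> _ \<zero> _ \<zero> _ \<zero> _ \<zero>]) (auto simp: M.minus_eq)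
next
  fix u v assume "u \<in> rel_gam x a y b z" "v \<in> rel_gam x a y b z"
  then obtain \<alpha> \<beta> \<alpha>' \<beta>' where
    m: "u \<in> carrier W" "\<alpha> \<in> a" "\<beta> \<in> b" "u \<ominus> \<alpha> \<in> z" "u \<ominus> \<beta> \<in> x" "u \<ominus> \<alpha> \<ominus> \<beta> \<in> y" and
    n: "v \<in> carrier W" "\<alpha>' \<in> a" "\<beta>' \<in> b" "v \<ominus> \<alpha>' \<in> z" "v \<ominus> \<beta>' \<in> x" "v \<ominus> \<alpha>' \<ominus> \<beta>' \<in> y"
    by (elim gamE)
  have c: "\<alpha> \<in> carrier W" "\<beta> \<in> carrier W" "\<alpha>' \<in> carrier W" "\<beta>' \<in> carrier W"
    using m n assms points_carrier by auto
  show "u \<oplus> v \<in> rel_gam x a y b z"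
  proof (rule gamI[where \<alpha> = "\<alpha> \<oplus> \<alpha>'" and \<beta> = "\<beta> \<oplus> \<beta>'"])
    show "(u \<oplus> v) \<ominus> (\<alpha> \<oplus> \<alpha>') = (u \<ominus> \<alpha>) \<oplus> (v \<ominus> \<alpha>')"
      "(u \<oplus> v) \<ominus> (\<beta> \<oplus> \<beta>') = (u \<ominus> \<beta>) \<oplus> (v \<ominus> \<beta>')"
      "((u \<ominus> \<alpha>) \<oplus> (v \<ominus> \<alpha>')) \<ominus> (\<beta> \<oplus> \<beta>') = (u \<ominus> \<alpha> \<ominus> \<beta>) \<oplus> (v \<ominus> \<alpha>' \<ominus> \<beta>')"
      using m(1) n(1) c by algebra+
  qed (use assms m n pointsD(3) in auto)
next
  fix r u assume r: "r \<in> carrier K" and "u \<in> rel_gam x a y b z"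
  then obtain \<alpha> \<beta> where
    m: "u \<in> carrier W" "\<alpha> \<in> a" "\<beta> \<in> b" "u \<ominus> \<alpha> \<in> z" "u \<ominus> \<beta> \<in> x" "u \<ominus> \<alpha> \<ominus> \<beta> \<in> y"
    by (elim gamE)
  have c: "\<alpha> \<in> carrier W" "\<beta> \<in> carrier W" using m assms points_carrier by auto
  show "r \<odot> u \<in> rel_gam x a y b z"
  proof (rule gamI[where \<alpha> = "r \<odot> \<alpha>" and \<beta> = "r \<odot> \<beta>"])
    show "r \<odot> u \<ominus> r \<odot> \<alpha> = r \<odot> (u \<ominus> \<alpha>)" "r \<odot> u \<ominus> r \<odot> \<beta> = r \<odot> (u \<ominus> \<beta>)"
      "r \<odot> (u \<ominus> \<alpha>) \<ominus> r \<odot> \<beta> = r \<odot> (u \<ominus> \<alpha> \<ominus> \<beta>)"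
      using m(1) c r by algebra+
  qed (use assms m r pointsD(6) in auto)
next
  fix T u assume T: "T \<in> \<Omega>" and "u \<in> rel_gam x a y b z"
  then obtain \<alpha> \<beta> where
    m: "u \<in> carrier W" "\<alpha> \<in> a" "\<beta> \<in> b" "u \<ominus> \<alpha> \<in> z" "u \<ominus> \<beta> \<in> x" "u \<ominus> \<alpha> \<ominus> \<beta> \<in> y"
    by (elim gamE)
  have c: "\<alpha> \<in> carrier W" "\<beta> \<in> carrier W" using m assms points_carrier by auto
  show "T u \<in> rel_gam x a y b z"
  proof (rule gamI[where \<alpha> = "T \<alpha>" and \<beta> = "T \<beta>"])
    show "T u \<ominus> T \<alpha> = T (u \<ominus> \<alpha>)" "T u \<ominus> T \<beta> = T (u \<ominus> \<beta>)"
      "T (u \<ominus> \<alpha>) \<ominus> T \<beta> = T (u \<ominus> \<alpha> \<ominus> \<beta>)"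
      using m(1) c T by (auto simp: op_minus)
  qed (use assms m T pointsD(7) op_closed in auto)
qed

lemma dilI:
  "w = \<xi> \<oplus> r \<odot> \<alpha> \<Longrightarrow> \<xi> \<in> x \<Longrightarrow> \<alpha> \<in> a \<Longrightarrow> \<xi> \<oplus> \<alpha> \<in> y \<Longrightarrow> w \<in> rel_dil r x a y"
  unfolding rel_dil_def by blast

lemma dilE:
  assumes "w \<in> rel_dil r x a y"
  obtains \<xi> \<alpha> where "w = \<xi> \<oplus> r \<odot> \<alpha>" "\<xi> \<in> x" "\<alpha> \<in> a" "\<xi> \<oplus> \<alpha> \<in> y"
  using assms unfolding rel_dil_def by blast

lemma dil_point:
  assumes r: "r \<in> carrier K" and "x \<in> points" "a \<in> points" "y \<in> points"
  shows "rel_dil r x a y \<in> points"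
proof (rule pointsI)
  show "rel_dil r x a y \<subseteq> carrier W"
    unfolding rel_dil_def using assms points_carrier by auto
  have "\<zero> \<in> x" "\<zero> \<in> a" "\<zero> \<in> y" using assms pointsD(2) by auto
  then show "\<zero> \<in> rel_dil r x a y"
    by (intro dilI[of \<zero> \<zero> _ \<zero>]) (auto simp: r)
next
  fix u v assume "u \<in> rel_dil r x a y" "v \<in> rel_dil r x a y"
  then obtain \<xi> \<alpha> \<xi>' \<alpha>' where
    m: "u = \<xi> \<oplus> r \<odot> \<alpha>" "\<xi> \<in> x" "\<alpha> \<in> a" "\<xi> \<oplus> \<alpha> \<in> y" and
    n: "v = \<xi>' \<oplus> r \<odot> \<alpha>'" "\<xi>' \<in> x" "\<alpha>' \<in> a" "\<xi>' \<oplus> \<alpha>' \<in> y"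
    by (elim dilE)
  have c: "\<xi> \<in> carrier W" "\<alpha> \<in> carrier W" "\<xi>' \<in> carrier W" "\<alpha>' \<in> carrier W"
    using m n assms points_carrier by auto
  show "u \<oplus> v \<in> rel_dil r x a y"
  proof (rule dilI)
    show "u \<oplus> v = (\<xi> \<oplus> \<xi>') \<oplus> r \<odot> (\<alpha> \<oplus> \<alpha>')" unfolding m n using c r by algebra
    have "(\<xi> \<oplus> \<xi>') \<oplus> (\<alpha> \<oplus> \<alpha>') = (\<xi> \<oplus> \<alpha>) \<oplus> (\<xi>' \<oplus> \<alpha>')" using c by algebra
    then show "(\<xi> \<oplus> \<xi>') \<oplus> (\<alpha> \<oplus> \<alpha>') \<in> y" using pointsD(3)[OF assms(4) m(4) n(4)] by simp
  qed (use assms m n pointsD(3) in auto)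
next
  fix s u assume s: "s \<in> carrier K" and "u \<in> rel_dil r x a y"
  then obtain \<xi> \<alpha> where
    m: "u = \<xi> \<oplus> r \<odot> \<alpha>" "\<xi> \<in> x" "\<alpha> \<in> a" "\<xi> \<oplus> \<alpha> \<in> y"
    by (elim dilE)
  have c: "\<xi> \<in> carrier W" "\<alpha> \<in> carrier W" using m assms points_carrier by auto
  show "s \<odot> u \<in> rel_dil r x a y"
  proof (rule dilI)
    \<comment> \<open>Commutativity of \<open>K\<close> enters here, to interchange r and s.\<close>
    show "s \<odot> u = s \<odot> \<xi> \<oplus> r \<odot> (s \<odot> \<alpha>)"
      unfolding m using c r s by (simp add: smult_r_distr R.m_comm flip: smult_assoc1)
    show "s \<odot> \<xi> \<oplus> s \<odot> \<alpha> \<in> y"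
      using pointsD(6)[OF assms(4) s m(4)] c s by (simp add: smult_r_distr)
  qed (use assms m s pointsD(6) in auto)
next
  fix T u assume T: "T \<in> \<Omega>" and "u \<in> rel_dil r x a y"
  then obtain \<xi> \<alpha> where
    m: "u = \<xi> \<oplus> r \<odot> \<alpha>" "\<xi> \<in> x" "\<alpha> \<in> a" "\<xi> \<oplus> \<alpha> \<in> y"
    by (elim dilE)
  have c: "\<xi> \<in> carrier W" "\<alpha> \<in> carrier W" using m assms points_carrier by auto
  show "T u \<in> rel_dil r x a y"
  proof (rule dilI)
    show "T u = T \<xi> \<oplus> r \<odot> T \<alpha>" unfolding m using c r T by (simp add: op_add op_smult)
    show "T \<xi> \<oplus> T \<alpha> \<in> y"
      using pointsD(7)[OF assms(4) T m(4)] c T by (simp add: op_add)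
  qed (use assms m T pointsD(7) in auto)
qed

text \<open>Unfolding the nested occurrence on either side places the same five elements, w shifted
  by elements of \<open>a\<close> and \<open>b\<close>, in \<open>x\<close>, \<open>y\<close>,
  \<open>z\<close>, \<open>u\<close>, \<open>v\<close>. The two descriptions differ only in the
  elements from which the shifts are measured, so passing between them adds, subtracts or negates
  shifts inside \<open>a\<close> and inside \<open>b\<close>.\<close>

lemma gam_para_left:
  assumes "x \<in> points" "a \<in> points" "y \<in> points" "b \<in> points" "z \<in> points" "u \<in> points" "v \<in> points"
  shows "rel_gam (rel_gam x a y b z) a u b v = rel_gam x a (rel_gam u a z b y) b v"
proof (intro equalityI subsetI)
  fix w assume "w \<in> rel_gam (rel_gam x a y b z) a u b v"
  then obtain \<alpha> \<beta> \<alpha>' \<beta>' where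
    m: "w \<in> carrier W" "\<alpha> \<in> a" "\<beta> \<in> b" "w \<ominus> \<alpha> \<in> v" "w \<ominus> \<alpha> \<ominus> \<beta> \<in> u"
      "\<alpha>' \<in> a" "\<beta>' \<in> b" "w \<ominus> \<beta> \<ominus> \<alpha>' \<in> z" "w \<ominus> \<beta> \<ominus> \<beta>' \<in> x" "w \<ominus> \<beta> \<ominus> \<alpha>' \<ominus> \<beta>' \<in> y"
    by (elim gamE)
  have c: "\<alpha> \<in> carrier W" "\<beta> \<in> carrier W" "\<alpha>' \<in> carrier W" "\<beta>' \<in> carrier W"
    using m assms points_carrier by auto
  have p: "\<beta> \<oplus> \<beta>' \<in> b" "\<alpha>' \<ominus> \<alpha> \<in> a" "\<ominus> \<beta>' \<in> b" using m assms pointsD(3,4,5) by auto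
  show "w \<in> rel_gam x a (rel_gam u a z b y) b v"
  proof (rule gamI[OF m(1,2) p(1) refl m(4) _ m(9) refl])
    show "w \<ominus> (\<beta> \<oplus> \<beta>') = w \<ominus> \<beta> \<ominus> \<beta>'" using m(1) c by algebra
    show "w \<ominus> \<alpha> \<ominus> (\<beta> \<oplus> \<beta>') \<in> rel_gam u a z b y"
    proof (rule gamI[OF _ p(2,3) _ m(10) _ m(5) _ m(8)])
      show "w \<ominus> \<alpha> \<ominus> (\<beta> \<oplus> \<beta>') \<in> carrier W" using m(1) c by simp
      show "w \<ominus> \<alpha> \<ominus> (\<beta> \<oplus> \<beta>') \<ominus> (\<alpha>' \<ominus> \<alpha>) = w \<ominus> \<beta> \<ominus> \<alpha>' \<ominus> \<beta>'"
        "w \<ominus> \<alpha> \<ominus> (\<beta> \<oplus> \<beta>') \<ominus> \<ominus> \<beta>' = w \<ominus> \<alpha> \<ominus> \<beta>"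
        "w \<ominus> \<beta> \<ominus> \<alpha>' \<ominus> \<beta>' \<ominus> \<ominus> \<beta>' = w \<ominus> \<beta> \<ominus> \<alpha>'"
        using m(1) c by algebra+
    qed
  qed
next
  fix w assume "w \<in> rel_gam x a (rel_gam u a z b y) b v"
  then obtain \<alpha> \<beta> \<alpha>' \<beta>' where
    m: "w \<in> carrier W" "\<alpha> \<in> a" "\<beta> \<in> b" "w \<ominus> \<alpha> \<in> v" "w \<ominus> \<beta> \<in> x"
      "\<alpha>' \<in> a" "\<beta>' \<in> b" "w \<ominus> \<alpha> \<ominus> \<beta> \<ominus> \<alpha>' \<in> y" "w \<ominus> \<alpha> \<ominus> \<beta> \<ominus> \<beta>' \<in> u"
      "w \<ominus> \<alpha> \<ominus> \<beta> \<ominus> \<alpha>' \<ominus> \<beta>' \<in> z"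
    by (elim gamE)
  have c: "\<alpha> \<in> carrier W" "\<beta> \<in> carrier W" "\<alpha>' \<in> carrier W" "\<beta>' \<in> carrier W"
    using m assms points_carrier by auto
  have p: "\<beta> \<oplus> \<beta>' \<in> b" "\<alpha>' \<oplus> \<alpha> \<in> a" "\<ominus> \<beta>' \<in> b" using m assms pointsD(3,4,5) by auto
  show "w \<in> rel_gam (rel_gam x a y b z) a u b v"
  proof (rule gamI[OF m(1,2) p(1) refl m(4) refl _ _ m(9)])
    show "w \<ominus> \<alpha> \<ominus> (\<beta> \<oplus> \<beta>') = w \<ominus> \<alpha> \<ominus> \<beta> \<ominus> \<beta>'" using m(1) c by algebra
    show "w \<ominus> (\<beta> \<oplus> \<beta>') \<in> rel_gam x a y b z"
    proof (rule gamI[OF _ p(2,3) _ m(10) _ m(5) _ m(8)])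
      show "w \<ominus> (\<beta> \<oplus> \<beta>') \<in> carrier W" using m(1) c by simp
      show "w \<ominus> (\<beta> \<oplus> \<beta>') \<ominus> (\<alpha>' \<oplus> \<alpha>) = w \<ominus> \<alpha> \<ominus> \<beta> \<ominus> \<alpha>' \<ominus> \<beta>'"
        "w \<ominus> (\<beta> \<oplus> \<beta>') \<ominus> \<ominus> \<beta>' = w \<ominus> \<beta>"
        "w \<ominus> \<alpha> \<ominus> \<beta> \<ominus> \<alpha>' \<ominus> \<beta>' \<ominus> \<ominus> \<beta>' = w \<ominus> \<alpha> \<ominus> \<beta> \<ominus> \<alpha>'"
        using m(1) c by algebra+
    qed
  qed
qed

text \<open>Reading all arguments backwards, which \<open>gam_swap\<close> permits, turns this law
  into the previous one with \<open>a\<close> and \<open>b\<close> exchanged.\<close>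

lemma gam_para_right:
  assumes "x \<in> points" "a \<in> points" "y \<in> points" "b \<in> points" "z \<in> points" "u \<in> points" "v \<in> points"
  shows "rel_gam x a (rel_gam u a z b y) b v = rel_gam x a y b (rel_gam z a u b v)"
proof -
  have "rel_gam x a y b (rel_gam z a u b v) = rel_gam (rel_gam v b u a z) b y a x"
    by (simp only: gam_swap[OF assms(2,4), of z u v] gam_swap[OF assms(2,4), of x y])
  also have "\<dots> = rel_gam v b (rel_gam y b z a u) a x"
    using assms by (intro gam_para_left)
  also have "\<dots> = rel_gam x a (rel_gam u a z b y) b v"
    by (simp only: gam_swap[OF assms(4,2), of y z u] gam_swap[OF assms(4,2), of v _ x])
  finally show ?thesis by simp
qed

section \<open>Linear relations and the structurality axioms\<close>

definition linear_relation :: "('w \<times> 'w) set \<Rightarrow> bool" where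
  "linear_relation F \<longleftrightarrow> F \<subseteq> carrier W \<times> carrier W \<and>
     (\<forall>u u' v v'. (u, u') \<in> F \<longrightarrow> (v, v') \<in> F \<longrightarrow> (u \<oplus> v, u' \<oplus> v') \<in> F) \<and>
     (\<forall>r\<in>carrier K. \<forall>u u'. (u, u') \<in> F \<longrightarrow> (r \<odot> u, r \<odot> u') \<in> F)"

lemma linear_relationD:
  assumes "linear_relation F"
  shows "(u, u') \<in> F \<Longrightarrow> u \<in> carrier W" "(u, u') \<in> F \<Longrightarrow> u' \<in> carrier W"
    "(u, u') \<in> F \<Longrightarrow> (v, v') \<in> F \<Longrightarrow> (u \<oplus> v, u' \<oplus> v') \<in> F"
    "r \<in> carrier K \<Longrightarrow> (u, u') \<in> F \<Longrightarrow> (r \<odot> u, r \<odot> u') \<in> F"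
  using assms unfolding linear_relation_def by auto

lemma linear_relation_minus:
  assumes F: "linear_relation F" and uv: "(u, u') \<in> F" "(v, v') \<in> F"
  shows "(u \<ominus> v, u' \<ominus> v') \<in> F"
proof -
  note c = linear_relationD(1,2)[OF F uv(1)] linear_relationD(1,2)[OF F uv(2)]
  have "((\<ominus>\<^bsub>K\<^esub> \<one>\<^bsub>K\<^esub>) \<odot> v, (\<ominus>\<^bsub>K\<^esub> \<one>\<^bsub>K\<^esub>) \<odot> v') \<in> F" using F uv by (intro linear_relationD(4)) auto
  then have "(\<ominus> v, \<ominus> v') \<in> F" using c by (simp add: smult_l_minus)
  then show ?thesis using F uv unfolding M.minus_eq by (intro linear_relationD(3))
qed

lemma linear_relation_converse: "linear_relation F \<Longrightarrow> linear_relation (F\<inverse>)"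
  unfolding linear_relation_def by auto

text \<open>The membership conditions of \<Gamma> are linear in w, \<alpha>, \<beta>, so they can be
  transported along \<open>F\<close> once every element involved has a partner. The converse image
  on \<open>u\<close> and \<open>v\<close> supplies just the partners of the shifts.\<close>

lemma Image_gam:
  assumes F: "linear_relation F"
    and sub: "x \<subseteq> carrier W" "u \<subseteq> carrier W" "y \<subseteq> carrier W" "v \<subseteq> carrier W" "z \<subseteq> carrier W"
  shows "F `` rel_gam x (F\<inverse> `` u) y (F\<inverse> `` v) z = rel_gam (F `` x) u (F `` y) v (F `` z)"
proof (intro equalityI subsetI)
  note minus = linear_relation_minus[OF F]
  fix w' assume "w' \<in> F `` rel_gam x (F\<inverse> `` u) y (F\<inverse> `` v) z"
  then obtain w \<alpha> \<alpha>' \<beta> \<beta>' where m: "(w, w') \<in> F" "(\<alpha>, \<alpha>') \<in> F" "(\<beta>, \<beta>') \<in> F" "\<alpha>' \<in> u" "\<beta>' \<in> v"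
    "w \<ominus> \<alpha> \<in> z" "w \<ominus> \<beta> \<in> x" "w \<ominus> \<alpha> \<ominus> \<beta> \<in> y"
    by (elim ImageE gamE) auto
  have "w' \<ominus> \<alpha>' \<in> F `` z" "w' \<ominus> \<beta>' \<in> F `` x" "w' \<ominus> \<alpha>' \<ominus> \<beta>' \<in> F `` y"
    using minus[OF m(1) m(2)] minus[OF m(1) m(3)] minus[OF minus[OF m(1) m(2)] m(3)] m by blast+
  moreover have "w' \<in> carrier W" using m linear_relationD[OF F] by blast
  ultimately show "w' \<in> rel_gam (F `` x) u (F `` y) v (F `` z)"
    using m by (intro gamI[OF _ m(4,5) refl _ refl _ refl]) auto
next
  note minus = linear_relation_minus[OF F]
  fix w' assume "w' \<in> rel_gam (F `` x) u (F `` y) v (F `` z)"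
  then obtain \<alpha>' \<beta>' \<xi> \<eta> \<zeta> where m: "w' \<in> carrier W" "\<alpha>' \<in> u" "\<beta>' \<in> v"
    "(\<zeta>, w' \<ominus> \<alpha>') \<in> F" "(\<xi>, w' \<ominus> \<beta>') \<in> F" "(\<eta>, w' \<ominus> \<alpha>' \<ominus> \<beta>') \<in> F" "\<zeta> \<in> z" "\<xi> \<in> x" "\<eta> \<in> y"
    by (elim ImageE gamE) auto
  have c: "\<alpha>' \<in> carrier W" "\<beta>' \<in> carrier W" "\<zeta> \<in> carrier W" "\<xi> \<in> carrier W" "\<eta> \<in> carrier W"
    using m sub by auto
  \<comment> \<open>Only the three remainders are known to have partners under \<open>F\<close>.
    Both shifts and w' itself are combinations of these remainders, so the same combinations of
    \<xi>, \<eta>, \<zeta> are partners for them.\<close>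
  have "(w' \<ominus> \<beta>') \<ominus> (w' \<ominus> \<alpha>' \<ominus> \<beta>') = \<alpha>'" "(w' \<ominus> \<alpha>') \<ominus> (w' \<ominus> \<alpha>' \<ominus> \<beta>') = \<beta>'"
    "(w' \<ominus> \<alpha>') \<ominus> ((w' \<ominus> \<alpha>' \<ominus> \<beta>') \<ominus> (w' \<ominus> \<beta>')) = w'"
    using m(1) c by algebra+
  then have F': "(\<xi> \<ominus> \<eta>, \<alpha>') \<in> F" "(\<zeta> \<ominus> \<eta>, \<beta>') \<in> F" "(\<zeta> \<ominus> (\<eta> \<ominus> \<xi>), w') \<in> F"
    using minus[OF m(5) m(6)] minus[OF m(4) m(6)] minus[OF m(4) minus[OF m(6) m(5)]] by simp_all
  have "\<zeta> \<ominus> (\<eta> \<ominus> \<xi>) \<in> rel_gam x (F\<inverse> `` u) y (F\<inverse> `` v) z"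
  proof (rule gamI[OF _ _ _ _ m(7) _ m(8) _ m(9)])
    show "\<xi> \<ominus> \<eta> \<in> F\<inverse> `` u" "\<zeta> \<ominus> \<eta> \<in> F\<inverse> `` v" using F' m by auto
    show "\<zeta> \<ominus> (\<eta> \<ominus> \<xi>) \<in> carrier W" using c by simp
    show "\<zeta> \<ominus> (\<eta> \<ominus> \<xi>) \<ominus> (\<xi> \<ominus> \<eta>) = \<zeta>" "\<zeta> \<ominus> (\<eta> \<ominus> \<xi>) \<ominus> (\<zeta> \<ominus> \<eta>) = \<xi>" "\<zeta> \<ominus> (\<zeta> \<ominus> \<eta>) = \<eta>"
      using c by algebra+
  qed
  then show "w' \<in> F `` rel_gam x (F\<inverse> `` u) y (F\<inverse> `` v) z" using F' by blast
qed

lemma Image_dil: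
  assumes F: "linear_relation F" and r: "r \<in> carrier K"
    and sub: "x \<subseteq> carrier W" "u \<subseteq> carrier W" "y \<subseteq> carrier W"
  shows "F `` rel_dil r x (F\<inverse> `` u) y = rel_dil r (F `` x) u (F `` y)"
proof (intro equalityI subsetI)
  fix w' assume "w' \<in> F `` rel_dil r x (F\<inverse> `` u) y"
  then obtain \<xi> \<alpha> \<alpha>' where m: "(\<xi> \<oplus> r \<odot> \<alpha>, w') \<in> F" "\<xi> \<in> x" "(\<alpha>, \<alpha>') \<in> F" "\<alpha>' \<in> u" "\<xi> \<oplus> \<alpha> \<in> y"
    by (elim ImageE dilE) auto
  \<comment> \<open>Partners are given for \<xi> + r \<alpha> and for \<alpha>, but not for \<xi>;
    subtraction yields this one.\<close>
  define \<xi>' where "\<xi>' = w' \<ominus> r \<odot> \<alpha>'"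
  have c: "\<xi> \<in> carrier W" "\<alpha> \<in> carrier W" "\<alpha>' \<in> carrier W" "w' \<in> carrier W"
    using m sub linear_relationD[OF F] by blast+
  have "\<xi> \<oplus> r \<odot> \<alpha> \<ominus> r \<odot> \<alpha> = \<xi>" using c r by algebra
  then have \<xi>': "(\<xi>, \<xi>') \<in> F"
    using linear_relation_minus[OF F m(1) linear_relationD(4)[OF F r m(3)]] by (simp add: \<xi>'_def)
  show "w' \<in> rel_dil r (F `` x) u (F `` y)"
  proof (rule dilI)
    show "w' = \<xi>' \<oplus> r \<odot> \<alpha>'" unfolding \<xi>'_def using c r by algebra
    show "\<xi>' \<oplus> \<alpha>' \<in> F `` y" using linear_relationD(3)[OF F \<xi>' m(3)] m by blast
  qed (use \<xi>' m in auto)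
next
  fix w' assume "w' \<in> rel_dil r (F `` x) u (F `` y)"
  then obtain \<xi> \<xi>' \<alpha>' \<eta> where m: "w' = \<xi>' \<oplus> r \<odot> \<alpha>'" "(\<xi>, \<xi>') \<in> F" "\<xi> \<in> x" "\<alpha>' \<in> u"
    "(\<eta>, \<xi>' \<oplus> \<alpha>') \<in> F" "\<eta> \<in> y"
    by (elim ImageE dilE) auto
  have c: "\<xi> \<in> carrier W" "\<xi>' \<in> carrier W" "\<alpha>' \<in> carrier W" "\<eta> \<in> carrier W"
    using m sub linear_relationD[OF F] by blast+
  have "\<xi>' \<oplus> \<alpha>' \<ominus> \<xi>' = \<alpha>'" "\<xi> \<oplus> (\<eta> \<ominus> \<xi>) = \<eta>" using c by algebra+
  then have \<alpha>: "(\<eta> \<ominus> \<xi>, \<alpha>') \<in> F" and \<eta>: "\<xi> \<oplus> (\<eta> \<ominus> \<xi>) \<in> y"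
    using linear_relation_minus[OF F m(5) m(2)] m by simp_all
  have "\<xi> \<oplus> r \<odot> (\<eta> \<ominus> \<xi>) \<in> rel_dil r x (F\<inverse> `` u) y"
    by (rule dilI[OF refl m(3) _ \<eta>]) (use \<alpha> m in auto)
  moreover have "(\<xi> \<oplus> r \<odot> (\<eta> \<ominus> \<xi>), w') \<in> F"
    unfolding m(1) using linear_relationD(3)[OF F m(2) linear_relationD(4)[OF F r \<alpha>]] .
  ultimately show "w' \<in> F `` rel_dil r x (F\<inverse> `` u) y" by blast
qed

text \<open>One half is the pair of image lemmas for \<open>F\<close>, the other half the same
  lemmas for its converse. Compatibility of \<open>F\<close> with \<open>\<Omega>\<close> is not
  asked for; the assumption that \<open>g\<close> and \<open>h\<close> preserve
  \<open>points\<close> takes its place.\<close>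

lemma structural_pair_Image:
  assumes F: "linear_relation F"
    and g: "\<And>S. S \<in> points \<Longrightarrow> g S = F `` S" "\<And>S. S \<in> points \<Longrightarrow> g S \<in> points"
    and h: "\<And>S. S \<in> points \<Longrightarrow> h S = F\<inverse> `` S" "\<And>S. S \<in> points \<Longrightarrow> h S \<in> points"
  shows "structural_pair K geom geom g h"
proof -
  have *: "semi_structural K geom geom g h"
    if F: "linear_relation F" and g: "\<And>S. S \<in> points \<Longrightarrow> g S = F `` S"
      and h: "\<And>S. S \<in> points \<Longrightarrow> h S = F\<inverse> `` S" "\<And>S. S \<in> points \<Longrightarrow> h S \<in> points" for F g h
    unfolding semi_structural_def geom_simps
  proof (intro conjI ballI)
    fix x u y v z assume P: "x \<in> points" "u \<in> points" "y \<in> points" "v \<in> points" "z \<in> points"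
    have "g (rel_gam x (h u) y (h v) z) = F `` rel_gam x (h u) y (h v) z"
      using P h(2) by (intro g gam_point)
    also have "\<dots> = rel_gam (F `` x) u (F `` y) v (F `` z)"
      using Image_gam[OF F] P pointsD(1) h(1) by simp
    finally show "g (rel_gam x (h u) y (h v) z) = rel_gam (g x) u (g y) v (g z)" using P g by simp
  next
    fix r x u y assume P: "r \<in> carrier K" "x \<in> points" "u \<in> points" "y \<in> points"
    have "g (rel_dil r x (h u) y) = F `` rel_dil r x (h u) y"
      using P h(2) by (intro g dil_point)
    also have "\<dots> = rel_dil r (F `` x) u (F `` y)"
      using Image_dil[OF F] P pointsD(1) h(1) by simp
    finally show "g (rel_dil r x (h u) y) = rel_dil r (g x) u (g y)" using P g by simp
  qed
  have "semi_structural K geom geom g h"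
    by (rule *[OF F]) (use g h in simp_all)
  moreover have "semi_structural K geom geom h g"
    by (rule *[OF linear_relation_converse[OF F]]) (use g h in simp_all)
  ultimately show ?thesis
    unfolding structural_pair_def using g(2) h(2) by simp
qed

text \<open>The pairs (\<zeta>, w) that occur in \<Gamma> when \<open>z\<close> is left open, with
  \<alpha> eliminated as w - \<zeta>. In general such a relation is neither single-valued nor
  defined everywhere. The same idea with \<open>y\<close> left open gives
  \<open>middle_rel\<close>.\<close>

definition left_rel :: "'w set \<Rightarrow> 'w set \<Rightarrow> 'w set \<Rightarrow> 'w set \<Rightarrow> ('w \<times> 'w) set" where
  "left_rel x a y b = {(\<zeta>, w). \<zeta> \<in> carrier W \<and> w \<in> carrier W \<and>
     w \<ominus> \<zeta> \<in> a \<and> (\<exists>\<beta>\<in>b. w \<ominus> \<beta> \<in> x \<and> \<zeta> \<ominus> \<beta> \<in> y)}"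

definition middle_rel :: "'w set \<Rightarrow> 'w set \<Rightarrow> 'w set \<Rightarrow> 'w set \<Rightarrow> ('w \<times> 'w) set" where
  "middle_rel x a b z = {(\<eta>, w). \<eta> \<in> carrier W \<and> w \<in> carrier W \<and>
     (\<exists>\<alpha>\<in>a. \<exists>\<beta>\<in>b. w \<ominus> \<alpha> \<in> z \<and> w \<ominus> \<beta> \<in> x \<and> \<eta> = w \<ominus> \<alpha> \<ominus> \<beta>)}"

lemma left_rel_linear:
  assumes P: "x \<in> points" "a \<in> points" "y \<in> points" "b \<in> points"
  shows "linear_relation (left_rel x a y b)"
  unfolding linear_relation_def
proof (intro conjI allI impI ballI)
  show "left_rel x a y b \<subseteq> carrier W \<times> carrier W" unfolding left_rel_def by blast
  fix u u' v v' assume "(u, u') \<in> left_rel x a y b" "(v, v') \<in> left_rel x a y b"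
  then obtain \<beta> \<gamma> where c: "u \<in> carrier W" "u' \<in> carrier W" "v \<in> carrier W" "v' \<in> carrier W"
     and m: "u' \<ominus> u \<in> a" "\<beta> \<in> b" "u' \<ominus> \<beta> \<in> x" "u \<ominus> \<beta> \<in> y"
     and n: "v' \<ominus> v \<in> a" "\<gamma> \<in> b" "v' \<ominus> \<gamma> \<in> x" "v \<ominus> \<gamma> \<in> y"
    unfolding left_rel_def by blast
  have d: "\<beta> \<in> carrier W" "\<gamma> \<in> carrier W" using P m n points_carrier by auto
  have "(u' \<oplus> v') \<ominus> (u \<oplus> v) = (u' \<ominus> u) \<oplus> (v' \<ominus> v)"
    "(u' \<oplus> v') \<ominus> (\<beta> \<oplus> \<gamma>) = (u' \<ominus> \<beta>) \<oplus> (v' \<ominus> \<gamma>)"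
    "(u \<oplus> v) \<ominus> (\<beta> \<oplus> \<gamma>) = (u \<ominus> \<beta>) \<oplus> (v \<ominus> \<gamma>)"
    using c d by algebra+
  then have "(u' \<oplus> v') \<ominus> (u \<oplus> v) \<in> a" "(u' \<oplus> v') \<ominus> (\<beta> \<oplus> \<gamma>) \<in> x" "(u \<oplus> v) \<ominus> (\<beta> \<oplus> \<gamma>) \<in> y" "\<beta> \<oplus> \<gamma> \<in> b"
    using P m n pointsD(3) by simp_all
  then show "(u \<oplus> v, u' \<oplus> v') \<in> left_rel x a y b"
    unfolding left_rel_def using c by auto
next
  fix r u u' assume r: "r \<in> carrier K" and "(u, u') \<in> left_rel x a y b"
  then obtain \<beta> where c: "u \<in> carrier W" "u' \<in> carrier W"
     and m: "u' \<ominus> u \<in> a" "\<beta> \<in> b" "u' \<ominus> \<beta> \<in> x" "u \<ominus> \<beta> \<in> y"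
    unfolding left_rel_def by blast
  have d: "\<beta> \<in> carrier W" using P m points_carrier by auto
  have "r \<odot> u' \<ominus> r \<odot> u = r \<odot> (u' \<ominus> u)" "r \<odot> u' \<ominus> r \<odot> \<beta> = r \<odot> (u' \<ominus> \<beta>)"
    "r \<odot> u \<ominus> r \<odot> \<beta> = r \<odot> (u \<ominus> \<beta>)"
    using r c d by algebra+
  then have "r \<odot> u' \<ominus> r \<odot> u \<in> a" "r \<odot> u' \<ominus> r \<odot> \<beta> \<in> x" "r \<odot> u \<ominus> r \<odot> \<beta> \<in> y" "r \<odot> \<beta> \<in> b"
    using P m r pointsD(6) by simp_all
  then show "(r \<odot> u, r \<odot> u') \<in> left_rel x a y b"
    unfolding left_rel_def using c r by auto
qed

text \<open>Exchanging \<zeta> with w exchanges the conditions for \<open>x\<close> and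
  \<open>y\<close> and negates the difference lying in \<open>a\<close>.\<close>

lemma left_rel_converse:
  assumes P: "a \<in> points"
  shows "(left_rel x a y b)\<inverse> = left_rel y a x b"
proof -
  have "u \<ominus> v \<in> a" if "v \<ominus> u \<in> a" "u \<in> carrier W" "v \<in> carrier W" for u v
  proof -
    have "u \<ominus> v = \<ominus> (v \<ominus> u)" using that(2,3) by algebra
    then show ?thesis using pointsD(4)[OF P that(1)] by simp
  qed
  then show ?thesis unfolding left_rel_def by blast
qed

lemma gam_left_rel:
  assumes "a \<in> points" "z \<in> points"
  shows "rel_gam x a y b z = left_rel x a y b `` z"
proof (intro equalityI subsetI)
  fix w assume "w \<in> rel_gam x a y b z"
  then obtain \<alpha> \<beta> where m: "w \<in> carrier W" "\<alpha> \<in> a" "\<beta> \<in> b" "w \<ominus> \<alpha> \<in> z" "w \<ominus> \<beta> \<in> x" "w \<ominus> \<alpha> \<ominus> \<beta> \<in> y"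
    by (rule gamE)
  have c: "\<alpha> \<in> carrier W" using m assms points_carrier by auto
  have "w \<ominus> (w \<ominus> \<alpha>) = \<alpha>" using m(1) c by algebra
  then have "(w \<ominus> \<alpha>, w) \<in> left_rel x a y b" unfolding left_rel_def using m c by auto
  then show "w \<in> left_rel x a y b `` z" using m by blast
next
  fix w assume "w \<in> left_rel x a y b `` z"
  then obtain \<zeta> \<beta> where m: "\<zeta> \<in> z" "w \<in> carrier W" "w \<ominus> \<zeta> \<in> a" "\<beta> \<in> b" "w \<ominus> \<beta> \<in> x" "\<zeta> \<ominus> \<beta> \<in> y"
    unfolding left_rel_def by blast
  have c: "\<zeta> \<in> carrier W" using m assms points_carrier by auto
  show "w \<in> rel_gam x a y b z"
    by (rule gamI[OF m(2,3,4) _ m(1) refl m(5) refl m(6)]) (use m(2) c in algebra)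
qed

lemma middle_rel_linear:
  assumes P: "x \<in> points" "a \<in> points" "b \<in> points" "z \<in> points"
  shows "linear_relation (middle_rel x a b z)"
  unfolding linear_relation_def
proof (intro conjI allI impI ballI)
  show "middle_rel x a b z \<subseteq> carrier W \<times> carrier W" unfolding middle_rel_def by blast
  fix u u' v v' assume "(u, u') \<in> middle_rel x a b z" "(v, v') \<in> middle_rel x a b z"
  then obtain \<alpha> \<beta> \<gamma> \<delta> where c: "u \<in> carrier W" "u' \<in> carrier W" "v \<in> carrier W" "v' \<in> carrier W"
     and m: "\<alpha> \<in> a" "\<beta> \<in> b" "u' \<ominus> \<alpha> \<in> z" "u' \<ominus> \<beta> \<in> x" "u = u' \<ominus> \<alpha> \<ominus> \<beta>"
     and n: "\<gamma> \<in> a" "\<delta> \<in> b" "v' \<ominus> \<gamma> \<in> z" "v' \<ominus> \<delta> \<in> x" "v = v' \<ominus> \<gamma> \<ominus> \<delta>"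
    unfolding middle_rel_def by blast
  have d: "\<alpha> \<in> carrier W" "\<beta> \<in> carrier W" "\<gamma> \<in> carrier W" "\<delta> \<in> carrier W"
    using P m n points_carrier by auto
  have "(u' \<oplus> v') \<ominus> (\<alpha> \<oplus> \<gamma>) = (u' \<ominus> \<alpha>) \<oplus> (v' \<ominus> \<gamma>)"
    "(u' \<oplus> v') \<ominus> (\<beta> \<oplus> \<delta>) = (u' \<ominus> \<beta>) \<oplus> (v' \<ominus> \<delta>)"
    using c d by algebra+
  then have "(u' \<oplus> v') \<ominus> (\<alpha> \<oplus> \<gamma>) \<in> z" "(u' \<oplus> v') \<ominus> (\<beta> \<oplus> \<delta>) \<in> x" "\<alpha> \<oplus> \<gamma> \<in> a" "\<beta> \<oplus> \<delta> \<in> b"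
    using P m n pointsD(3) by simp_all
  moreover have "u \<oplus> v = (u' \<oplus> v') \<ominus> (\<alpha> \<oplus> \<gamma>) \<ominus> (\<beta> \<oplus> \<delta>)"
    unfolding m(5) n(5) using c(2,4) d by algebra
  ultimately show "(u \<oplus> v, u' \<oplus> v') \<in> middle_rel x a b z"
    unfolding middle_rel_def using c by blast
next
  fix r u u' assume r: "r \<in> carrier K" and "(u, u') \<in> middle_rel x a b z"
  then obtain \<alpha> \<beta> where c: "u \<in> carrier W" "u' \<in> carrier W"
     and m: "\<alpha> \<in> a" "\<beta> \<in> b" "u' \<ominus> \<alpha> \<in> z" "u' \<ominus> \<beta> \<in> x" "u = u' \<ominus> \<alpha> \<ominus> \<beta>"
    unfolding middle_rel_def by blast
  have d: "\<alpha> \<in> carrier W" "\<beta> \<in> carrier W" using P m points_carrier by auto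
  have "r \<odot> u' \<ominus> r \<odot> \<alpha> = r \<odot> (u' \<ominus> \<alpha>)" "r \<odot> u' \<ominus> r \<odot> \<beta> = r \<odot> (u' \<ominus> \<beta>)"
    using r c d by algebra+
  then have "r \<odot> u' \<ominus> r \<odot> \<alpha> \<in> z" "r \<odot> u' \<ominus> r \<odot> \<beta> \<in> x" "r \<odot> \<alpha> \<in> a" "r \<odot> \<beta> \<in> b"
    using P m r pointsD(6) by simp_all
  moreover have "r \<odot> u = r \<odot> u' \<ominus> r \<odot> \<alpha> \<ominus> r \<odot> \<beta>"
    unfolding m(5) using c(2) d r by algebra
  ultimately show "(r \<odot> u, r \<odot> u') \<in> middle_rel x a b z"
    unfolding middle_rel_def using c r by blast
qed

text \<open>Solving \<eta> = w - \<alpha> - \<beta> for w gives an equation of the same form with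
  both shifts negated. The remainders in \<open>x\<close> and \<open>z\<close> then change
  places.\<close>

lemma middle_rel_converse_subset:
  assumes P: "a \<in> points" "b \<in> points"
  shows "(middle_rel x a b z)\<inverse> \<subseteq> middle_rel z a b x"
proof clarify
  fix w \<eta> assume "(\<eta>, w) \<in> middle_rel x a b z"
  then obtain \<alpha> \<beta> where c: "\<eta> \<in> carrier W" "w \<in> carrier W"
     and m: "\<alpha> \<in> a" "\<beta> \<in> b" "w \<ominus> \<alpha> \<in> z" "w \<ominus> \<beta> \<in> x" "\<eta> = w \<ominus> \<alpha> \<ominus> \<beta>"
    unfolding middle_rel_def by blast
  have d: "\<alpha> \<in> carrier W" "\<beta> \<in> carrier W" using P m points_carrier by auto
  have e: "\<eta> \<ominus> \<ominus> \<alpha> = w \<ominus> \<beta>" "\<eta> \<ominus> \<ominus> \<beta> = w \<ominus> \<alpha>" "w = \<eta> \<ominus> \<ominus> \<alpha> \<ominus> \<ominus> \<beta>"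
    unfolding m(5) using c(2) d by algebra+
  have "\<eta> \<ominus> \<ominus> \<alpha> \<in> x" "\<eta> \<ominus> \<ominus> \<beta> \<in> z" "\<ominus> \<alpha> \<in> a" "\<ominus> \<beta> \<in> b"
    unfolding e(1,2) using m P pointsD(4) by simp_all
  then show "(w, \<eta>) \<in> middle_rel z a b x" unfolding middle_rel_def using c e(3) by blast
qed

lemma middle_rel_converse:
  assumes P: "a \<in> points" "b \<in> points"
  shows "(middle_rel x a b z)\<inverse> = middle_rel z a b x"
  using middle_rel_converse_subset[OF P, of x z] middle_rel_converse_subset[OF P, of z x]
  by (metis converse_converse converse_mono subset_antisym)

lemma gam_middle_rel:
  assumes "a \<in> points" "b \<in> points" "y \<in> points"
  shows "rel_gam x a y b z = middle_rel x a b z `` y"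
  unfolding rel_gam_def middle_rel_def using points_carrier[OF assms(3)] by blast

lemma L_structural_geom:
  assumes P: "x \<in> points" "a \<in> points" "y \<in> points" "b \<in> points"
  shows "structural_pair K geom geom (\<lambda>z. rel_gam x a y b z) (\<lambda>z. rel_gam y a x b z)"
proof (rule structural_pair_Image[OF left_rel_linear[of x a y b]])
  fix S assume "S \<in> points"
  then show "rel_gam x a y b S = left_rel x a y b `` S" "rel_gam y a x b S = (left_rel x a y b)\<inverse> `` S"
    unfolding left_rel_converse[OF P(2)] by (simp_all add: gam_left_rel P)
qed (use P gam_point in auto)

lemma M_structural_geom:
  assumes P: "x \<in> points" "a \<in> points" "b \<in> points" "z \<in> points"
  shows "structural_pair K geom geom (\<lambda>y. rel_gam x a y b z) (\<lambda>y. rel_gam z a y b x)"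
proof (rule structural_pair_Image[OF middle_rel_linear[of x a b z]])
  fix S assume "S \<in> points"
  then show "rel_gam x a S b z = middle_rel x a b z `` S" "rel_gam z a S b x = (middle_rel x a b z)\<inverse> `` S"
    unfolding middle_rel_converse[OF P(2,3)] by (simp_all add: gam_middle_rel P)
qed (use P gam_point in auto)

lemma R_structural_geom:
  assumes P: "a \<in> points" "y \<in> points" "b \<in> points" "z \<in> points"
  shows "structural_pair K geom geom (\<lambda>x. rel_gam x a y b z) (\<lambda>x. rel_gam x a z b y)"
  using L_structural_geom[of z b y a] P gam_swap[OF P(1,3)] by simp

section \<open>Transversality and the diagonal values\<close>

lemma gam_compl:
  assumes x: "compl x a" and y: "compl y b" and z: "compl z a"
  shows "compl (rel_gam x a y b z) a"
proof (rule complI)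
  note P = complD[OF x] complD[OF y] complD[OF z]
  show G: "rel_gam x a y b z \<in> points" "a \<in> points" using P gam_point by auto
  fix w assume "w \<in> rel_gam x a y b z" and wa: "w \<in> a"
  then obtain \<alpha> \<beta> where m: "w \<in> carrier W" "\<alpha> \<in> a" "\<beta> \<in> b" "w \<ominus> \<alpha> \<in> z" "w \<ominus> \<beta> \<in> x" "w \<ominus> \<alpha> \<ominus> \<beta> \<in> y"
    by (elim gamE)
  have c: "\<alpha> \<in> carrier W" "\<beta> \<in> carrier W" using m P points_carrier by auto
  \<comment> \<open>Both w and \<alpha> lie in \<open>a\<close>, so their difference is in
    \<open>z\<close> and \<open>a\<close>. Next \<beta> vanishes by transversality of
    \<open>y\<close> and \<open>b\<close>, which leaves w itself in \<open>x\<close>.\<close>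
  have z0: "w \<ominus> \<alpha> = \<zero>" using P(9) m(4) pointsD(5)[OF G(2) wa m(2)] by blast
  then have "w \<ominus> \<alpha> \<ominus> \<beta> = \<ominus> \<beta>" using c by (simp add: M.minus_eq)
  then have "w \<ominus> \<alpha> \<ominus> \<beta> = \<zero>" using P(6) m(3,6) pointsD(4)[OF P(5) m(3)] by simp
  then have "\<ominus> \<beta> = \<zero>" using z0 c by (simp add: M.minus_eq)
  then have "\<beta> = \<zero>" using c by simp
  then have "w \<in> x" using m c by simp
  then show "w = \<zero>" using P(3) wa by blast
next
  note P = complD[OF x] complD[OF y] complD[OF z]
  fix w assume w: "w \<in> carrier W"
  \<comment> \<open>A zigzag: project along \<open>a\<close> to \<open>z\<close>, from there along
    \<open>b\<close> to \<open>y\<close>, and from there along \<open>a\<close> to \<open>x\<close>.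
    Undoing only the middle step, \<xi> + \<beta> lies in \<Gamma> and has changed w by elements of
    \<open>a\<close> alone.\<close>
  obtain \<zeta> \<alpha>' where 1: "w = \<zeta> \<oplus> \<alpha>'" "\<zeta> \<in> z" "\<alpha>' \<in> a" using compl_decomp[OF z w] by blast
  have c1: "\<zeta> \<in> carrier W" "\<alpha>' \<in> carrier W" using 1 P points_carrier by auto
  obtain \<eta> \<beta> where 2: "\<zeta> = \<eta> \<oplus> \<beta>" "\<eta> \<in> y" "\<beta> \<in> b" using compl_decomp[OF y c1(1)] by blast
  have c2: "\<eta> \<in> carrier W" "\<beta> \<in> carrier W" using 2 P points_carrier by auto
  obtain \<xi> \<alpha> where 3: "\<eta> = \<xi> \<oplus> \<alpha>" "\<xi> \<in> x" "\<alpha> \<in> a" using compl_decomp[OF x c2(1)] by blast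
  have c3: "\<xi> \<in> carrier W" "\<alpha> \<in> carrier W" using 3 P points_carrier by auto
  have "\<xi> \<oplus> \<beta> \<in> rel_gam x a y b z"
  proof (rule gamI[OF _ pointsD(4)[OF P(2) 3(3)] 2(3) _ 1(2) _ 3(2) _ 2(2)])
    show "\<xi> \<oplus> \<beta> \<in> carrier W" using c2 c3 by simp
    show "\<xi> \<oplus> \<beta> \<ominus> \<ominus> \<alpha> = \<zeta>" "\<zeta> \<ominus> \<beta> = \<eta>" "\<xi> \<oplus> \<beta> \<ominus> \<beta> = \<xi>"
      unfolding 2(1) 3(1) using c2(2) c3 by algebra+
  qed
  moreover have "w = (\<xi> \<oplus> \<beta>) \<oplus> (\<alpha> \<oplus> \<alpha>')"
    unfolding 1(1) 2(1) 3(1) using c1(2) c2(2) c3 by algebra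
  ultimately show "\<exists>u\<in>rel_gam x a y b z. \<exists>v\<in>a. w = u \<oplus> v"
    using pointsD(3)[OF P(2) 3(3) 1(3)] by blast
qed

lemma gam_compl_right:
  assumes "compl x b" "compl y a" "compl z b"
  shows "compl (rel_gam x a y b z) b"
  using gam_compl[OF assms(3,2,1)] gam_swap[of a b x y z] complD(2) assms by simp

lemma dil_compl:
  assumes x: "compl x a" and y: "compl y a" and r: "r \<in> carrier K"
  shows "compl (rel_dil r x a y) a"
proof (rule complI)
  note P = complD[OF x] complD[OF y]
  show G: "rel_dil r x a y \<in> points" "a \<in> points" using P r dil_point by auto
  fix w assume "w \<in> rel_dil r x a y" and wa: "w \<in> a"
  then obtain \<xi> \<alpha> where m: "w = \<xi> \<oplus> r \<odot> \<alpha>" "\<xi> \<in> x" "\<alpha> \<in> a" "\<xi> \<oplus> \<alpha> \<in> y"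
    by (elim dilE)
  have c: "\<xi> \<in> carrier W" "\<alpha> \<in> carrier W" using m P points_carrier by auto
  have "w \<ominus> r \<odot> \<alpha> = \<xi>" unfolding m(1) using c r by algebra
  then have "\<xi> \<in> a" using pointsD(5)[OF G(2) wa pointsD(6)[OF G(2) r m(3)]] by simp
  then have "\<xi> = \<zero>" using P(3) m(2) by blast
  then have "\<alpha> = \<zero>" using P(6) m(3,4) c by simp
  then show "w = \<zero>" using \<open>\<xi> = \<zero>\<close> m(1) r by simp
next
  note P = complD[OF x] complD[OF y]
  fix w assume w: "w \<in> carrier W"
  obtain \<xi> \<alpha> where 1: "w = \<xi> \<oplus> \<alpha>" "\<xi> \<in> x" "\<alpha> \<in> a" using compl_decomp[OF x w] by blast
  have c1: "\<xi> \<in> carrier W" "\<alpha> \<in> carrier W" using 1 P points_carrier by auto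
  obtain \<eta> \<alpha>' where 2: "\<xi> = \<eta> \<oplus> \<alpha>'" "\<eta> \<in> y" "\<alpha>' \<in> a" using compl_decomp[OF y c1(1)] by blast
  have c2: "\<eta> \<in> carrier W" "\<alpha>' \<in> carrier W" using 2 P points_carrier by auto
  \<comment> \<open>The shift leading from \<open>x\<close> to \<open>y\<close> is minus the
    \<open>a\<close>-part of \<xi> in its decomposition along \<open>y\<close>.\<close>
  have "\<xi> \<oplus> \<ominus> \<alpha>' = \<eta>" unfolding 2(1) using c2 by algebra
  then have "\<xi> \<oplus> r \<odot> \<ominus> \<alpha>' \<in> rel_dil r x a y"
    by (intro dilI[OF refl 1(2)]) (use 2 pointsD(4)[OF P(2)] in auto)
  moreover have "w = (\<xi> \<oplus> r \<odot> \<ominus> \<alpha>') \<oplus> (r \<odot> \<alpha>' \<oplus> \<alpha>)"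
    unfolding 1(1) using c1 c2(2) r by algebra
  moreover have "r \<odot> \<alpha>' \<oplus> \<alpha> \<in> a"
    using pointsD(3)[OF P(2) pointsD(6)[OF P(2) r 2(3)] 1(3)] .
  ultimately show "\<exists>u\<in>rel_dil r x a y. \<exists>v\<in>a. w = u \<oplus> v" by blast
qed

lemma gam_join:
  assumes P: "a \<in> points" "b \<in> points" "y \<in> points"
  shows "rel_gam a a y b b = sum_set a b"
proof (intro equalityI subsetI)
  fix w assume "w \<in> rel_gam a a y b b"
  then obtain \<alpha> where m: "w \<in> carrier W" "\<alpha> \<in> a" "w \<ominus> \<alpha> \<in> b" by (elim gamE)
  have c: "\<alpha> \<in> carrier W" using m P points_carrier by auto
  have "w = \<alpha> \<oplus> (w \<ominus> \<alpha>)" using m(1) c by algebra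
  then show "w \<in> sum_set a b" using sum_setI[OF m(2,3)] by simp
next
  fix w assume "w \<in> sum_set a b"
  then obtain \<alpha> \<beta> where m: "w = \<alpha> \<oplus> \<beta>" "\<alpha> \<in> a" "\<beta> \<in> b" unfolding sum_set_def by blast
  have c: "\<alpha> \<in> carrier W" "\<beta> \<in> carrier W" using m P points_carrier by auto
  show "w \<in> rel_gam a a y b b"
  proof (rule gamI[OF _ m(2,3) _ m(3) _ m(2) _ pointsD(2)[OF P(3)]])
    show "w \<in> carrier W" "w \<ominus> \<alpha> = \<beta>" "w \<ominus> \<beta> = \<alpha>" "\<beta> \<ominus> \<beta> = \<zero>" unfolding m(1) using c by algebra+
  qed
qed

lemma gam_meet:
  assumes P: "a \<in> points" "b \<in> points" "y \<in> points"
  shows "rel_gam a b y a b = a \<inter> b"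
proof (intro equalityI subsetI)
  fix w assume "w \<in> rel_gam a b y a b"
  then obtain \<alpha> \<beta> where m: "w \<in> carrier W" "\<alpha> \<in> b" "\<beta> \<in> a" "w \<ominus> \<alpha> \<in> b" "w \<ominus> \<beta> \<in> a" by (elim gamE)
  have c: "\<alpha> \<in> carrier W" "\<beta> \<in> carrier W" using m P points_carrier by auto
  have "w = \<alpha> \<oplus> (w \<ominus> \<alpha>)" "w = \<beta> \<oplus> (w \<ominus> \<beta>)" using m(1) c by algebra+
  then show "w \<in> a \<inter> b" using pointsD(3)[OF P(1) m(3,5)] pointsD(3)[OF P(2) m(2,4)] by simp
next
  fix w assume m: "w \<in> a \<inter> b"
  then have c: "w \<in> carrier W" using P points_carrier by auto
  show "w \<in> rel_gam a b y a b"
  proof (rule gamI[where \<alpha> = w and \<beta> = \<zero>])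
    show "w \<ominus> w = \<zero>" "w \<ominus> \<zero> = w" "\<zero> \<ominus> \<zero> = \<zero>" using c by (simp_all add: M.minus_eq M.r_neg)
  qed (use m c pointsD(2) P in auto)
qed

lemma gam_idem:
  assumes xa: "compl x a" and xb: "compl x b" and z: "z \<in> points"
  shows "rel_gam x a x b z = z"
proof (intro equalityI subsetI)
  note P = complD[OF xa] complD[OF xb]
  fix w assume "w \<in> rel_gam x a x b z"
  then obtain \<alpha> \<beta> where m: "w \<in> carrier W" "\<alpha> \<in> a" "\<beta> \<in> b" "w \<ominus> \<alpha> \<in> z" "w \<ominus> \<beta> \<in> x" "w \<ominus> \<alpha> \<ominus> \<beta> \<in> x"
    by (elim gamE)
  have c: "\<alpha> \<in> carrier W" "\<beta> \<in> carrier W" using m P points_carrier by auto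
  have "\<alpha> = (w \<ominus> \<beta>) \<ominus> (w \<ominus> \<alpha> \<ominus> \<beta>)" using m(1) c by algebra
  then have "\<alpha> \<in> x" using pointsD(5)[OF P(1) m(5,6)] by simp
  then have "\<alpha> = \<zero>" using P(3) m(2) by blast
  then show "w \<in> z" using m(1,4) by simp
next
  note P = complD[OF xa] complD[OF xb]
  fix w assume w: "w \<in> z"
  then have wW: "w \<in> carrier W" using z points_carrier by auto
  obtain \<xi> \<beta> where m: "w = \<xi> \<oplus> \<beta>" "\<xi> \<in> x" "\<beta> \<in> b" using compl_decomp[OF xb wW] by blast
  have c: "\<xi> \<in> carrier W" "\<beta> \<in> carrier W" using m P points_carrier by auto
  have e: "w \<ominus> \<beta> = \<xi>" unfolding m(1) using c by algebra
  show "w \<in> rel_gam x a x b z"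
    by (rule gamI[OF wW pointsD(2)[OF P(2)] m(3) _ w e m(2) e m(2)]) (use wW in \<open>simp add: M.minus_eq\<close>)
qed

lemma gam_idem_right:
  assumes "compl x a" "compl x b" "z \<in> points"
  shows "rel_gam z b x a x = z"
  using gam_idem[OF assms] gam_swap[of a b x x z] complD(2) assms by simp

lemma gam_right:
  assumes ax: "compl a x" and yb: "compl y b"
  shows "rel_gam x a y b b = b"
proof (intro equalityI subsetI)
  note P = complD[OF ax] complD[OF yb]
  fix w assume "w \<in> rel_gam x a y b b"
  then obtain \<alpha> \<beta> where m: "w \<in> carrier W" "\<alpha> \<in> a" "\<beta> \<in> b" "w \<ominus> \<alpha> \<in> b" "w \<ominus> \<beta> \<in> x" "w \<ominus> \<alpha> \<ominus> \<beta> \<in> y"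
    by (elim gamE)
  have c: "\<alpha> \<in> carrier W" "\<beta> \<in> carrier W" using m P points_carrier by auto
  \<comment> \<open>The middle remainder is a difference of two elements of \<open>b\<close>, and it
    lies in \<open>y\<close>. Its vanishing identifies the remainder in \<open>x\<close> with
    \<alpha>, which is therefore in \<open>a\<close> and \<open>x\<close>.\<close>
  have "w \<ominus> \<alpha> \<ominus> \<beta> = \<zero>" using P(6) m(6) pointsD(5)[OF P(5) m(4,3)] by blast
  moreover have "w \<ominus> \<beta> = (w \<ominus> \<alpha> \<ominus> \<beta>) \<oplus> \<alpha>" using m(1) c by algebra
  ultimately have "w \<ominus> \<beta> = \<alpha>" using c by simp
  then have "\<alpha> = \<zero>" using P(3) m(2,5) by simp
  then show "w \<in> b" using m(1,4) by simp
next
  note P = complD[OF ax] complD[OF yb]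
  fix w assume w: "w \<in> b"
  then have wW: "w \<in> carrier W" using P points_carrier by auto
  then have e: "w \<ominus> \<zero> = w" "w \<ominus> w = \<zero>" by (simp_all add: M.minus_eq M.r_neg)
  show "w \<in> rel_gam x a y b b"
    by (rule gamI[OF wW pointsD(2)[OF P(1)] w e(1) w e(2) pointsD(2)[OF P(2)] e(2) pointsD(2)[OF P(4)]])
qed

lemma gam_left:
  assumes ay: "compl a y" and bx: "compl b x"
  shows "rel_gam x a y b a = a"
proof (intro equalityI subsetI)
  note P = complD[OF ay] complD[OF bx]
  fix w assume "w \<in> rel_gam x a y b a"
  then obtain \<alpha> where m: "w \<in> carrier W" "\<alpha> \<in> a" "w \<ominus> \<alpha> \<in> a"
    by (elim gamE)
  have c: "\<alpha> \<in> carrier W" using m P points_carrier by auto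
  have "w = \<alpha> \<oplus> (w \<ominus> \<alpha>)" using m(1) c by algebra
  then show "w \<in> a" using pointsD(3)[OF P(1) m(2,3)] by simp
next
  note P = complD[OF ay] complD[OF bx]
  fix w assume w: "w \<in> a"
  then have wW: "w \<in> carrier W" using P points_carrier by auto
  \<comment> \<open>Transversality is needed for this inclusion only. The shifts are read off from
    two successive splittings, of w along \<open>b\<close> and \<open>x\<close> and then of the
    \<open>x\<close>-part along \<open>a\<close> and \<open>y\<close>.\<close>
  obtain \<beta> \<xi> where 1: "w = \<beta> \<oplus> \<xi>" "\<beta> \<in> b" "\<xi> \<in> x" using compl_decomp[OF bx wW] by blast
  have c1: "\<beta> \<in> carrier W" "\<xi> \<in> carrier W" using 1 P points_carrier by auto
  obtain \<alpha> \<eta> where 2: "\<xi> = \<alpha> \<oplus> \<eta>" "\<alpha> \<in> a" "\<eta> \<in> y" using compl_decomp[OF ay c1(2)] by blast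
  have c2: "\<alpha> \<in> carrier W" "\<eta> \<in> carrier W" using 2 P points_carrier by auto
  show "w \<in> rel_gam x a y b a"
  proof (rule gamI[OF wW 2(2) 1(2) refl _ _ 1(3) _ 2(3)])
    show "w \<ominus> \<alpha> \<in> a" using pointsD(5)[OF P(1) w 2(2)] .
    show "w \<ominus> \<beta> = \<xi>" "w \<ominus> \<alpha> \<ominus> \<beta> = \<eta>" unfolding 1(1) 2(1) using c1(1) c2 by algebra+
  qed
qed

section \<open>The affine structure on the complements of a point\<close>

lemma dil_one:
  assumes p: "compl p a" and y: "compl y a"
  shows "rel_dil \<one>\<^bsub>K\<^esub> p a y = y"
proof (rule compl_eq[OF dil_compl[OF p y] y])
  show "rel_dil \<one>\<^bsub>K\<^esub> p a y \<subseteq> y"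
    using complD[OF p] points_carrier[of a] by (auto elim!: dilE)
qed simp

lemma dil_plus:
  assumes p: "compl p a" and y: "compl y a" and r: "r \<in> carrier K" and s: "s \<in> carrier K"
  shows "rel_dil (r \<oplus>\<^bsub>K\<^esub> s) p a y = rel_gam (rel_dil r p a y) a p a (rel_dil s p a y)"
proof (rule compl_eq)
  note P = complD[OF p] complD[OF y]
  show "compl (rel_dil (r \<oplus>\<^bsub>K\<^esub> s) p a y) a" "compl (rel_gam (rel_dil r p a y) a p a (rel_dil s p a y)) a"
    using assms by (auto intro!: dil_compl gam_compl)
  show "rel_dil (r \<oplus>\<^bsub>K\<^esub> s) p a y \<subseteq> rel_gam (rel_dil r p a y) a p a (rel_dil s p a y)"
  proof
    fix w assume "w \<in> rel_dil (r \<oplus>\<^bsub>K\<^esub> s) p a y"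
    then obtain \<xi> \<alpha> where m: "w = \<xi> \<oplus> (r \<oplus>\<^bsub>K\<^esub> s) \<odot> \<alpha>" "\<xi> \<in> p" "\<alpha> \<in> a" "\<xi> \<oplus> \<alpha> \<in> y"
      by (elim dilE)
    have c: "\<xi> \<in> carrier W" "\<alpha> \<in> carrier W" using m P points_carrier by auto
    have w: "w = \<xi> \<oplus> (r \<odot> \<alpha> \<oplus> s \<odot> \<alpha>)" using m(1) c r s by (simp add: smult_l_distr)
    have e: "\<xi> \<oplus> r \<odot> \<alpha> \<in> rel_dil r p a y" "\<xi> \<oplus> s \<odot> \<alpha> \<in> rel_dil s p a y"
      by (rule dilI[OF refl m(2,3,4)])+
    show "w \<in> rel_gam (rel_dil r p a y) a p a (rel_dil s p a y)"
    proof (rule gamI[OF _ pointsD(6)[OF P(2) r m(3)] pointsD(6)[OF P(2) s m(3)] _ e(2) _ e(1) _ m(2)])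
      show "w \<in> carrier W" "w \<ominus> r \<odot> \<alpha> = \<xi> \<oplus> s \<odot> \<alpha>" "w \<ominus> s \<odot> \<alpha> = \<xi> \<oplus> r \<odot> \<alpha>"
        "\<xi> \<oplus> s \<odot> \<alpha> \<ominus> s \<odot> \<alpha> = \<xi>"
        unfolding w using c r s by algebra+
    qed
  qed
qed

lemma dil_times:
  assumes p: "compl p a" and y: "compl y a" and r: "r \<in> carrier K" and s: "s \<in> carrier K"
  shows "rel_dil (r \<otimes>\<^bsub>K\<^esub> s) p a y = rel_dil r p a (rel_dil s p a y)"
proof (rule compl_eq)
  note P = complD[OF p] complD[OF y]
  show "compl (rel_dil (r \<otimes>\<^bsub>K\<^esub> s) p a y) a" "compl (rel_dil r p a (rel_dil s p a y)) a"
    using assms by (auto intro!: dil_compl)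
  show "rel_dil (r \<otimes>\<^bsub>K\<^esub> s) p a y \<subseteq> rel_dil r p a (rel_dil s p a y)"
  proof
    fix w assume "w \<in> rel_dil (r \<otimes>\<^bsub>K\<^esub> s) p a y"
    then obtain \<xi> \<alpha> where m: "w = \<xi> \<oplus> (r \<otimes>\<^bsub>K\<^esub> s) \<odot> \<alpha>" "\<xi> \<in> p" "\<alpha> \<in> a" "\<xi> \<oplus> \<alpha> \<in> y"
      by (elim dilE)
    have c: "\<xi> \<in> carrier W" "\<alpha> \<in> carrier W" using m P points_carrier by auto
    show "w \<in> rel_dil r p a (rel_dil s p a y)"
    proof (rule dilI[OF _ m(2) pointsD(6)[OF P(2) s m(3)]])
      show "w = \<xi> \<oplus> r \<odot> (s \<odot> \<alpha>)" using m(1) c r s by (simp add: smult_assoc1)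
      show "\<xi> \<oplus> s \<odot> \<alpha> \<in> rel_dil s p a y" by (rule dilI[OF refl m(2,3,4)])
    qed
  qed
qed

lemma dil_distrib:
  assumes p: "compl p a" and x: "compl x a" and z: "compl z a" and r: "r \<in> carrier K"
  shows "rel_dil r p a (rel_gam x a p a z) = rel_gam (rel_dil r p a x) a p a (rel_dil r p a z)"
proof (rule compl_eq)
  note P = complD[OF p] complD[OF x] complD[OF z]
  show "compl (rel_dil r p a (rel_gam x a p a z)) a" "compl (rel_gam (rel_dil r p a x) a p a (rel_dil r p a z)) a"
    using assms by (auto intro!: dil_compl gam_compl)
  show "rel_dil r p a (rel_gam x a p a z) \<subseteq> rel_gam (rel_dil r p a x) a p a (rel_dil r p a z)"
  proof
    fix w assume "w \<in> rel_dil r p a (rel_gam x a p a z)"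
    then obtain \<xi> \<alpha> \<beta> \<gamma> where m: "w = \<xi> \<oplus> r \<odot> \<alpha>" "\<xi> \<in> p" "\<alpha> \<in> a"
      "\<beta> \<in> a" "\<gamma> \<in> a" "\<xi> \<oplus> \<alpha> \<ominus> \<beta> \<in> z" "\<xi> \<oplus> \<alpha> \<ominus> \<gamma> \<in> x" "\<xi> \<oplus> \<alpha> \<ominus> \<beta> \<ominus> \<gamma> \<in> p"
      by (elim dilE gamE)
    have c: "\<xi> \<in> carrier W" "\<alpha> \<in> carrier W" "\<beta> \<in> carrier W" "\<gamma> \<in> carrier W"
      using m P points_carrier by auto
    \<comment> \<open>The summation condition provides another element of \<open>p\<close> that
      differs from \<xi> by an element of \<open>a\<close>. By transversality the two agree, which
      forces \<alpha> = \<beta> + \<gamma>.\<close>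
    have "\<alpha> \<ominus> (\<beta> \<oplus> \<gamma>) = (\<xi> \<oplus> \<alpha> \<ominus> \<beta> \<ominus> \<gamma>) \<ominus> \<xi>" using c by algebra
    then have "\<alpha> \<ominus> (\<beta> \<oplus> \<gamma>) \<in> p" using pointsD(5)[OF P(1) m(8,2)] by simp
    moreover have "\<alpha> \<ominus> (\<beta> \<oplus> \<gamma>) \<in> a" using pointsD(3,5)[OF P(2)] m by blast
    ultimately have z: "\<alpha> \<ominus> (\<beta> \<oplus> \<gamma>) = \<zero>" using P(3) by blast
    have "\<alpha> = (\<alpha> \<ominus> (\<beta> \<oplus> \<gamma>)) \<oplus> (\<beta> \<oplus> \<gamma>)" using c by algebra
    then have \<alpha>: "\<alpha> = \<beta> \<oplus> \<gamma>" unfolding z using c by simp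
    have "\<xi> \<oplus> \<beta> = \<xi> \<oplus> \<alpha> \<ominus> \<gamma>" "\<xi> \<oplus> \<gamma> = \<xi> \<oplus> \<alpha> \<ominus> \<beta>" unfolding \<alpha> using c by algebra+
    then have "\<xi> \<oplus> \<beta> \<in> x" "\<xi> \<oplus> \<gamma> \<in> z" using m by simp_all
    then have e: "\<xi> \<oplus> r \<odot> \<beta> \<in> rel_dil r p a x" "\<xi> \<oplus> r \<odot> \<gamma> \<in> rel_dil r p a z"
      using dilI[OF refl m(2,4)] dilI[OF refl m(2,5)] by blast+
    show "w \<in> rel_gam (rel_dil r p a x) a p a (rel_dil r p a z)"
    proof (rule gamI[OF _ pointsD(6)[OF P(2) r m(4)] pointsD(6)[OF P(2) r m(5)] _ e(2) _ e(1) _ m(2)])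
      show "w \<in> carrier W" "w \<ominus> r \<odot> \<beta> = \<xi> \<oplus> r \<odot> \<gamma>" "w \<ominus> r \<odot> \<gamma> = \<xi> \<oplus> r \<odot> \<beta>"
        "\<xi> \<oplus> r \<odot> \<gamma> \<ominus> r \<odot> \<gamma> = \<xi>"
        unfolding m(1) \<alpha> using c r by algebra+
    qed
  qed
qed

lemma dil_affine:
  assumes p: "compl p a" and x: "compl x a" and y: "compl y a" and r: "r \<in> carrier K"
  shows "rel_dil r x a y = rel_gam (rel_dil (\<one>\<^bsub>K\<^esub> \<ominus>\<^bsub>K\<^esub> r) p a x) a p a (rel_dil r p a y)"
proof (rule compl_eq)
  note P = complD[OF p] complD[OF x] complD[OF y]
  show "compl (rel_dil r x a y) a" "compl (rel_gam (rel_dil (\<one>\<^bsub>K\<^esub> \<ominus>\<^bsub>K\<^esub> r) p a x) a p a (rel_dil r p a y)) a"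
    using assms by (auto intro!: dil_compl gam_compl)
  show "rel_dil r x a y \<subseteq> rel_gam (rel_dil (\<one>\<^bsub>K\<^esub> \<ominus>\<^bsub>K\<^esub> r) p a x) a p a (rel_dil r p a y)"
  proof
    fix w assume "w \<in> rel_dil r x a y"
    then obtain \<xi> \<alpha> where m: "w = \<xi> \<oplus> r \<odot> \<alpha>" "\<xi> \<in> x" "\<alpha> \<in> a" "\<xi> \<oplus> \<alpha> \<in> y"
      by (elim dilE)
    have c: "\<xi> \<in> carrier W" "\<alpha> \<in> carrier W" using m P points_carrier by auto
    \<comment> \<open>Change of origin from \<open>x\<close> to \<open>p\<close>: over \<pi> the
      point \<open>x\<close> has height \<gamma> and \<open>y\<close> has height \<gamma> +
      \<alpha>. The claim becomes \<gamma> + r \<alpha> = (1 - r) \<gamma> + r (\<gamma> +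
      \<alpha>).\<close>
    obtain \<pi> \<gamma> where d: "\<xi> = \<pi> \<oplus> \<gamma>" "\<pi> \<in> p" "\<gamma> \<in> a" using compl_decomp[OF p c(1)] by blast
    have cd: "\<pi> \<in> carrier W" "\<gamma> \<in> carrier W" using d P points_carrier by auto
    have e: "(\<one>\<^bsub>K\<^esub> \<ominus>\<^bsub>K\<^esub> r) \<odot> \<gamma> = \<gamma> \<ominus> r \<odot> \<gamma>"
      using cd r by (simp add: R.minus_eq M.minus_eq smult_l_distr smult_l_minus)
    have f1: "\<pi> \<oplus> (\<gamma> \<ominus> r \<odot> \<gamma>) \<in> rel_dil (\<one>\<^bsub>K\<^esub> \<ominus>\<^bsub>K\<^esub> r) p a x"
      using m(2) unfolding d e[symmetric] by (intro dilI[OF refl d(2,3)])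
    have f2: "\<pi> \<oplus> r \<odot> (\<gamma> \<oplus> \<alpha>) \<in> rel_dil r p a y"
    proof (rule dilI[OF refl d(2)])
      show "\<gamma> \<oplus> \<alpha> \<in> a" using pointsD(3)[OF P(2) d(3) m(3)] .
      show "\<pi> \<oplus> (\<gamma> \<oplus> \<alpha>) \<in> y" using m(4) unfolding d(1) using cd c(2) by (simp add: M.a_assoc)
    qed
    have f3: "\<gamma> \<ominus> r \<odot> \<gamma> \<in> a" "r \<odot> (\<gamma> \<oplus> \<alpha>) \<in> a"
      using d(3) m(3) r pointsD(3,5,6)[OF P(2)] by auto
    show "w \<in> rel_gam (rel_dil (\<one>\<^bsub>K\<^esub> \<ominus>\<^bsub>K\<^esub> r) p a x) a p a (rel_dil r p a y)"
    proof (rule gamI[OF _ f3 _ f2 _ f1 _ d(2)])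
      show "w \<in> carrier W" "w \<ominus> (\<gamma> \<ominus> r \<odot> \<gamma>) = \<pi> \<oplus> r \<odot> (\<gamma> \<oplus> \<alpha>)"
        "w \<ominus> r \<odot> (\<gamma> \<oplus> \<alpha>) = \<pi> \<oplus> (\<gamma> \<ominus> r \<odot> \<gamma>)"
        "\<pi> \<oplus> r \<odot> (\<gamma> \<oplus> \<alpha>) \<ominus> r \<odot> (\<gamma> \<oplus> \<alpha>) = \<pi>"
        unfolding m(1) d(1) using cd c(2) r by algebra+
    qed
  qed
qed

lemma affine_geom:
  assumes a: "a \<in> points"
  shows "affine_space K (U geom a) (\<lambda>x y z. rel_gam x a y a z) (\<lambda>r x y. rel_dil r x a y)"
  unfolding affine_space_def Let_def
proof (rule ballI)
  fix p assume "p \<in> U geom a"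
  then have p: "compl p a" using a by (simp add: U_iff)
  note pt = complD(1)
  define L :: "('k, 'w set) module" where
    "L = linearization (U geom a) (\<lambda>x y z. rel_gam x a y a z) (\<lambda>r x y. rel_dil r x a y) p"
  have L: "x \<in> carrier L \<longleftrightarrow> compl x a" "\<zero>\<^bsub>L\<^esub> = p" "x \<oplus>\<^bsub>L\<^esub> y = rel_gam x a p a y"
    "r \<odot>\<^bsub>L\<^esub> y = rel_dil r p a y" for x y r
    using a by (auto simp: L_def linearization_def U_iff)
  \<comment> \<open>Para-associativity and the idempotent laws make the complements of
    \<open>a\<close> a torsor. Linearized at \<open>p\<close> it is a group with neutral element
    \<open>p\<close>, in which the inverse of x is \<Gamma>(p, a, x, a, p).\<close>
  have inv: "rel_gam (rel_gam p a x a p) a p a x = p" if "compl x a" for x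
    using that p a by (simp add: gam_para_left gam_para_right pt gam_idem gam_idem_right)
  have "module K L"
  proof (rule moduleI)
    show "cring K" by (rule R.is_cring)
    show "abelian_group L"
    proof (rule abelian_groupI, unfold L)
      fix x y z assume C: "compl x a" "compl y a" "compl z a"
      show "compl (rel_gam x a p a y) a" by (rule gam_compl[OF C(1) p C(2)])
      show "rel_gam (rel_gam x a p a y) a p a z = rel_gam x a p a (rel_gam y a p a z)"
        using C p a by (simp add: gam_para_left gam_para_right pt)
      show "rel_gam x a p a y = rel_gam y a p a x" by (rule gam_swap[OF a a])
      show "rel_gam p a p a x = x" by (rule gam_idem[OF p p pt[OF C(1)]])
      show "\<exists>y\<in>carrier L. rel_gam y a p a x = p"
        using inv[OF C(1)] gam_compl[OF p C(1) p] L(1) by blast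
    qed (rule p)
  qed (simp_all add: L dil_compl p dil_plus dil_times dil_distrib dil_one gam_compl)
  then interpret L: module K L .
  have L_minus: "x \<ominus>\<^bsub>L\<^esub> y = rel_gam x a y a p" if "compl x a" "compl y a" for x y
  proof -
    have "\<ominus>\<^bsub>L\<^esub> y = rel_gam p a y a p"
      by (rule L.minus_equality) (use that inv[OF that(2)] gam_compl p in \<open>simp_all add: L\<close>)
    then show ?thesis
      using that p a by (simp add: a_minus_def L pt gam_idem gam_idem_right flip: gam_para_right gam_para_left)
  qed
  show "module K L \<and>
      (\<forall>x\<in>U geom a. \<forall>y\<in>U geom a. \<forall>z\<in>U geom a. rel_gam x a y a z = (x \<ominus>\<^bsub>L\<^esub> y) \<oplus>\<^bsub>L\<^esub> z) \<and>
      (\<forall>r\<in>carrier K. \<forall>x\<in>U geom a. \<forall>y\<in>U geom a.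
         rel_dil r x a y = ((\<one>\<^bsub>K\<^esub> \<ominus>\<^bsub>K\<^esub> r) \<odot>\<^bsub>L\<^esub> x) \<oplus>\<^bsub>L\<^esub> (r \<odot>\<^bsub>L\<^esub> y))"
  proof (intro conjI ballI L.module_axioms)
    fix x y z assume "x \<in> U geom a" "y \<in> U geom a" "z \<in> U geom a"
    then have C: "compl x a" "compl y a" "compl z a" using a by (simp_all add: U_iff)
    then show "rel_gam x a y a z = (x \<ominus>\<^bsub>L\<^esub> y) \<oplus>\<^bsub>L\<^esub> z"
      using p a by (simp add: L_minus L gam_para_left gam_para_right pt gam_idem gam_idem_right)
  next
    fix r x y assume "r \<in> carrier K" "x \<in> U geom a" "y \<in> U geom a"
    then show "rel_dil r x a y = ((\<one>\<^bsub>K\<^esub> \<ominus>\<^bsub>K\<^esub> r) \<odot>\<^bsub>L\<^esub> x) \<oplus>\<^bsub>L\<^esub> (r \<odot>\<^bsub>L\<^esub> y)"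
      unfolding L using a p by (intro dil_affine) (simp_all add: U_iff)
  qed
qed

theorem geom_associative_geometry: "associative_geometry K geom"
proof (unfold_locales, unfold geom_simps)
  fix x a y b z assume P: "x \<in> points" "a \<in> points" "y \<in> points" "b \<in> points" "z \<in> points"
  show "rel_gam x a y b z \<in> points" using P by (rule gam_point)
  show "rel_gam x a y b z = rel_gam z b y a x \<and> rel_gam z b y a x = rel_gam a x y z b"
    using gam_swap[OF P(2,4), of x y z] gam_flip[OF P] by simp
next
  fix x y z u v a b
  assume P: "x \<in> points" "y \<in> points" "z \<in> points" "u \<in> points" "v \<in> points" "a \<in> points" "b \<in> points"
  show "rel_gam (rel_gam x a y b z) a u b v = rel_gam x a (rel_gam u a z b y) b v \<and>
      rel_gam x a (rel_gam u a z b y) b v = rel_gam x a y b (rel_gam z a u b v)"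
    using gam_para_left[OF P(1,6,2,7,3,4,5)] gam_para_right[OF P(1,6,2,7,3,4,5)] by simp
qed (simp_all add: dil_point L_structural_geom M_structural_geom R_structural_geom
    gam_join geom_join gam_meet geom_meet U_iff transversal_iff affine_geom dil_compl
    gam_compl gam_compl_right gam_idem gam_idem_right gam_left gam_right)

subsection \<open>Points as graphs\<close>

definition graph :: "'w set \<Rightarrow> ('w \<Rightarrow> 'w) \<Rightarrow> 'w set" where
  "graph p \<phi> = {s \<oplus> \<phi> s | s. s \<in> p}"

definition point_hom :: "'w set \<Rightarrow> 'w set \<Rightarrow> ('w \<Rightarrow> 'w) \<Rightarrow> bool" where
  "point_hom p q \<phi> \<longleftrightarrow> \<phi> \<in> p \<rightarrow> q \<and>
     (\<forall>s\<in>p. \<forall>t\<in>p. \<phi> (s \<oplus> t) = \<phi> s \<oplus> \<phi> t) \<and>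
     (\<forall>r\<in>carrier K. \<forall>s\<in>p. \<phi> (r \<odot> s) = r \<odot> \<phi> s) \<and>
     (\<forall>T\<in>\<Omega>. \<forall>s\<in>p. \<phi> (T s) = T (\<phi> s))"

lemma point_homD:
  assumes "point_hom p q \<phi>"
  shows "s \<in> p \<Longrightarrow> \<phi> s \<in> q" "s \<in> p \<Longrightarrow> t \<in> p \<Longrightarrow> \<phi> (s \<oplus> t) = \<phi> s \<oplus> \<phi> t"
    "r \<in> carrier K \<Longrightarrow> s \<in> p \<Longrightarrow> \<phi> (r \<odot> s) = r \<odot> \<phi> s" "T \<in> \<Omega> \<Longrightarrow> s \<in> p \<Longrightarrow> \<phi> (T s) = T (\<phi> s)"
  using assms unfolding point_hom_def by auto

lemma graphI: "s \<in> p \<Longrightarrow> s \<oplus> \<phi> s \<in> graph p \<phi>"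
  unfolding graph_def by blast

lemma graphE:
  assumes "w \<in> graph p \<phi>"
  obtains s where "s \<in> p" "w = s \<oplus> \<phi> s"
  using assms unfolding graph_def by blast

lemma compl_decomp_unique:
  assumes pq: "compl p q" and "s \<in> p" "t \<in> q" "s' \<in> p" "t' \<in> q" and eq: "s \<oplus> t = s' \<oplus> t'"
  shows "s = s' \<and> t = t'"
proof -
  note P = complD[OF pq]
  have c: "s \<in> carrier W" "t \<in> carrier W" "s' \<in> carrier W" "t' \<in> carrier W"
    using assms P points_carrier by auto
  have "s \<ominus> s' = (s \<oplus> t) \<ominus> (s' \<oplus> t)" using c by algebra
  also have "\<dots> = t' \<ominus> t" unfolding eq using c by algebra
  finally have "s \<ominus> s' \<in> q" using assms pointsD(5)[OF P(2)] by simp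
  then have z: "s \<ominus> s' = \<zero>" using assms pointsD(5)[OF P(1)] P(3) by blast
  have "s = (s \<ominus> s') \<oplus> s'" using c by algebra
  then have "s = s'" unfolding z using c by simp
  then show ?thesis using eq c by simp
qed

lemma graph_compl:
  assumes pq: "compl p q" and \<phi>: "point_hom p q \<phi>"
  shows "compl (graph p \<phi>) q"
proof (rule complI)
  note P = complD[OF pq] and H = point_homD[OF \<phi>]
  have c: "s \<in> carrier W" "\<phi> s \<in> carrier W" if "s \<in> p" for s
    using that P H points_carrier by auto
  have "\<phi> (\<zero>\<^bsub>K\<^esub> \<odot> \<zero>) = \<zero>\<^bsub>K\<^esub> \<odot> \<phi> \<zero>" using H(3) pointsD(2)[OF P(1)] by blast
  then have zero: "\<phi> \<zero> = \<zero>" using c pointsD(2)[OF P(1)] by simp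
  show "graph p \<phi> \<in> points"
  proof (rule pointsI)
    show "graph p \<phi> \<subseteq> carrier W" unfolding graph_def using c by auto
    show "\<zero> \<in> graph p \<phi>" using graphI[OF pointsD(2)[OF P(1)], of \<phi>] zero by simp
  next
    fix u v assume "u \<in> graph p \<phi>" "v \<in> graph p \<phi>"
    then obtain s t where st: "s \<in> p" "t \<in> p" "u = s \<oplus> \<phi> s" "v = t \<oplus> \<phi> t" by (elim graphE)
    have "u \<oplus> v = (s \<oplus> t) \<oplus> \<phi> (s \<oplus> t)" unfolding st(3,4) H(2)[OF st(1,2)]
      using c[OF st(1)] c[OF st(2)] by algebra
    then show "u \<oplus> v \<in> graph p \<phi>" using graphI[OF pointsD(3)[OF P(1) st(1,2)]] by simp
  next
    fix r u assume r: "r \<in> carrier K" and "u \<in> graph p \<phi>"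
    then obtain s where s: "s \<in> p" "u = s \<oplus> \<phi> s" by (elim graphE)
    have "r \<odot> u = r \<odot> s \<oplus> \<phi> (r \<odot> s)" unfolding s(2) H(3)[OF r s(1)]
      using c[OF s(1)] r by algebra
    then show "r \<odot> u \<in> graph p \<phi>" using graphI[OF pointsD(6)[OF P(1) r s(1)]] by simp
  next
    fix T u assume T: "T \<in> \<Omega>" and "u \<in> graph p \<phi>"
    then obtain s where s: "s \<in> p" "u = s \<oplus> \<phi> s" by (elim graphE)
    have "T u = T s \<oplus> \<phi> (T s)" unfolding s(2) H(4)[OF T s(1)]
      using c[OF s(1)] T by (simp add: op_add)
    then show "T u \<in> graph p \<phi>" using graphI[OF pointsD(7)[OF P(1) T s(1)]] by simp
  qed
  show "q \<in> points" by (rule P)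
  fix u assume "u \<in> graph p \<phi>" and uq: "u \<in> q"
  then obtain s where s: "s \<in> p" "u = s \<oplus> \<phi> s" by (elim graphE)
  have "u \<ominus> \<phi> s = s" unfolding s(2) using c[OF s(1)] by algebra
  then have "s \<in> q" using pointsD(5)[OF P(2) uq H(1)[OF s(1)]] by simp
  then have "s = \<zero>" using P(3) s(1) by blast
  then show "u = \<zero>" using s(2) zero by simp
next
  note P = complD[OF pq] and H = point_homD[OF \<phi>]
  fix w assume "w \<in> carrier W"
  then obtain s t where st: "w = s \<oplus> t" "s \<in> p" "t \<in> q" using compl_decomp[OF pq] by blast
  have c: "s \<in> carrier W" "\<phi> s \<in> carrier W" "t \<in> carrier W"
    using st P H points_carrier by auto
  have "w = (s \<oplus> \<phi> s) \<oplus> (t \<ominus> \<phi> s)" unfolding st(1) using c by algebra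
  then show "\<exists>u\<in>graph p \<phi>. \<exists>v\<in>q. w = u \<oplus> v"
    using graphI[OF st(2)] pointsD(5)[OF P(2) st(3) H(1)[OF st(2)]] by blast
qed

text \<open>The bridge from maps to points: to identify an operation on graphs, it is enough to know
  that its value is a complement of \<open>q\<close> and to exhibit one element of it over each s in
  \<open>p\<close>.\<close>

lemma graph_eqI:
  assumes "compl p q" "point_hom p q \<phi>" "compl S q" "\<And>s. s \<in> p \<Longrightarrow> s \<oplus> \<phi> s \<in> S"
  shows "graph p \<phi> = S"
  using assms by (intro compl_eq[OF graph_compl]) (auto simp: graph_def)

lemma graph_inject:
  assumes pq: "compl p q" and hom: "point_hom p q \<phi>" "point_hom p q \<psi>"
    and eq: "graph p \<phi> = graph p \<psi>" and s: "s \<in> p"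
  shows "\<phi> s = \<psi> s"
proof -
  have "s \<oplus> \<phi> s \<in> graph p \<psi>" using graphI[OF s, of \<phi>] eq by simp
  then obtain t where "t \<in> p" "s \<oplus> \<phi> s = t \<oplus> \<psi> t" by (rule graphE)
  then show ?thesis
    using compl_decomp_unique[OF pq s point_homD(1)[OF hom(1) s]] point_homD(1)[OF hom(2)] by blast
qed

lemma graph_add:
  assumes pq: "compl p q" and hom: "point_hom p q \<phi>" "point_hom p q \<psi>" "point_hom p q \<chi>"
    and \<chi>: "\<And>s. s \<in> p \<Longrightarrow> \<chi> s = \<phi> s \<oplus> \<psi> s"
  shows "graph p \<chi> = rel_gam (graph p \<phi>) q p q (graph p \<psi>)"
proof (rule graph_eqI[OF pq hom(3)])
  note P = complD[OF pq]
  show "compl (rel_gam (graph p \<phi>) q p q (graph p \<psi>)) q"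
    using pq hom by (intro gam_compl graph_compl)
  fix s assume s: "s \<in> p"
  have q: "\<phi> s \<in> q" "\<psi> s \<in> q" using s hom point_homD(1) by auto
  have c: "s \<in> carrier W" "\<phi> s \<in> carrier W" "\<psi> s \<in> carrier W" using s q P points_carrier by auto
  show "s \<oplus> \<chi> s \<in> rel_gam (graph p \<phi>) q p q (graph p \<psi>)"
  proof (rule gamI[OF _ q _ graphI[OF s] _ graphI[OF s] _ s])
    show "s \<oplus> \<chi> s \<in> carrier W" "s \<oplus> \<chi> s \<ominus> \<phi> s = s \<oplus> \<psi> s" "s \<oplus> \<chi> s \<ominus> \<psi> s = s \<oplus> \<phi> s"
      "s \<oplus> \<psi> s \<ominus> \<psi> s = s"
      unfolding \<chi>[OF s] using c by algebra+
  qed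
qed

lemma graph_smult:
  assumes pq: "compl p q" and hom: "point_hom p q \<phi>" "point_hom p q \<chi>" and r: "r \<in> carrier K"
    and \<chi>: "\<And>s. s \<in> p \<Longrightarrow> \<chi> s = r \<odot> \<phi> s"
  shows "graph p \<chi> = rel_dil r p q (graph p \<phi>)"
proof (rule graph_eqI[OF pq hom(2)])
  show "compl (rel_dil r p q (graph p \<phi>)) q"
    using pq hom r by (intro dil_compl graph_compl)
  fix s assume s: "s \<in> p"
  show "s \<oplus> \<chi> s \<in> rel_dil r p q (graph p \<phi>)"
    unfolding \<chi>[OF s] by (rule dilI[OF refl s point_homD(1)[OF hom(1) s] graphI[OF s, of \<phi>]])
qed

lemma graph_linear_map:
  assumes pq: "compl p q"
    and hom: "\<And>x. x \<in> carrier A \<Longrightarrow> point_hom p q (\<phi> x)"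
    and A: "module K A"
    and add: "\<And>x y s. x \<in> carrier A \<Longrightarrow> y \<in> carrier A \<Longrightarrow> s \<in> p \<Longrightarrow> \<phi> (x \<oplus>\<^bsub>A\<^esub> y) s = \<phi> x s \<oplus> \<phi> y s"
    and smult: "\<And>r x s. r \<in> carrier K \<Longrightarrow> x \<in> carrier A \<Longrightarrow> s \<in> p \<Longrightarrow> \<phi> (r \<odot>\<^bsub>A\<^esub> x) s = r \<odot> \<phi> x s"
  shows "linear_map K A (U_module geom q p) (\<lambda>x. graph p (\<phi> x))"
proof -
  interpret A: module K A by fact
  have "compl (graph p (\<phi> x)) q" if "x \<in> carrier A" for x
    using graph_compl[OF pq hom[OF that]] .
  moreover have "graph p (\<phi> (x \<oplus>\<^bsub>A\<^esub> y)) = rel_gam (graph p (\<phi> x)) q p q (graph p (\<phi> y))"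
    if "x \<in> carrier A" "y \<in> carrier A" for x y
    using that by (intro graph_add pq hom add A.a_closed)
  moreover have "graph p (\<phi> (r \<odot>\<^bsub>A\<^esub> x)) = rel_dil r p q (graph p (\<phi> x))"
    if "r \<in> carrier K" "x \<in> carrier A" for r x
    using that by (intro graph_smult pq hom smult A.smult_closed)
  ultimately show ?thesis
    using complD(2)[OF pq] by (auto simp: linear_map_def U_module_def linearization_def U_iff)
qed

text \<open>Along \<open>p\<close> and \<open>q\<close>, read points as relations from
  \<open>p\<close> to \<open>q\<close>. Then \<Gamma>(x, q, y, p, z) contains the composite of z,
  the converse of y, and x: s goes to t by z, t goes back to u by y, and u goes to v by x.\<close>

lemma gam_decompI:
  assumes pq: "compl p q" and st: "s \<in> p" "u \<in> p" "t \<in> q" "v \<in> q"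
    and "s \<oplus> t \<in> z" "u \<oplus> t \<in> y" "u \<oplus> v \<in> x"
  shows "s \<oplus> v \<in> rel_gam x q y p z"
proof (rule gamI[OF _ _ _ _ assms(6) _ assms(8) _ assms(7)])
  note P = complD[OF pq]
  have c: "s \<in> carrier W" "t \<in> carrier W" "u \<in> carrier W" "v \<in> carrier W"
    using st P points_carrier by auto
  show "v \<ominus> t \<in> q" "s \<ominus> u \<in> p" using st pointsD(5) P by auto
  show "s \<oplus> v \<in> carrier W" "s \<oplus> v \<ominus> (v \<ominus> t) = s \<oplus> t" "s \<oplus> v \<ominus> (s \<ominus> u) = u \<oplus> v"
    "s \<oplus> t \<ominus> (s \<ominus> u) = u \<oplus> t"
    using c by algebra+
qed

text \<open>The middle point is a graph over \<open>q\<close>, so its converse as a relation from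
  \<open>p\<close> to \<open>q\<close> is the map \<open>\<beta>\<close> itself.\<close>

lemma graph_triple_product:
  assumes pq: "compl p q"
    and hom: "point_hom p q \<phi>" "point_hom q p \<beta>" "point_hom p q \<psi>" "point_hom p q \<chi>"
    and \<chi>: "\<And>s. s \<in> p \<Longrightarrow> \<chi> s = \<phi> (\<beta> (\<psi> s))"
  shows "graph p \<chi> = rel_gam (graph p \<phi>) q (graph q \<beta>) p (graph p \<psi>)"
proof (rule graph_eqI[OF pq hom(4)])
  note P = complD[OF pq] and H = point_homD(1)[OF hom(1)] point_homD(1)[OF hom(2)] point_homD(1)[OF hom(3)]
  show "compl (rel_gam (graph p \<phi>) q (graph q \<beta>) p (graph p \<psi>)) q"
    using pq hom by (intro gam_compl graph_compl) (auto intro: compl_sym)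
  fix s assume s: "s \<in> p"
  then have m: "\<psi> s \<in> q" "\<beta> (\<psi> s) \<in> p" "\<phi> (\<beta> (\<psi> s)) \<in> q" using H by auto
  have "\<beta> (\<psi> s) \<oplus> \<psi> s = \<psi> s \<oplus> \<beta> (\<psi> s)" using m P points_carrier by (intro M.a_comm) auto
  then have "\<beta> (\<psi> s) \<oplus> \<psi> s \<in> graph q \<beta>" using graphI[OF m(1)] by simp
  then show "s \<oplus> \<chi> s \<in> rel_gam (graph p \<phi>) q (graph q \<beta>) p (graph p \<psi>)"
    unfolding \<chi>[OF s] by (intro gam_decompI[OF pq s m(2,1,3)] graphI s m)
qed

text \<open>Here the middle point is a graph over \<open>p\<close>, so its converse has to be
  followed backwards; \<open>\<theta>\<close> lifts \<open>\<phi>\<close> through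
  \<open>\<delta>\<close> for this purpose. The positions of \<open>p\<close> and \<open>q\<close>
  are the opposite of those in \<open>gam_decompI\<close>, so the arguments are reversed and
  \<open>\<phi>\<close> is applied before \<open>\<psi>\<close>.\<close>

lemma graph_unital_product:
  assumes pq: "compl p q"
    and hom: "point_hom p q \<phi>" "point_hom p q \<delta>" "point_hom p q \<psi>" "point_hom p q \<chi>"
    and \<delta>: "compl (graph p \<delta>) p"
    and \<theta>: "\<And>s. s \<in> p \<Longrightarrow> \<theta> s \<in> p \<and> \<delta> (\<theta> s) = \<phi> s"
    and \<chi>: "\<And>s. s \<in> p \<Longrightarrow> \<chi> s = \<psi> (\<theta> s)"
  shows "graph p \<chi> = rel_gam (graph p \<phi>) p (graph p \<delta>) q (graph p \<psi>)"
proof (rule graph_eqI[OF pq hom(4)])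
  note P = complD[OF pq]
  show "compl (rel_gam (graph p \<phi>) p (graph p \<delta>) q (graph p \<psi>)) q"
    by (rule gam_compl_right[OF graph_compl[OF pq hom(1)] \<delta> graph_compl[OF pq hom(3)]])
  fix s assume s: "s \<in> p"
  have "s \<oplus> \<psi> (\<theta> s) \<in> rel_gam (graph p \<psi>) q (graph p \<delta>) p (graph p \<phi>)"
  proof (rule gam_decompI[OF pq s])
    show "\<theta> s \<in> p" "\<phi> s \<in> q" "\<psi> (\<theta> s) \<in> q" "s \<oplus> \<phi> s \<in> graph p \<phi>" "\<theta> s \<oplus> \<psi> (\<theta> s) \<in> graph p \<psi>"
      using \<theta> s hom point_homD(1) by (auto intro: graphI)
    show "\<theta> s \<oplus> \<phi> s \<in> graph p \<delta>" using \<theta>[OF s] graphI[of "\<theta> s" p \<delta>] by simp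
  qed
  then show "s \<oplus> \<chi> s \<in> rel_gam (graph p \<phi>) p (graph p \<delta>) q (graph p \<psi>)"
    using \<chi>[OF s] gam_swap[OF P(2,1)] by simp
qed

end

section \<open>Unital algebras\<close>

definition prod_module ::
  "('k, 'a, 'm) module_scheme \<Rightarrow> ('k, 'b, 'n) module_scheme \<Rightarrow> ('k, 'a \<times> 'b) module"
where
  "prod_module M N =
     \<lparr> carrier = carrier M \<times> carrier N, monoid.mult = undefined, one = undefined,
       zero = (\<zero>\<^bsub>M\<^esub>, \<zero>\<^bsub>N\<^esub>), add = (\<lambda>(a, b) (c, d). (a \<oplus>\<^bsub>M\<^esub> c, b \<oplus>\<^bsub>N\<^esub> d)),
       smult = (\<lambda>r (a, b). (r \<odot>\<^bsub>M\<^esub> a, r \<odot>\<^bsub>N\<^esub> b)) \<rparr>"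

lemma prod_module_simps [simp]:
  "carrier (prod_module M N) = carrier M \<times> carrier N"
  "\<zero>\<^bsub>prod_module M N\<^esub> = (\<zero>\<^bsub>M\<^esub>, \<zero>\<^bsub>N\<^esub>)"
  "(a, b) \<oplus>\<^bsub>prod_module M N\<^esub> (c, d) = (a \<oplus>\<^bsub>M\<^esub> c, b \<oplus>\<^bsub>N\<^esub> d)"
  "r \<odot>\<^bsub>prod_module M N\<^esub> (a, b) = (r \<odot>\<^bsub>M\<^esub> a, r \<odot>\<^bsub>N\<^esub> b)"
  by (simp_all add: prod_module_def)

lemma module_prod_module:
  assumes "module K M" "module K N"
  shows "module K (prod_module M N)"
proof -
  interpret M: module K M by fact
  interpret N: module K N by fact
  show ?thesis
  proof (rule moduleI)
    show "cring K" by (rule M.R.is_cring)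
    show "abelian_group (prod_module M N)"
    proof (rule abelian_groupI)
      fix u assume "u \<in> carrier (prod_module M N)"
      then show "\<exists>v\<in>carrier (prod_module M N). v \<oplus>\<^bsub>prod_module M N\<^esub> u = \<zero>\<^bsub>prod_module M N\<^esub>"
        by (intro bexI[of _ "(\<ominus>\<^bsub>M\<^esub> fst u, \<ominus>\<^bsub>N\<^esub> snd u)"]) (auto simp: M.M.l_neg N.M.l_neg)
    qed (auto simp: M.M.a_ac N.M.a_ac)
  qed (auto simp: M.smult_l_distr N.smult_l_distr M.smult_r_distr N.smult_r_distr
         M.smult_assoc1 N.smult_assoc1)
qed

context unital_assoc_algebra
begin

definition plane :: "('k, 'a \<times> 'a) module" where
  "plane = prod_module A A"

text \<open>Multiplication from the left, so that the equivariant maps are right multiplications.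
  These compose in the order in which the product of a transversal triple composes its factors, and
  the original algebra appears rather than its opposite.\<close>

definition scalings :: "('a \<times> 'a \<Rightarrow> 'a \<times> 'a) set" where
  "scalings = {\<lambda>(a, b). (c \<otimes>\<^bsub>A\<^esub> a, c \<otimes>\<^bsub>A\<^esub> b) | c. c \<in> carrier A}"

lemma plane_simps [simp]:
  "carrier plane = carrier A \<times> carrier A"
  "\<zero>\<^bsub>plane\<^esub> = (\<zero>\<^bsub>A\<^esub>, \<zero>\<^bsub>A\<^esub>)"
  "(a, b) \<oplus>\<^bsub>plane\<^esub> (c, d) = (a \<oplus>\<^bsub>A\<^esub> c, b \<oplus>\<^bsub>A\<^esub> d)"
  "r \<odot>\<^bsub>plane\<^esub> (a, b) = (r \<odot>\<^bsub>A\<^esub> a, r \<odot>\<^bsub>A\<^esub> b)"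
  by (simp_all add: plane_def)

lemma scalingsE:
  assumes "T \<in> scalings"
  obtains c where "c \<in> carrier A" "\<And>a b. T (a, b) = (c \<otimes>\<^bsub>A\<^esub> a, c \<otimes>\<^bsub>A\<^esub> b)"
  using assms unfolding scalings_def by auto

lemma operator_module_plane: "operator_module K plane scalings"
proof -
  interpret W: module K plane
    unfolding plane_def by (intro module_prod_module module_axioms)
  show ?thesis
  proof
    fix T assume "T \<in> scalings"
    then obtain c where "c \<in> carrier A" "\<And>a b. T (a, b) = (c \<otimes>\<^bsub>A\<^esub> a, c \<otimes>\<^bsub>A\<^esub> b)"
      using scalingsE by blast
    then show "linear_map K plane plane T"
      by (auto simp: linear_map_def r_distr smult_mult_right)
  qed
qed

sublocale plane: operator_module K plane scalings
  by (rule operator_module_plane)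

definition x_axis :: "('a \<times> 'a) set" where
  "x_axis = carrier A \<times> {\<zero>\<^bsub>A\<^esub>}"

definition y_axis :: "('a \<times> 'a) set" where
  "y_axis = {\<zero>\<^bsub>A\<^esub>} \<times> carrier A"

definition slope_hom :: "'a \<Rightarrow> 'a \<times> 'a \<Rightarrow> 'a \<times> 'a" where
  "slope_hom x = (\<lambda>(a, b). (\<zero>\<^bsub>A\<^esub>, a \<otimes>\<^bsub>A\<^esub> x))"

lemma slope_hom_simp [simp]: "slope_hom x (a, b) = (\<zero>\<^bsub>A\<^esub>, a \<otimes>\<^bsub>A\<^esub> x)"
  by (simp add: slope_hom_def)

definition line :: "'a \<Rightarrow> ('a \<times> 'a) set" where
  "line x = plane.graph x_axis (slope_hom x)"

lemma axes_compl: "plane.compl x_axis y_axis"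
proof (rule plane.complI)
  show "x_axis \<in> plane.points"
    by (rule plane.pointsI) (auto simp: x_axis_def elim!: scalingsE)
  show "y_axis \<in> plane.points"
    by (rule plane.pointsI) (auto simp: y_axis_def elim!: scalingsE)
qed (auto simp: x_axis_def y_axis_def)

lemma slope_hom_point_hom:
  assumes x: "x \<in> carrier A"
  shows "plane.point_hom x_axis y_axis (slope_hom x)"
proof -
  show ?thesis
    using x unfolding plane.point_hom_def
    by (auto simp: x_axis_def y_axis_def l_distr m_assoc smult_mult_left elim!: scalingsE)
qed

lemma line_compl: "x \<in> carrier A \<Longrightarrow> plane.compl (line x) y_axis"
  unfolding line_def by (intro plane.graph_compl axes_compl slope_hom_point_hom)

lemma bij_betw_line: "bij_betw line (carrier A) (U plane.geom y_axis)"
proof -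
  note y_axis = plane.complD(2)[OF axes_compl]
  have "x = y" if xy: "x \<in> carrier A" "y \<in> carrier A" "line x = line y" for x y
  proof -
    have "slope_hom x (\<one>\<^bsub>A\<^esub>, \<zero>\<^bsub>A\<^esub>) = slope_hom y (\<one>\<^bsub>A\<^esub>, \<zero>\<^bsub>A\<^esub>)"
      using xy unfolding line_def
      by (intro plane.graph_inject[OF axes_compl slope_hom_point_hom slope_hom_point_hom])
        (auto simp: x_axis_def)
    then show ?thesis using xy by simp
  qed
  moreover have "S \<in> line ` carrier A" if S: "plane.compl S y_axis" for S
  proof -
    \<comment> \<open>The slope of \<open>S\<close> is found over the generator of
      \<open>x_axis\<close>: the component of (1, 0) in \<open>S\<close> must be some (1, x). Its
      left multiples then fill \<open>line x\<close>.\<close>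
    have "(\<one>\<^bsub>A\<^esub>, \<zero>\<^bsub>A\<^esub>) \<in> carrier plane" by simp
    then obtain u v where uv: "(\<one>\<^bsub>A\<^esub>, \<zero>\<^bsub>A\<^esub>) = u \<oplus>\<^bsub>plane\<^esub> v" "u \<in> S" "v \<in> y_axis"
      by (rule plane.compl_decomp[OF S])
    have "u \<in> carrier plane" using plane.points_carrier[OF plane.complD(1)[OF S] uv(2)] .
    then obtain x where x: "x \<in> carrier A" "u = (\<one>\<^bsub>A\<^esub>, x)"
      using uv by (cases u) (auto simp: y_axis_def)
    have "line x = S"
      unfolding line_def
    proof (rule plane.graph_eqI[OF axes_compl slope_hom_point_hom[OF x(1)] S])
      fix s assume "s \<in> x_axis"
      then obtain a where a: "a \<in> carrier A" "s = (a, \<zero>\<^bsub>A\<^esub>)" unfolding x_axis_def by auto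
      have "(\<lambda>(c, d). (a \<otimes>\<^bsub>A\<^esub> c, a \<otimes>\<^bsub>A\<^esub> d)) \<in> scalings" using a unfolding scalings_def by blast
      from plane.pointsD(7)[OF plane.complD(1)[OF S] this uv(2)]
      show "s \<oplus>\<^bsub>plane\<^esub> slope_hom x s \<in> S" using a x by simp
    qed
    then show ?thesis using x by blast
  qed
  ultimately show ?thesis
    using line_compl y_axis by (auto simp: bij_betw_def inj_on_def plane.U_iff)
qed

lemma diagonal_compl: "plane.compl (line \<one>\<^bsub>A\<^esub>) x_axis"
proof (rule plane.complI)
  show "line \<one>\<^bsub>A\<^esub> \<in> plane.points" using plane.complD(1)[OF line_compl] by simp
  show "x_axis \<in> plane.points" using plane.complD(1)[OF axes_compl] .
  show "u = \<zero>\<^bsub>plane\<^esub>" if "u \<in> line \<one>\<^bsub>A\<^esub>" "u \<in> x_axis" for u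
    using that by (auto simp: line_def plane.graph_def x_axis_def)
  fix w assume "w \<in> carrier plane"
  then obtain a b where w: "w = (a, b)" "a \<in> carrier A" "b \<in> carrier A" by auto
  have "(b, \<zero>\<^bsub>A\<^esub>) \<oplus>\<^bsub>plane\<^esub> slope_hom \<one>\<^bsub>A\<^esub> (b, \<zero>\<^bsub>A\<^esub>) \<in> line \<one>\<^bsub>A\<^esub>"
    unfolding line_def using w by (intro plane.graphI) (auto simp: x_axis_def)
  moreover have "(a \<ominus>\<^bsub>A\<^esub> b, \<zero>\<^bsub>A\<^esub>) \<in> x_axis" using w by (simp add: x_axis_def)
  moreover have "b \<oplus>\<^bsub>A\<^esub> (a \<ominus>\<^bsub>A\<^esub> b) = a" using w(2,3) by algebra
  ultimately show "\<exists>u\<in>line \<one>\<^bsub>A\<^esub>. \<exists>v\<in>x_axis. w = u \<oplus>\<^bsub>plane\<^esub> v"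
    using w by (intro bexI[of _ "(b, b)"] bexI[of _ "(a \<ominus>\<^bsub>A\<^esub> b, \<zero>\<^bsub>A\<^esub>)"]) auto
qed

lemma line_mult:
  assumes x: "x \<in> carrier A" and z: "z \<in> carrier A"
  shows "line (x \<otimes>\<^bsub>A\<^esub> z) = plane.rel_gam (line x) x_axis (line \<one>\<^bsub>A\<^esub>) y_axis (line z)"
proof -
  show ?thesis
    unfolding line_def
  \<comment> \<open>On the axis (a, 0) the lift must satisfy \<delta> (\<theta> (a, 0)) = (0, a x),
    where \<delta> is right multiplication by 1 into the second coordinate; hence a is replaced by a
    x.\<close>
  proof (rule plane.graph_unital_product[OF axes_compl, where \<theta> = "\<lambda>(a, b). (a \<otimes>\<^bsub>A\<^esub> x, b)"])
    show "plane.compl (plane.graph x_axis (slope_hom \<one>\<^bsub>A\<^esub>)) x_axis"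
      using diagonal_compl unfolding line_def .
    show "plane.point_hom x_axis y_axis (slope_hom x)" "plane.point_hom x_axis y_axis (slope_hom \<one>\<^bsub>A\<^esub>)"
      "plane.point_hom x_axis y_axis (slope_hom z)" "plane.point_hom x_axis y_axis (slope_hom (x \<otimes>\<^bsub>A\<^esub> z))"
      using x z by (simp_all add: slope_hom_point_hom)
  qed (use x z in \<open>auto simp: x_axis_def m_assoc\<close>)
qed

theorem exists_geometry_algebra:
  "\<exists>(X :: ('a algebra_point, 'k) geometry) p e m f.
     associative_geometry K X \<and> transversal_triple X p e m \<and> algebra_iso K A (triple_algebra X p e m) f"
proof (intro exI conjI)
  note P = plane.complD(1,2)[OF axes_compl] plane.complD(1)[OF diagonal_compl]
  show "associative_geometry K plane.geom" by (rule plane.geom_associative_geometry)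
  show "transversal_triple plane.geom x_axis (line \<one>\<^bsub>A\<^esub>) y_axis"
    using P axes_compl diagonal_compl line_compl[OF one_closed]
    by (simp add: transversal_triple_def plane.transversal_iff plane.compl_sym)
  have lin: "linear_map K A (U_module plane.geom y_axis x_axis) line"
    unfolding line_def
  proof (rule plane.graph_linear_map[OF axes_compl slope_hom_point_hom module_axioms])
  qed (auto simp: x_axis_def r_distr smult_mult_right)
  then have "linear_map K A (triple_algebra plane.geom x_axis (line \<one>\<^bsub>A\<^esub>) y_axis) line"
    by (simp add: linear_map_def triple_algebra_def U_module_def linearization_def)
  moreover have "line \<in> ring_iso A (triple_algebra plane.geom x_axis (line \<one>\<^bsub>A\<^esub>) y_axis)"
    using lin bij_betw_line line_mult
    by (auto simp: ring_iso_def ring_hom_def linear_map_def triple_algebra_def U_module_def linearization_def)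
  ultimately show "algebra_iso K A (triple_algebra plane.geom x_axis (line \<one>\<^bsub>A\<^esub>) y_axis) line"
    by (simp add: algebra_iso_def)
qed

end

section \<open>Associative pairs\<close>

lemma linear_map_zero:
  assumes "module K M" "module K N" "linear_map K M N f"
  shows "f \<zero>\<^bsub>M\<^esub> = \<zero>\<^bsub>N\<^esub>"
proof -
  interpret M: module K M by fact
  interpret N: module K N by fact
  have "f (\<zero>\<^bsub>K\<^esub> \<odot>\<^bsub>M\<^esub> \<zero>\<^bsub>M\<^esub>) = \<zero>\<^bsub>K\<^esub> \<odot>\<^bsub>N\<^esub> f \<zero>\<^bsub>M\<^esub>" "f \<zero>\<^bsub>M\<^esub> \<in> carrier N"
    using assms(3) M.R.zero_closed M.M.zero_closed unfolding linear_map_def by blast+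
  then show ?thesis by simp
qed

text \<open>All functions on the type with values in the module, linear or not. This is just the
  ambient module in which the multipliers form a submodule.\<close>

definition fun_module :: "('k, 'a, 'm) module_scheme \<Rightarrow> ('k, 'c \<Rightarrow> 'a) module" where
  "fun_module M =
     \<lparr> carrier = {f. \<forall>v. f v \<in> carrier M}, monoid.mult = undefined, one = undefined,
       zero = (\<lambda>_. \<zero>\<^bsub>M\<^esub>), add = (\<lambda>f g v. f v \<oplus>\<^bsub>M\<^esub> g v), smult = (\<lambda>r f v. r \<odot>\<^bsub>M\<^esub> f v) \<rparr>"

lemma fun_module_simps [simp]:
  "carrier (fun_module M) = {f. \<forall>v. f v \<in> carrier M}"
  "\<zero>\<^bsub>fun_module M\<^esub> = (\<lambda>_. \<zero>\<^bsub>M\<^esub>)"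
  "f \<oplus>\<^bsub>fun_module M\<^esub> g = (\<lambda>v. f v \<oplus>\<^bsub>M\<^esub> g v)"
  "r \<odot>\<^bsub>fun_module M\<^esub> f = (\<lambda>v. r \<odot>\<^bsub>M\<^esub> f v)"
  by (simp_all add: fun_module_def)

lemma module_fun_module:
  assumes "module K M"
  shows "module K (fun_module M)"
proof -
  interpret M: module K M by fact
  show ?thesis
  proof (rule moduleI)
    show "cring K" by (rule M.R.is_cring)
    show "abelian_group (fun_module M)"
    proof (rule abelian_groupI)
      fix f assume "f \<in> carrier (fun_module M)"
      then show "\<exists>g\<in>carrier (fun_module M). g \<oplus>\<^bsub>fun_module M\<^esub> f = \<zero>\<^bsub>fun_module M\<^esub>"
        by (intro bexI[of _ "\<lambda>v. \<ominus>\<^bsub>M\<^esub> f v"]) (auto simp: M.M.l_neg)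
    qed (auto simp: M.M.a_ac)
  qed (auto simp: M.smult_l_distr M.smult_r_distr M.smult_assoc1)
qed

definition zero_ext_end :: "('k, 'r) ring_scheme \<Rightarrow> ('k, 'a, 'm) module_scheme \<Rightarrow> ('a \<Rightarrow> 'a) \<Rightarrow> bool" where
  "zero_ext_end K M f \<longleftrightarrow> linear_map K M M f \<and> (\<forall>v. v \<notin> carrier M \<longrightarrow> f v = \<zero>\<^bsub>M\<^esub>)"

text \<open>
  \<open>\<rho> = (f, g)\<close> stands for a ring element acting by \<open>f x = x \<rho>\<close> and \<open>g y = \<rho> y\<close>.  In matrix
  order \<open>tp x y z\<close> is the product \<open>x y z\<close>, but \<open>tm x y z\<close> is \<open>z y x\<close>.  Functions vanish
  outside the carriers, so that equality of multipliers is equality of functions.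
\<close>

definition multipliers ::
  "('k, 'r) ring_scheme \<Rightarrow> ('k, 'a, 'm) module_scheme \<Rightarrow> ('k, 'b, 'n) module_scheme \<Rightarrow>
   ('a \<Rightarrow> 'b \<Rightarrow> 'a \<Rightarrow> 'a) \<Rightarrow> ('b \<Rightarrow> 'a \<Rightarrow> 'b \<Rightarrow> 'b) \<Rightarrow> (('a \<Rightarrow> 'a) \<times> ('b \<Rightarrow> 'b)) set"
where
  "multipliers K A B tp tm = {\<rho>. zero_ext_end K A (fst \<rho>) \<and> zero_ext_end K B (snd \<rho>) \<and>
     (\<forall>v\<in>carrier A. \<forall>y\<in>carrier B. \<forall>x\<in>carrier A.
        fst \<rho> (tp v y x) = tp v y (fst \<rho> x) \<and> tp (fst \<rho> v) y x = tp v (snd \<rho> y) x) \<and>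
     (\<forall>w\<in>carrier B. \<forall>x\<in>carrier A. \<forall>y\<in>carrier B.
        snd \<rho> (tm w x y) = tm w x (snd \<rho> y) \<and> tm w (fst \<rho> x) y = tm (snd \<rho> w) x y)}"

definition right_mult ::
  "('k, 'a, 'm) module_scheme \<Rightarrow> ('k, 'b, 'n) module_scheme \<Rightarrow>
   ('a \<Rightarrow> 'b \<Rightarrow> 'a \<Rightarrow> 'a) \<Rightarrow> ('b \<Rightarrow> 'a \<Rightarrow> 'b \<Rightarrow> 'b) \<Rightarrow> 'b \<Rightarrow> 'a \<Rightarrow> ('a \<Rightarrow> 'a) \<times> ('b \<Rightarrow> 'b)"
where
  "right_mult A B tp tm y x =
     (\<lambda>v. if v \<in> carrier A then tp v y x else \<zero>\<^bsub>A\<^esub>, \<lambda>w. if w \<in> carrier B then tm w x y else \<zero>\<^bsub>B\<^esub>)"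

definition mult_one :: "('k, 'a, 'm) module_scheme \<Rightarrow> ('k, 'b, 'n) module_scheme \<Rightarrow> ('a \<Rightarrow> 'a) \<times> ('b \<Rightarrow> 'b)" where
  "mult_one A B = (\<lambda>v. if v \<in> carrier A then v else \<zero>\<^bsub>A\<^esub>, \<lambda>w. if w \<in> carrier B then w else \<zero>\<^bsub>B\<^esub>)"

definition mult_comp :: "('a \<Rightarrow> 'a) \<times> ('b \<Rightarrow> 'b) \<Rightarrow> ('a \<Rightarrow> 'a) \<times> ('b \<Rightarrow> 'b) \<Rightarrow> ('a \<Rightarrow> 'a) \<times> ('b \<Rightarrow> 'b)" where
  "mult_comp \<rho> \<rho>' = (fst \<rho>' \<circ> fst \<rho>, snd \<rho> \<circ> snd \<rho>')"

context associative_pair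
begin

lemma tp_linear:
  "y \<in> carrier B \<Longrightarrow> z \<in> carrier A \<Longrightarrow> linear_map K A A (\<lambda>x. tp x y z)"
  "x \<in> carrier A \<Longrightarrow> z \<in> carrier A \<Longrightarrow> linear_map K B A (\<lambda>y. tp x y z)"
  "x \<in> carrier A \<Longrightarrow> y \<in> carrier B \<Longrightarrow> linear_map K A A (\<lambda>z. tp x y z)"
  using tp_trilinear unfolding trilinear_map_def by auto

lemma tm_linear:
  "y \<in> carrier A \<Longrightarrow> z \<in> carrier B \<Longrightarrow> linear_map K B B (\<lambda>x. tm x y z)"
  "x \<in> carrier B \<Longrightarrow> z \<in> carrier B \<Longrightarrow> linear_map K A B (\<lambda>y. tm x y z)"
  "x \<in> carrier B \<Longrightarrow> y \<in> carrier A \<Longrightarrow> linear_map K B B (\<lambda>z. tm x y z)"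
  using tm_trilinear unfolding trilinear_map_def by auto

lemma tp_closed [simp]: "x \<in> carrier A \<Longrightarrow> y \<in> carrier B \<Longrightarrow> z \<in> carrier A \<Longrightarrow> tp x y z \<in> carrier A"
  using tp_linear(1)[of y z] unfolding linear_map_def by auto

lemma tm_closed [simp]: "x \<in> carrier B \<Longrightarrow> y \<in> carrier A \<Longrightarrow> z \<in> carrier B \<Longrightarrow> tm x y z \<in> carrier B"
  using tm_linear(1)[of y z] unfolding linear_map_def by auto

lemma tp_add:
  "x \<in> carrier A \<Longrightarrow> x' \<in> carrier A \<Longrightarrow> y \<in> carrier B \<Longrightarrow> z \<in> carrier A \<Longrightarrow> tp (x \<oplus>\<^bsub>A\<^esub> x') y z = tp x y z \<oplus>\<^bsub>A\<^esub> tp x' y z"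
  "x \<in> carrier A \<Longrightarrow> y \<in> carrier B \<Longrightarrow> y' \<in> carrier B \<Longrightarrow> z \<in> carrier A \<Longrightarrow> tp x (y \<oplus>\<^bsub>B\<^esub> y') z = tp x y z \<oplus>\<^bsub>A\<^esub> tp x y' z"
  "x \<in> carrier A \<Longrightarrow> y \<in> carrier B \<Longrightarrow> z \<in> carrier A \<Longrightarrow> z' \<in> carrier A \<Longrightarrow> tp x y (z \<oplus>\<^bsub>A\<^esub> z') = tp x y z \<oplus>\<^bsub>A\<^esub> tp x y z'"
  using tp_linear(1)[of y z] tp_linear(2)[of x z] tp_linear(3)[of x y] by (simp_all add: linear_map_def)

lemma tp_smult:
  "r \<in> carrier K \<Longrightarrow> x \<in> carrier A \<Longrightarrow> y \<in> carrier B \<Longrightarrow> z \<in> carrier A \<Longrightarrow> tp (r \<odot>\<^bsub>A\<^esub> x) y z = r \<odot>\<^bsub>A\<^esub> tp x y z"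
  "r \<in> carrier K \<Longrightarrow> x \<in> carrier A \<Longrightarrow> y \<in> carrier B \<Longrightarrow> z \<in> carrier A \<Longrightarrow> tp x (r \<odot>\<^bsub>B\<^esub> y) z = r \<odot>\<^bsub>A\<^esub> tp x y z"
  "r \<in> carrier K \<Longrightarrow> x \<in> carrier A \<Longrightarrow> y \<in> carrier B \<Longrightarrow> z \<in> carrier A \<Longrightarrow> tp x y (r \<odot>\<^bsub>A\<^esub> z) = r \<odot>\<^bsub>A\<^esub> tp x y z"
  using tp_linear(1)[of y z] tp_linear(2)[of x z] tp_linear(3)[of x y] by (simp_all add: linear_map_def)

lemma tm_add:
  "x \<in> carrier B \<Longrightarrow> x' \<in> carrier B \<Longrightarrow> y \<in> carrier A \<Longrightarrow> z \<in> carrier B \<Longrightarrow> tm (x \<oplus>\<^bsub>B\<^esub> x') y z = tm x y z \<oplus>\<^bsub>B\<^esub> tm x' y z"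
  "x \<in> carrier B \<Longrightarrow> y \<in> carrier A \<Longrightarrow> y' \<in> carrier A \<Longrightarrow> z \<in> carrier B \<Longrightarrow> tm x (y \<oplus>\<^bsub>A\<^esub> y') z = tm x y z \<oplus>\<^bsub>B\<^esub> tm x y' z"
  "x \<in> carrier B \<Longrightarrow> y \<in> carrier A \<Longrightarrow> z \<in> carrier B \<Longrightarrow> z' \<in> carrier B \<Longrightarrow> tm x y (z \<oplus>\<^bsub>B\<^esub> z') = tm x y z \<oplus>\<^bsub>B\<^esub> tm x y z'"
  using tm_linear(1)[of y z] tm_linear(2)[of x z] tm_linear(3)[of x y] by (simp_all add: linear_map_def)

lemma tm_smult:
  "r \<in> carrier K \<Longrightarrow> x \<in> carrier B \<Longrightarrow> y \<in> carrier A \<Longrightarrow> z \<in> carrier B \<Longrightarrow> tm (r \<odot>\<^bsub>B\<^esub> x) y z = r \<odot>\<^bsub>B\<^esub> tm x y z"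
  "r \<in> carrier K \<Longrightarrow> x \<in> carrier B \<Longrightarrow> y \<in> carrier A \<Longrightarrow> z \<in> carrier B \<Longrightarrow> tm x (r \<odot>\<^bsub>A\<^esub> y) z = r \<odot>\<^bsub>B\<^esub> tm x y z"
  "r \<in> carrier K \<Longrightarrow> x \<in> carrier B \<Longrightarrow> y \<in> carrier A \<Longrightarrow> z \<in> carrier B \<Longrightarrow> tm x y (r \<odot>\<^bsub>B\<^esub> z) = r \<odot>\<^bsub>B\<^esub> tm x y z"
  using tm_linear(1)[of y z] tm_linear(2)[of x z] tm_linear(3)[of x y] by (simp_all add: linear_map_def)

lemma tp_zero [simp]:
  "y \<in> carrier B \<Longrightarrow> z \<in> carrier A \<Longrightarrow> tp \<zero>\<^bsub>A\<^esub> y z = \<zero>\<^bsub>A\<^esub>"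
  "x \<in> carrier A \<Longrightarrow> z \<in> carrier A \<Longrightarrow> tp x \<zero>\<^bsub>B\<^esub> z = \<zero>\<^bsub>A\<^esub>"
  "x \<in> carrier A \<Longrightarrow> y \<in> carrier B \<Longrightarrow> tp x y \<zero>\<^bsub>A\<^esub> = \<zero>\<^bsub>A\<^esub>"
  using linear_map_zero[OF plus.module_axioms plus.module_axioms tp_linear(1)[of y z]]
    linear_map_zero[OF minus.module_axioms plus.module_axioms tp_linear(2)[of x z]]
    linear_map_zero[OF plus.module_axioms plus.module_axioms tp_linear(3)[of x y]] by auto

lemma tm_zero [simp]:
  "y \<in> carrier A \<Longrightarrow> z \<in> carrier B \<Longrightarrow> tm \<zero>\<^bsub>B\<^esub> y z = \<zero>\<^bsub>B\<^esub>"
  "x \<in> carrier B \<Longrightarrow> z \<in> carrier B \<Longrightarrow> tm x \<zero>\<^bsub>A\<^esub> z = \<zero>\<^bsub>B\<^esub>"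
  "x \<in> carrier B \<Longrightarrow> y \<in> carrier A \<Longrightarrow> tm x y \<zero>\<^bsub>B\<^esub> = \<zero>\<^bsub>B\<^esub>"
  using linear_map_zero[OF minus.module_axioms minus.module_axioms tm_linear(1)[of y z]]
    linear_map_zero[OF plus.module_axioms minus.module_axioms tm_linear(2)[of x z]]
    linear_map_zero[OF minus.module_axioms minus.module_axioms tm_linear(3)[of x y]] by auto

text \<open>Reversal turns left actions into right ones. Applied to the opposite pair, the theory of
  multipliers therefore also yields the second diagonal corner.\<close>

lemma opposite: "associative_pair K A B (\<lambda>x y z. tp z y x) (\<lambda>x y z. tm z y x)"
proof
  show "trilinear_map K A B A A (\<lambda>x y z. tp z y x)" "trilinear_map K B A B B (\<lambda>x y z. tm z y x)"
    unfolding trilinear_map_def using tp_linear tm_linear by auto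
qed (simp_all add: tp_assoc tm_assoc)

section \<open>Multipliers as entries of the diagonal corners\<close>

lemma multiplierD:
  assumes "\<rho> \<in> multipliers K A B tp tm"
  shows "linear_map K A A (fst \<rho>)" "linear_map K B B (snd \<rho>)"
    "v \<notin> carrier A \<Longrightarrow> fst \<rho> v = \<zero>\<^bsub>A\<^esub>" "w \<notin> carrier B \<Longrightarrow> snd \<rho> w = \<zero>\<^bsub>B\<^esub>"
    "v \<in> carrier A \<Longrightarrow> y \<in> carrier B \<Longrightarrow> x \<in> carrier A \<Longrightarrow> fst \<rho> (tp v y x) = tp v y (fst \<rho> x)"
    "v \<in> carrier A \<Longrightarrow> y \<in> carrier B \<Longrightarrow> x \<in> carrier A \<Longrightarrow> tp (fst \<rho> v) y x = tp v (snd \<rho> y) x"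
    "w \<in> carrier B \<Longrightarrow> x \<in> carrier A \<Longrightarrow> y \<in> carrier B \<Longrightarrow> snd \<rho> (tm w x y) = tm w x (snd \<rho> y)"
    "w \<in> carrier B \<Longrightarrow> x \<in> carrier A \<Longrightarrow> y \<in> carrier B \<Longrightarrow> tm w (fst \<rho> x) y = tm (snd \<rho> w) x y"
  using assms unfolding multipliers_def zero_ext_end_def by auto

lemma multiplier_closed [simp]:
  assumes "\<rho> \<in> multipliers K A B tp tm"
  shows "fst \<rho> v \<in> carrier A" "snd \<rho> w \<in> carrier B"
  using multiplierD(1,2)[OF assms] multiplierD(3)[OF assms, of v] multiplierD(4)[OF assms, of w]
  unfolding linear_map_def by auto

lemma multiplier_zero [simp]:
  assumes "\<rho> \<in> multipliers K A B tp tm"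
  shows "fst \<rho> \<zero>\<^bsub>A\<^esub> = \<zero>\<^bsub>A\<^esub>" "snd \<rho> \<zero>\<^bsub>B\<^esub> = \<zero>\<^bsub>B\<^esub>"
  using linear_map_zero[OF plus.module_axioms plus.module_axioms] multiplierD(1)[OF assms]
    linear_map_zero[OF minus.module_axioms minus.module_axioms] multiplierD(2)[OF assms] by auto

lemma multiplier_add:
  assumes "\<rho> \<in> multipliers K A B tp tm"
  shows "u \<in> carrier A \<Longrightarrow> v \<in> carrier A \<Longrightarrow> fst \<rho> (u \<oplus>\<^bsub>A\<^esub> v) = fst \<rho> u \<oplus>\<^bsub>A\<^esub> fst \<rho> v"
    "w \<in> carrier B \<Longrightarrow> z \<in> carrier B \<Longrightarrow> snd \<rho> (w \<oplus>\<^bsub>B\<^esub> z) = snd \<rho> w \<oplus>\<^bsub>B\<^esub> snd \<rho> z"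
  using multiplierD(1,2)[OF assms] unfolding linear_map_def by auto

lemma multiplier_smult:
  assumes "\<rho> \<in> multipliers K A B tp tm"
  shows "r \<in> carrier K \<Longrightarrow> v \<in> carrier A \<Longrightarrow> fst \<rho> (r \<odot>\<^bsub>A\<^esub> v) = r \<odot>\<^bsub>A\<^esub> fst \<rho> v"
    "r \<in> carrier K \<Longrightarrow> w \<in> carrier B \<Longrightarrow> snd \<rho> (r \<odot>\<^bsub>B\<^esub> w) = r \<odot>\<^bsub>B\<^esub> snd \<rho> w"
  using multiplierD(1,2)[OF assms] unfolding linear_map_def by auto

lemma multiplierI:
  assumes "\<And>v. fst \<rho> v \<in> carrier A" "\<And>w. snd \<rho> w \<in> carrier B"
    "\<And>u v. u \<in> carrier A \<Longrightarrow> v \<in> carrier A \<Longrightarrow> fst \<rho> (u \<oplus>\<^bsub>A\<^esub> v) = fst \<rho> u \<oplus>\<^bsub>A\<^esub> fst \<rho> v"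
    "\<And>w z. w \<in> carrier B \<Longrightarrow> z \<in> carrier B \<Longrightarrow> snd \<rho> (w \<oplus>\<^bsub>B\<^esub> z) = snd \<rho> w \<oplus>\<^bsub>B\<^esub> snd \<rho> z"
    "\<And>r v. r \<in> carrier K \<Longrightarrow> v \<in> carrier A \<Longrightarrow> fst \<rho> (r \<odot>\<^bsub>A\<^esub> v) = r \<odot>\<^bsub>A\<^esub> fst \<rho> v"
    "\<And>r w. r \<in> carrier K \<Longrightarrow> w \<in> carrier B \<Longrightarrow> snd \<rho> (r \<odot>\<^bsub>B\<^esub> w) = r \<odot>\<^bsub>B\<^esub> snd \<rho> w"
    "\<And>v. v \<notin> carrier A \<Longrightarrow> fst \<rho> v = \<zero>\<^bsub>A\<^esub>" "\<And>w. w \<notin> carrier B \<Longrightarrow> snd \<rho> w = \<zero>\<^bsub>B\<^esub>"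
    "\<And>v y x. v \<in> carrier A \<Longrightarrow> y \<in> carrier B \<Longrightarrow> x \<in> carrier A \<Longrightarrow> fst \<rho> (tp v y x) = tp v y (fst \<rho> x)"
    "\<And>v y x. v \<in> carrier A \<Longrightarrow> y \<in> carrier B \<Longrightarrow> x \<in> carrier A \<Longrightarrow> tp (fst \<rho> v) y x = tp v (snd \<rho> y) x"
    "\<And>w x y. w \<in> carrier B \<Longrightarrow> x \<in> carrier A \<Longrightarrow> y \<in> carrier B \<Longrightarrow> snd \<rho> (tm w x y) = tm w x (snd \<rho> y)"
    "\<And>w x y. w \<in> carrier B \<Longrightarrow> x \<in> carrier A \<Longrightarrow> y \<in> carrier B \<Longrightarrow> tm w (fst \<rho> x) y = tm (snd \<rho> w) x y"
  shows "\<rho> \<in> multipliers K A B tp tm"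
  using assms unfolding multipliers_def zero_ext_end_def linear_map_def by simp

definition end_module :: "('k, ('a \<Rightarrow> 'a) \<times> ('b \<Rightarrow> 'b)) module" where
  "end_module = prod_module (fun_module A) (fun_module B)"

definition right_module :: "('k, ('a \<Rightarrow> 'a) \<times> ('b \<Rightarrow> 'b)) module" where
  "right_module = end_module\<lparr>carrier := multipliers K A B tp tm\<rparr>"

lemma end_module_simps [simp]:
  "\<zero>\<^bsub>end_module\<^esub> = (\<lambda>_. \<zero>\<^bsub>A\<^esub>, \<lambda>_. \<zero>\<^bsub>B\<^esub>)"
  "\<rho> \<oplus>\<^bsub>end_module\<^esub> \<sigma> = (\<lambda>v. fst \<rho> v \<oplus>\<^bsub>A\<^esub> fst \<sigma> v, \<lambda>w. snd \<rho> w \<oplus>\<^bsub>B\<^esub> snd \<sigma> w)"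
  "r \<odot>\<^bsub>end_module\<^esub> \<rho> = (\<lambda>v. r \<odot>\<^bsub>A\<^esub> fst \<rho> v, \<lambda>w. r \<odot>\<^bsub>B\<^esub> snd \<rho> w)"
  by (cases \<rho>; cases \<sigma>; simp add: end_module_def)+

lemma right_module_simps:
  "carrier right_module = multipliers K A B tp tm"
  "\<zero>\<^bsub>right_module\<^esub> = (\<lambda>_. \<zero>\<^bsub>A\<^esub>, \<lambda>_. \<zero>\<^bsub>B\<^esub>)"
  "\<rho> \<oplus>\<^bsub>right_module\<^esub> \<sigma> = (\<lambda>v. fst \<rho> v \<oplus>\<^bsub>A\<^esub> fst \<sigma> v, \<lambda>w. snd \<rho> w \<oplus>\<^bsub>B\<^esub> snd \<sigma> w)"
  "r \<odot>\<^bsub>right_module\<^esub> \<rho> = (\<lambda>v. r \<odot>\<^bsub>A\<^esub> fst \<rho> v, \<lambda>w. r \<odot>\<^bsub>B\<^esub> snd \<rho> w)"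
  using end_module_simps by (simp_all add: right_module_def)

text \<open>The empty set of operators is only used to get closure under negation from \<open>pointsI\<close>.\<close>

lemma module_right_module: "module K right_module"
proof -
  have E: "module K end_module"
    unfolding end_module_def
    by (intro module_prod_module module_fun_module plus.module_axioms minus.module_axioms)
  interpret E: operator_module K end_module "{}"
    by (rule operator_module.intro[OF E]) (simp add: operator_module_axioms_def)
  have "multipliers K A B tp tm \<in> E.points"
  proof (rule E.pointsI)
    show "multipliers K A B tp tm \<subseteq> carrier end_module"
      unfolding end_module_def using multiplier_closed by (intro subsetI) (simp add: mem_Times_iff)
  next
    fix \<rho> \<sigma> assume "\<rho> \<in> multipliers K A B tp tm" "\<sigma> \<in> multipliers K A B tp tm"
    then show "\<rho> \<oplus>\<^bsub>end_module\<^esub> \<sigma> \<in> multipliers K A B tp tm"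
      by (intro multiplierI) (simp_all add: multiplier_add multiplier_smult multiplierD tp_add tm_add
        plus.smult_r_distr minus.smult_r_distr plus.M.a_ac minus.M.a_ac)
  next
    fix r \<rho> assume "r \<in> carrier K" "\<rho> \<in> multipliers K A B tp tm"
    then show "r \<odot>\<^bsub>end_module\<^esub> \<rho> \<in> multipliers K A B tp tm"
      by (intro multiplierI) (simp_all add: multiplier_add multiplier_smult multiplierD tp_smult tm_smult
        plus.smult_r_distr minus.smult_r_distr plus.R.m_comm flip: plus.smult_assoc1 minus.smult_assoc1)
  qed (auto intro!: multiplierI)
  then show ?thesis
    unfolding right_module_def by (intro submodule.submodule_is_module E) (simp add: E.points_def)
qed

text \<open>The product yx belongs to the first corner: for the couple of maps that represents it,
  the conditions on a multiplier are instances of the associative laws of the pair.\<close>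

lemma right_mult_closed:
  assumes "y \<in> carrier B" "x \<in> carrier A"
  shows "right_mult A B tp tm y x \<in> multipliers K A B tp tm"
  using assms
  by (intro multiplierI) (simp_all add: right_mult_def tp_add tm_add tp_smult tm_smult tp_assoc tm_assoc)

lemma mult_one_closed: "mult_one A B \<in> multipliers K A B tp tm"
  by (intro multiplierI) (simp_all add: mult_one_def)

lemma mult_comp_closed:
  assumes "\<rho> \<in> multipliers K A B tp tm" "\<sigma> \<in> multipliers K A B tp tm"
  shows "mult_comp \<rho> \<sigma> \<in> multipliers K A B tp tm"
  using assms
  by (intro multiplierI) (simp_all add: mult_comp_def multiplier_add multiplier_smult multiplierD)

lemma mult_comp_one:
  assumes "\<rho> \<in> multipliers K A B tp tm"
  shows "mult_comp \<rho> (mult_one A B) = \<rho>" "mult_comp (mult_one A B) \<rho> = \<rho>"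
  using multiplierD(3,4)[OF assms] assms
  by (auto simp: mult_comp_def mult_one_def prod_eq_iff fun_eq_iff)

lemma mult_comp_add:
  assumes "\<rho> \<in> multipliers K A B tp tm" "\<sigma> \<in> multipliers K A B tp tm" "\<tau> \<in> multipliers K A B tp tm"
  shows "mult_comp (\<rho> \<oplus>\<^bsub>right_module\<^esub> \<sigma>) \<tau> = mult_comp \<rho> \<tau> \<oplus>\<^bsub>right_module\<^esub> mult_comp \<sigma> \<tau>"
    "mult_comp \<tau> (\<rho> \<oplus>\<^bsub>right_module\<^esub> \<sigma>) = mult_comp \<tau> \<rho> \<oplus>\<^bsub>right_module\<^esub> mult_comp \<tau> \<sigma>"
  using assms by (auto simp: mult_comp_def right_module_simps multiplier_add)

lemma mult_comp_smult:
  assumes "r \<in> carrier K" "\<rho> \<in> multipliers K A B tp tm" "\<tau> \<in> multipliers K A B tp tm"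
  shows "mult_comp (r \<odot>\<^bsub>right_module\<^esub> \<rho>) \<tau> = r \<odot>\<^bsub>right_module\<^esub> mult_comp \<rho> \<tau>"
    "mult_comp \<tau> (r \<odot>\<^bsub>right_module\<^esub> \<rho>) = r \<odot>\<^bsub>right_module\<^esub> mult_comp \<tau> \<rho>"
  using assms by (auto simp: mult_comp_def right_module_simps multiplier_smult)

lemma mult_comp_zero:
  assumes "\<tau> \<in> multipliers K A B tp tm"
  shows "mult_comp \<zero>\<^bsub>right_module\<^esub> \<tau> = \<zero>\<^bsub>right_module\<^esub>"
    "mult_comp \<tau> \<zero>\<^bsub>right_module\<^esub> = \<zero>\<^bsub>right_module\<^esub>"
  using assms by (auto simp: mult_comp_def right_module_simps)

lemma right_mult_add:
  "x \<in> carrier A \<Longrightarrow> y \<in> carrier B \<Longrightarrow> y' \<in> carrier B \<Longrightarrow>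
     right_mult A B tp tm (y \<oplus>\<^bsub>B\<^esub> y') x = right_mult A B tp tm y x \<oplus>\<^bsub>right_module\<^esub> right_mult A B tp tm y' x"
  "x \<in> carrier A \<Longrightarrow> x' \<in> carrier A \<Longrightarrow> y \<in> carrier B \<Longrightarrow>
     right_mult A B tp tm y (x \<oplus>\<^bsub>A\<^esub> x') = right_mult A B tp tm y x \<oplus>\<^bsub>right_module\<^esub> right_mult A B tp tm y x'"
  by (auto simp: right_mult_def right_module_simps tp_add tm_add)

lemma right_mult_smult:
  assumes "r \<in> carrier K" "x \<in> carrier A" "y \<in> carrier B"
  shows "right_mult A B tp tm (r \<odot>\<^bsub>B\<^esub> y) x = r \<odot>\<^bsub>right_module\<^esub> right_mult A B tp tm y x"
    "right_mult A B tp tm y (r \<odot>\<^bsub>A\<^esub> x) = r \<odot>\<^bsub>right_module\<^esub> right_mult A B tp tm y x"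
  using assms by (auto simp: right_mult_def right_module_simps tp_smult tm_smult)

lemma right_mult_zero:
  "x \<in> carrier A \<Longrightarrow> right_mult A B tp tm \<zero>\<^bsub>B\<^esub> x = \<zero>\<^bsub>right_module\<^esub>"
  "y \<in> carrier B \<Longrightarrow> right_mult A B tp tm y \<zero>\<^bsub>A\<^esub> = \<zero>\<^bsub>right_module\<^esub>"
  by (auto simp: right_mult_def right_module_simps)

text \<open>In matrix order these are (yx)\<rho> = y(x\<rho>) and \<rho>(yx) = (\<rho>y)x.\<close>

lemma right_mult_assoc:
  assumes "\<rho> \<in> multipliers K A B tp tm" "x \<in> carrier A" "y \<in> carrier B"
  shows "mult_comp (right_mult A B tp tm y x) \<rho> = right_mult A B tp tm y (fst \<rho> x)"
    "mult_comp \<rho> (right_mult A B tp tm y x) = right_mult A B tp tm (snd \<rho> y) x"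
  using assms multiplierD(3,4)[OF assms(1)]
  by (auto simp: mult_comp_def right_mult_def fun_eq_iff multiplierD)

text \<open>In matrix order (y\<sigma>)x = y(\<sigma>x), with \<sigma> from the second
  corner.\<close>

lemma right_mult_opposite_assoc:
  assumes "\<rho> \<in> multipliers K A B (\<lambda>x y z. tp z y x) (\<lambda>x y z. tm z y x)" "x \<in> carrier A" "y \<in> carrier B"
  shows "right_mult A B tp tm (snd \<rho> y) x = right_mult A B tp tm y (fst \<rho> x)"
  using assms associative_pair.multiplierD[OF opposite assms(1)] associative_pair.multiplier_closed[OF opposite assms(1)]
  by (auto simp: right_mult_def)

text \<open>In matrix order (zyx)v = z(yxv), since \<open>tm x y z\<close> stands for zyx.\<close>

lemma right_mult_tm:
  assumes "x \<in> carrier B" "y \<in> carrier A" "z \<in> carrier B" "v \<in> carrier A"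
  shows "right_mult A B tp tm (tm x y z) v = right_mult A B tp tm z (tp y x v)"
  using assms by (auto simp: right_mult_def tp_assoc tm_assoc)

lemma right_module_rules:
  "\<zero>\<^bsub>right_module\<^esub> \<in> multipliers K A B tp tm" "r \<in> carrier K \<Longrightarrow> r \<odot>\<^bsub>right_module\<^esub> \<zero>\<^bsub>right_module\<^esub> = \<zero>\<^bsub>right_module\<^esub>"
  "\<rho> \<in> multipliers K A B tp tm \<Longrightarrow> \<sigma> \<in> multipliers K A B tp tm \<Longrightarrow> \<rho> \<oplus>\<^bsub>right_module\<^esub> \<sigma> \<in> multipliers K A B tp tm" "r \<in> carrier K \<Longrightarrow> \<rho> \<in> multipliers K A B tp tm \<Longrightarrow> r \<odot>\<^bsub>right_module\<^esub> \<rho> \<in> multipliers K A B tp tm"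
  "\<rho> \<in> multipliers K A B tp tm \<Longrightarrow> \<zero>\<^bsub>right_module\<^esub> \<oplus>\<^bsub>right_module\<^esub> \<rho> = \<rho>" "\<rho> \<in> multipliers K A B tp tm \<Longrightarrow> \<rho> \<oplus>\<^bsub>right_module\<^esub> \<zero>\<^bsub>right_module\<^esub> = \<rho>"
  "fst \<zero>\<^bsub>right_module\<^esub> = (\<lambda>_. \<zero>\<^bsub>A\<^esub>)" "snd \<zero>\<^bsub>right_module\<^esub> = (\<lambda>_. \<zero>\<^bsub>B\<^esub>)"
  "fst (\<rho> \<oplus>\<^bsub>right_module\<^esub> \<sigma>) v = fst \<rho> v \<oplus>\<^bsub>A\<^esub> fst \<sigma> v" "snd (\<rho> \<oplus>\<^bsub>right_module\<^esub> \<sigma>) w = snd \<rho> w \<oplus>\<^bsub>B\<^esub> snd \<sigma> w"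
  "fst (r \<odot>\<^bsub>right_module\<^esub> \<rho>) v = r \<odot>\<^bsub>A\<^esub> fst \<rho> v" "snd (r \<odot>\<^bsub>right_module\<^esub> \<rho>) w = r \<odot>\<^bsub>B\<^esub> snd \<rho> w"
proof -
  interpret M: module K right_module by (rule module_right_module)
  note c = right_module_simps(1)
  show "\<zero>\<^bsub>right_module\<^esub> \<in> multipliers K A B tp tm" "r \<in> carrier K \<Longrightarrow> r \<odot>\<^bsub>right_module\<^esub> \<zero>\<^bsub>right_module\<^esub> = \<zero>\<^bsub>right_module\<^esub>"
    "\<rho> \<in> multipliers K A B tp tm \<Longrightarrow> \<sigma> \<in> multipliers K A B tp tm \<Longrightarrow> \<rho> \<oplus>\<^bsub>right_module\<^esub> \<sigma> \<in> multipliers K A B tp tm" "r \<in> carrier K \<Longrightarrow> \<rho> \<in> multipliers K A B tp tm \<Longrightarrow> r \<odot>\<^bsub>right_module\<^esub> \<rho> \<in> multipliers K A B tp tm"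
    "\<rho> \<in> multipliers K A B tp tm \<Longrightarrow> \<zero>\<^bsub>right_module\<^esub> \<oplus>\<^bsub>right_module\<^esub> \<rho> = \<rho>" "\<rho> \<in> multipliers K A B tp tm \<Longrightarrow> \<rho> \<oplus>\<^bsub>right_module\<^esub> \<zero>\<^bsub>right_module\<^esub> = \<rho>"
    using M.M.zero_closed M.M.a_closed M.smult_closed M.M.l_zero M.M.r_zero M.smult_r_null
    unfolding c by blast+
qed (simp_all add: right_module_simps)

section \<open>The standard imbedding and its right multiplications\<close>

interpretation opp: associative_pair K A B "\<lambda>x y z. tp z y x" "\<lambda>x y z. tm z y x"
  by (rule opposite)

abbreviation RM where "RM \<equiv> right_module"
abbreviation LM where "LM \<equiv> opp.right_module"
abbreviation RS where "RS \<equiv> multipliers K A B tp tm"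
abbreviation LS where "LS \<equiv> multipliers K A B (\<lambda>x y z. tp z y x) (\<lambda>x y z. tm z y x)"
abbreviation rm where "rm \<equiv> right_mult A B tp tm"
text \<open>The arguments are exchanged so that \<open>lm x y\<close> reads as the matrix product
  xy.\<close>

abbreviation lm where "lm x y \<equiv> right_mult A B (\<lambda>x y z. tp z y x) (\<lambda>x y z. tm z y x) y x"

lemmas mult_rules [simp] = right_module_rules opp.right_module_rules
  right_module_simps(1) opp.right_module_simps(1)
  right_mult_closed opp.right_mult_closed mult_one_closed opp.mult_one_closed
  mult_comp_closed opp.mult_comp_closed mult_comp_one opp.mult_comp_one
  mult_comp_add opp.mult_comp_add mult_comp_smult opp.mult_comp_smult mult_comp_zero opp.mult_comp_zero
  right_mult_add opp.right_mult_add right_mult_smult opp.right_mult_smult right_mult_zero opp.right_mult_zero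
  multiplier_add opp.multiplier_add multiplier_smult opp.multiplier_smult

lemma right_mult_apply [simp]:
  "v \<in> carrier A \<Longrightarrow> fst (rm y x) v = tp v y x" "w \<in> carrier B \<Longrightarrow> snd (rm y x) w = tm w x y"
  "v \<in> carrier A \<Longrightarrow> fst (lm x y) v = tp x y v" "w \<in> carrier B \<Longrightarrow> snd (lm x y) w = tm y x w"
  by (simp_all add: right_mult_def)

lemma mult_comp_apply [simp]:
  "fst (mult_comp \<rho> \<sigma>) v = fst \<sigma> (fst \<rho> v)" "snd (mult_comp \<rho> \<sigma>) w = snd \<rho> (snd \<sigma> w)"
  by (simp_all add: mult_comp_def)

text \<open>
  \<open>(\<rho>, x, y, \<sigma>)\<close> encodes the matrix with rows \<open>(\<rho>, y)\<close> and \<open>(x, \<sigma>)\<close>; the operators are the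
  right multiplications by matrices with a single nonzero entry.  Multipliers \<open>\<sigma>\<close> of the opposite
  pair act by \<open>fst \<sigma> x = \<sigma> x\<close> and \<open>snd \<sigma> y = y \<sigma>\<close>, so \<open>mult_comp\<close> is
  reversed on them.
\<close>

definition imbedding ::
  "('k, (('a \<Rightarrow> 'a) \<times> ('b \<Rightarrow> 'b)) \<times> 'a \<times> 'b \<times> (('a \<Rightarrow> 'a) \<times> ('b \<Rightarrow> 'b))) module" where
  "imbedding = prod_module RM (prod_module A (prod_module B LM))"

lemma imbedding_simps [simp]:
  "carrier imbedding = RS \<times> carrier A \<times> carrier B \<times> LS"
  "\<zero>\<^bsub>imbedding\<^esub> = (\<zero>\<^bsub>RM\<^esub>, \<zero>\<^bsub>A\<^esub>, \<zero>\<^bsub>B\<^esub>, \<zero>\<^bsub>LM\<^esub>)"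
  "(\<rho>, x, y, \<sigma>) \<oplus>\<^bsub>imbedding\<^esub> (\<rho>', x', y', \<sigma>') =
     (\<rho> \<oplus>\<^bsub>RM\<^esub> \<rho>', x \<oplus>\<^bsub>A\<^esub> x', y \<oplus>\<^bsub>B\<^esub> y', \<sigma> \<oplus>\<^bsub>LM\<^esub> \<sigma>')"
  "r \<odot>\<^bsub>imbedding\<^esub> (\<rho>, x, y, \<sigma>) = (r \<odot>\<^bsub>RM\<^esub> \<rho>, r \<odot>\<^bsub>A\<^esub> x, r \<odot>\<^bsub>B\<^esub> y, r \<odot>\<^bsub>LM\<^esub> \<sigma>)"
  by (simp_all add: imbedding_def)

text \<open>Listed by the position of the nonzero entry of the right factor: (1,1), (1,2), (2,1),
  (2,2). Right multiplication by an arbitrary matrix is a sum of four such operators, so they have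
  the same invariant submodules as the full ring would have, while equivariance is checked entry by
  entry.\<close>

definition op_R where "op_R \<tau> = (\<lambda>(\<rho>, x, y, \<sigma>). (mult_comp \<rho> \<tau>, fst \<tau> x, \<zero>\<^bsub>B\<^esub>, \<zero>\<^bsub>LM\<^esub>))"
definition op_B where "op_B b = (\<lambda>(\<rho>, x, y, \<sigma>). (\<zero>\<^bsub>RM\<^esub>, \<zero>\<^bsub>A\<^esub>, snd \<rho> b, lm x b))"
definition op_A where "op_A a = (\<lambda>(\<rho>, x, y, \<sigma>). (rm y a, fst \<sigma> a, \<zero>\<^bsub>B\<^esub>, \<zero>\<^bsub>LM\<^esub>))"
definition op_L where "op_L \<tau> = (\<lambda>(\<rho>, x, y, \<sigma>). (\<zero>\<^bsub>RM\<^esub>, \<zero>\<^bsub>A\<^esub>, snd \<tau> y, mult_comp \<tau> \<sigma>))"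

lemma op_simps [simp]:
  "op_R \<tau> (\<rho>, x, y, \<sigma>) = (mult_comp \<rho> \<tau>, fst \<tau> x, \<zero>\<^bsub>B\<^esub>, \<zero>\<^bsub>LM\<^esub>)"
  "op_B b (\<rho>, x, y, \<sigma>) = (\<zero>\<^bsub>RM\<^esub>, \<zero>\<^bsub>A\<^esub>, snd \<rho> b, lm x b)"
  "op_A a (\<rho>, x, y, \<sigma>) = (rm y a, fst \<sigma> a, \<zero>\<^bsub>B\<^esub>, \<zero>\<^bsub>LM\<^esub>)"
  "op_L \<tau> (\<rho>, x, y, \<sigma>) = (\<zero>\<^bsub>RM\<^esub>, \<zero>\<^bsub>A\<^esub>, snd \<tau> y, mult_comp \<tau> \<sigma>)"
  by (simp_all add: op_R_def op_B_def op_A_def op_L_def)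

definition operators where
  "operators = op_R ` RS \<union> op_B ` carrier B \<union> op_A ` carrier A \<union> op_L ` LS"

lemma operators_iff: "T \<in> operators \<longleftrightarrow> (\<exists>\<tau>\<in>RS. T = op_R \<tau>) \<or> (\<exists>b\<in>carrier B. T = op_B b) \<or>
   (\<exists>a\<in>carrier A. T = op_A a) \<or> (\<exists>\<tau>\<in>LS. T = op_L \<tau>)"
  by (auto simp: operators_def)

lemma operatorsE:
  assumes "T \<in> operators"
  obtains (R) \<tau> where "\<tau> \<in> RS" "T = op_R \<tau>" | (B) b where "b \<in> carrier B" "T = op_B b"
    | (A) a where "a \<in> carrier A" "T = op_A a" | (L) \<tau> where "\<tau> \<in> LS" "T = op_L \<tau>"
  using assms unfolding operators_iff by blast

lemma imbedding_ballI:
  assumes "\<And>\<rho> x y \<sigma>. \<rho> \<in> RS \<Longrightarrow> x \<in> carrier A \<Longrightarrow> y \<in> carrier B \<Longrightarrow> \<sigma> \<in> LS \<Longrightarrow> P (\<rho>, x, y, \<sigma>)"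
  shows "\<forall>u\<in>carrier imbedding. P u"
  using assms unfolding imbedding_simps by blast

lemma operator_linear:
  assumes "T \<in> operators"
  shows "linear_map K imbedding imbedding T"
  unfolding linear_map_def Pi_iff
  using assms by (cases rule: operatorsE) (intro conjI imbedding_ballI ballI; simp)+

lemma operator_module_imbedding: "operator_module K imbedding operators"
proof -
  interpret W: module K imbedding
    unfolding imbedding_def
    by (intro module_prod_module module_right_module opp.module_right_module plus.module_axioms minus.module_axioms)
  show ?thesis
  proof
  qed (rule operator_linear)
qed

interpretation emb: operator_module K imbedding operators
  by (rule operator_module_imbedding)

text \<open>The two rows of the matrices. The first is generated by the idempotent with
  \<open>mult_one A B\<close> in position (1,1), the second by the one with
  \<open>mult_one A B\<close> in position (2,2).\<close>

definition o_plus where "o_plus = RS \<times> {\<zero>\<^bsub>A\<^esub>} \<times> carrier B \<times> {\<zero>\<^bsub>LM\<^esub>}"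
definition o_minus where "o_minus = {\<zero>\<^bsub>RM\<^esub>} \<times> carrier A \<times> {\<zero>\<^bsub>B\<^esub>} \<times> LS"

lemma o_plus_iff [simp]:
  "(\<rho>, x, y, \<sigma>) \<in> o_plus \<longleftrightarrow> \<rho> \<in> RS \<and> x = \<zero>\<^bsub>A\<^esub> \<and> y \<in> carrier B \<and> \<sigma> = \<zero>\<^bsub>LM\<^esub>"
  by (simp add: o_plus_def)

lemma o_minus_iff [simp]:
  "(\<rho>, x, y, \<sigma>) \<in> o_minus \<longleftrightarrow> \<rho> = \<zero>\<^bsub>RM\<^esub> \<and> x \<in> carrier A \<and> y = \<zero>\<^bsub>B\<^esub> \<and> \<sigma> \<in> LS"
  by (simp add: o_minus_def)

lemma o_plusE:
  assumes "u \<in> o_plus"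
  obtains \<rho> y where "\<rho> \<in> RS" "y \<in> carrier B" "u = (\<rho>, \<zero>\<^bsub>A\<^esub>, y, \<zero>\<^bsub>LM\<^esub>)"
  using assms unfolding o_plus_def by blast

lemma o_minusE:
  assumes "u \<in> o_minus"
  obtains x \<sigma> where "x \<in> carrier A" "\<sigma> \<in> LS" "u = (\<zero>\<^bsub>RM\<^esub>, x, \<zero>\<^bsub>B\<^esub>, \<sigma>)"
  using assms unfolding o_minus_def by blast

lemma imbeddingE:
  assumes "u \<in> carrier imbedding"
  obtains \<rho> x y \<sigma> where "\<rho> \<in> RS" "x \<in> carrier A" "y \<in> carrier B" "\<sigma> \<in> LS" "u = (\<rho>, x, y, \<sigma>)"
  using assms unfolding imbedding_simps by blast

lemma o_plus_point: "o_plus \<in> emb.points"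
proof (rule emb.pointsI)
  show "o_plus \<subseteq> carrier imbedding" by (auto simp: o_plus_def)
  show "T u \<in> o_plus" if "T \<in> operators" "u \<in> o_plus" for T u
    using that by (elim operatorsE o_plusE; simp)
qed (simp, (elim o_plusE; simp)+)

lemma o_minus_point: "o_minus \<in> emb.points"
proof (rule emb.pointsI)
  show "o_minus \<subseteq> carrier imbedding" by (auto simp: o_minus_def)
  show "T u \<in> o_minus" if "T \<in> operators" "u \<in> o_minus" for T u
    using that by (elim operatorsE o_minusE; simp)
qed (simp, (elim o_minusE; simp)+)

lemma base_compl: "emb.compl o_plus o_minus"
proof (rule emb.complI[OF o_plus_point o_minus_point])
  show "u = \<zero>\<^bsub>imbedding\<^esub>" if "u \<in> o_plus" "u \<in> o_minus" for u
    using that by (elim o_plusE o_minusE) simp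
  fix w assume "w \<in> carrier imbedding"
  then obtain \<rho> x y \<sigma> where w: "\<rho> \<in> RS" "x \<in> carrier A" "y \<in> carrier B" "\<sigma> \<in> LS" "w = (\<rho>, x, y, \<sigma>)"
    by (rule imbeddingE)
  show "\<exists>u\<in>o_plus. \<exists>v\<in>o_minus. w = u \<oplus>\<^bsub>imbedding\<^esub> v"
    by (rule bexI[of _ "(\<rho>, \<zero>\<^bsub>A\<^esub>, y, \<zero>\<^bsub>LM\<^esub>)"], rule bexI[of _ "(\<zero>\<^bsub>RM\<^esub>, x, \<zero>\<^bsub>B\<^esub>, \<sigma>)"])
      (use w in simp_all)
qed

text \<open>Left multiplication by the matrix with single entry a in position (2,1), which sends the
  first row to the second; \<open>minus_hom\<close> is left multiplication by b in position
  (1,2).\<close>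

definition plus_hom where "plus_hom a = (\<lambda>(\<rho>, x, y, \<sigma>). (\<zero>\<^bsub>RM\<^esub>, fst \<rho> a, \<zero>\<^bsub>B\<^esub>, lm a y))"
definition minus_hom where "minus_hom b = (\<lambda>(\<rho>, x, y, \<sigma>). (rm b x, \<zero>\<^bsub>A\<^esub>, snd \<sigma> b, \<zero>\<^bsub>LM\<^esub>))"

lemma hom_simps [simp]:
  "plus_hom a (\<rho>, x, y, \<sigma>) = (\<zero>\<^bsub>RM\<^esub>, fst \<rho> a, \<zero>\<^bsub>B\<^esub>, lm a y)"
  "minus_hom b (\<rho>, x, y, \<sigma>) = (rm b x, \<zero>\<^bsub>A\<^esub>, snd \<sigma> b, \<zero>\<^bsub>LM\<^esub>)"
  by (simp_all add: plus_hom_def minus_hom_def)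

text \<open>A left multiplication commutes with the right ones by associativity of the matrix
  product, one instance for each kind of operator. For \<open>op_B\<close> this is a(\<rho>b) =
  (a\<rho>)b, the condition that links the two halves of a multiplier.\<close>

lemma plus_hom_point_hom:
  assumes a: "a \<in> carrier A"
  shows "emb.point_hom o_plus o_minus (plus_hom a)"
  unfolding emb.point_hom_def
proof (intro conjI ballI Pi_I)
  fix T s assume T: "T \<in> operators" and s: "s \<in> o_plus"
  from T s show "plus_hom a (T s) = T (plus_hom a s)"
    by (elim operatorsE o_plusE)
      (use a in \<open>simp_all add: opp.right_mult_opposite_assoc opp.right_mult_assoc opp.multiplierD\<close>)
qed (use a in \<open>(elim o_plusE; simp)+\<close>)

lemma minus_hom_point_hom:
  assumes b: "b \<in> carrier B"
  shows "emb.point_hom o_minus o_plus (minus_hom b)"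
  unfolding emb.point_hom_def
proof (intro conjI ballI Pi_I)
  fix T s assume T: "T \<in> operators" and s: "s \<in> o_minus"
  from T s show "minus_hom b (T s) = T (minus_hom b s)"
    by (elim operatorsE o_minusE)
      (use b in \<open>simp_all add: right_mult_opposite_assoc right_mult_assoc multiplierD\<close>)
qed (use b in \<open>(elim o_minusE; simp)+\<close>)

definition plus_point where "plus_point a = emb.graph o_plus (plus_hom a)"
definition minus_point where "minus_point b = emb.graph o_minus (minus_hom b)"

lemma bij_betw_plus_point: "bij_betw plus_point (carrier A) (U emb.geom o_minus)"
proof -
  have "x = y" if xy: "x \<in> carrier A" "y \<in> carrier A" "plus_point x = plus_point y" for x y
  proof -
    have "plus_hom x (mult_one A B, \<zero>\<^bsub>A\<^esub>, \<zero>\<^bsub>B\<^esub>, \<zero>\<^bsub>LM\<^esub>) = plus_hom y (mult_one A B, \<zero>\<^bsub>A\<^esub>, \<zero>\<^bsub>B\<^esub>, \<zero>\<^bsub>LM\<^esub>)"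
      by (rule emb.graph_inject[OF base_compl])
        (use xy in \<open>simp_all add: plus_hom_point_hom plus_point_def del: hom_simps\<close>)
    then show ?thesis using xy by (simp add: mult_one_def)
  qed
  moreover have "S \<in> plus_point ` carrier A" if S: "emb.compl S o_minus" for S
  proof -
    note S_point = emb.complD(1)[OF S]
    have "(mult_one A B, \<zero>\<^bsub>A\<^esub>, \<zero>\<^bsub>B\<^esub>, \<zero>\<^bsub>LM\<^esub>) \<in> carrier imbedding" by simp
    then obtain u v where uv: "(mult_one A B, \<zero>\<^bsub>A\<^esub>, \<zero>\<^bsub>B\<^esub>, \<zero>\<^bsub>LM\<^esub>) = u \<oplus>\<^bsub>imbedding\<^esub> v" "u \<in> S" "v \<in> o_minus"
      by (rule emb.compl_decomp[OF S])
    obtain \<rho> x y \<sigma> where u: "\<rho> \<in> RS" "x \<in> carrier A" "y \<in> carrier B" "\<sigma> \<in> LS" "u = (\<rho>, x, y, \<sigma>)"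
      using emb.points_carrier[OF S_point uv(2)] by (rule imbeddingE)
    obtain x' \<sigma>' where v: "x' \<in> carrier A" "\<sigma>' \<in> LS" "v = (\<zero>\<^bsub>RM\<^esub>, x', \<zero>\<^bsub>B\<^esub>, \<sigma>')"
      using uv(3) by (rule o_minusE)
    \<comment> \<open>The complement \<open>o_minus\<close> leaves the second row undetermined, so
      only the first row of u is known to be (1, 0). The entry x is the desired element, and nothing
      is known about \<sigma>.\<close>
    have \<rho>: "\<rho> = mult_one A B" "y = \<zero>\<^bsub>B\<^esub>" using uv(1) u v by simp_all
    have "plus_point x = S"
      unfolding plus_point_def
    proof (rule emb.graph_eqI[OF base_compl plus_hom_point_hom[OF u(2)] S])
      fix s assume "s \<in> o_plus"
      then obtain \<tau> b where s: "\<tau> \<in> RS" "b \<in> carrier B" "s = (\<tau>, \<zero>\<^bsub>A\<^esub>, b, \<zero>\<^bsub>LM\<^esub>)" by (rule o_plusE)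
      \<comment> \<open>Right multiplication by a matrix with first row (\<tau>, b) and second row 0
        sees only the first column of u, so the unknown \<sigma> drops out. The product has rows
        (\<tau>, b) and (x\<tau>, xb).\<close>
      have "op_R \<tau> u \<in> S" "op_B b u \<in> S"
        using emb.pointsD(7)[OF S_point _ uv(2)] s unfolding operators_iff by blast+
      then have "op_R \<tau> u \<oplus>\<^bsub>imbedding\<^esub> op_B b u \<in> S" by (rule emb.pointsD(3)[OF S_point])
      moreover have "op_R \<tau> u \<oplus>\<^bsub>imbedding\<^esub> op_B b u = s \<oplus>\<^bsub>imbedding\<^esub> plus_hom x s"
        using u s by (simp add: \<rho>) (simp add: mult_one_def)
      ultimately show "s \<oplus>\<^bsub>imbedding\<^esub> plus_hom x s \<in> S" by simp
    qed
    then show ?thesis using u by blast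
  qed
  moreover have "emb.compl (plus_point x) o_minus" if "x \<in> carrier A" for x
    unfolding plus_point_def by (rule emb.graph_compl[OF base_compl plus_hom_point_hom[OF that]])
  ultimately show ?thesis
    using o_minus_point by (auto simp: bij_betw_def inj_on_def emb.U_iff)
qed

lemma bij_betw_minus_point: "bij_betw minus_point (carrier B) (U emb.geom o_plus)"
proof -
  note compl = emb.compl_sym[OF base_compl]
  have "x = y" if xy: "x \<in> carrier B" "y \<in> carrier B" "minus_point x = minus_point y" for x y
  proof -
    have "minus_hom x (\<zero>\<^bsub>RM\<^esub>, \<zero>\<^bsub>A\<^esub>, \<zero>\<^bsub>B\<^esub>, mult_one A B) = minus_hom y (\<zero>\<^bsub>RM\<^esub>, \<zero>\<^bsub>A\<^esub>, \<zero>\<^bsub>B\<^esub>, mult_one A B)"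
      by (rule emb.graph_inject[OF compl])
        (use xy in \<open>simp_all add: minus_hom_point_hom minus_point_def del: hom_simps\<close>)
    then show ?thesis using xy by (simp add: mult_one_def)
  qed
  moreover have "S \<in> minus_point ` carrier B" if S: "emb.compl S o_plus" for S
  proof -
    note S_point = emb.complD(1)[OF S]
    have "(\<zero>\<^bsub>RM\<^esub>, \<zero>\<^bsub>A\<^esub>, \<zero>\<^bsub>B\<^esub>, mult_one A B) \<in> carrier imbedding" by simp
    then obtain u v where uv: "(\<zero>\<^bsub>RM\<^esub>, \<zero>\<^bsub>A\<^esub>, \<zero>\<^bsub>B\<^esub>, mult_one A B) = u \<oplus>\<^bsub>imbedding\<^esub> v" "u \<in> S" "v \<in> o_plus"
      by (rule emb.compl_decomp[OF S])
    obtain \<rho> x y \<sigma> where u: "\<rho> \<in> RS" "x \<in> carrier A" "y \<in> carrier B" "\<sigma> \<in> LS" "u = (\<rho>, x, y, \<sigma>)"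
      using emb.points_carrier[OF S_point uv(2)] by (rule imbeddingE)
    obtain \<rho>' y' where v: "\<rho>' \<in> RS" "y' \<in> carrier B" "v = (\<rho>', \<zero>\<^bsub>A\<^esub>, y', \<zero>\<^bsub>LM\<^esub>)"
      using uv(3) by (rule o_plusE)
    have \<sigma>: "\<sigma> = mult_one A B" "x = \<zero>\<^bsub>A\<^esub>" using uv(1) u v by simp_all
    have "minus_point y = S"
      unfolding minus_point_def
    proof (rule emb.graph_eqI[OF compl minus_hom_point_hom[OF u(3)] S])
      fix s assume "s \<in> o_minus"
      then obtain a \<tau> where s: "a \<in> carrier A" "\<tau> \<in> LS" "s = (\<zero>\<^bsub>RM\<^esub>, a, \<zero>\<^bsub>B\<^esub>, \<tau>)" by (rule o_minusE)
      \<comment> \<open>The mirror image: a matrix supported in its second row, (a, \<tau>), sees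
        only the second column of u, which consists of y and the unit.\<close>
      have "op_A a u \<in> S" "op_L \<tau> u \<in> S"
        using emb.pointsD(7)[OF S_point _ uv(2)] s unfolding operators_iff by blast+
      then have "op_A a u \<oplus>\<^bsub>imbedding\<^esub> op_L \<tau> u \<in> S" by (rule emb.pointsD(3)[OF S_point])
      moreover have "op_A a u \<oplus>\<^bsub>imbedding\<^esub> op_L \<tau> u = s \<oplus>\<^bsub>imbedding\<^esub> minus_hom y s"
        using u s by (simp add: \<sigma>) (simp add: mult_one_def)
      ultimately show "s \<oplus>\<^bsub>imbedding\<^esub> minus_hom y s \<in> S" by simp
    qed
    then show ?thesis using u by blast
  qed
  moreover have "emb.compl (minus_point x) o_plus" if "x \<in> carrier B" for x
    unfolding minus_point_def by (rule emb.graph_compl[OF compl minus_hom_point_hom[OF that]])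
  ultimately show ?thesis
    using o_plus_point by (auto simp: bij_betw_def inj_on_def emb.U_iff)
qed

text \<open>Left multiplications by x, y and z compose to left multiplication by xyz, in the same
  order in which \<Gamma> composes graphs.\<close>

lemma plus_point_product:
  assumes "x \<in> carrier A" "y \<in> carrier B" "z \<in> carrier A"
  shows "plus_point (tp x y z) = emb.rel_gam (plus_point x) o_minus (minus_point y) o_plus (plus_point z)"
  unfolding plus_point_def minus_point_def
proof (rule emb.graph_triple_product[OF base_compl])
  fix s assume "s \<in> o_plus"
  then show "plus_hom (tp x y z) s = plus_hom x (minus_hom y (plus_hom z s))"
    by (elim o_plusE) (use assms in \<open>simp add: multiplierD opp.right_mult_tm\<close>)
qed (use assms in \<open>simp_all add: plus_hom_point_hom minus_hom_point_hom\<close>)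

lemma minus_point_product:
  assumes "x \<in> carrier B" "y \<in> carrier A" "z \<in> carrier B"
  shows "minus_point (tm x y z) = emb.rel_gam (minus_point x) o_minus (plus_point y) o_plus (minus_point z)"
proof -
  \<comment> \<open>As a matrix product \<open>tm x y z\<close> is zyx, so composition gives the
    factors in reverse order. Exchanging \<open>o_plus\<close> with \<open>o_minus\<close> by
    \<open>gam_swap\<close> restores the order that the pair product prescribes.\<close>
  have "minus_point (tm x y z) = emb.rel_gam (minus_point z) o_plus (plus_point y) o_minus (minus_point x)"
    unfolding plus_point_def minus_point_def
  proof (rule emb.graph_triple_product[OF emb.compl_sym[OF base_compl]])
    fix s assume "s \<in> o_minus"
    then show "minus_hom (tm x y z) s = minus_hom z (plus_hom y (minus_hom x s))"
      by (elim o_minusE) (use assms in \<open>simp add: opp.multiplierD right_mult_tm\<close>)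
  qed (use assms in \<open>simp_all add: plus_hom_point_hom minus_hom_point_hom\<close>)
  then show ?thesis using emb.gam_swap[OF o_plus_point o_minus_point] by simp
qed

theorem exists_geometry_pair:
  "\<exists>(X :: (('a, 'b) pair_point, 'k) geometry) p m f g.
     associative_geometry K X \<and> base_point X p m \<and>
     associative_pair_iso K A B tp tm
       (U_module X m p) (U_module X p m) (pair_product X p m) (pair_product X p m) f g"
proof (intro exI conjI)
  show "associative_geometry K emb.geom" by (rule emb.geom_associative_geometry)
  show "base_point emb.geom o_plus o_minus"
    using base_compl o_plus_point o_minus_point by (simp add: base_point_def emb.transversal_iff)
  have "linear_map K A (U_module emb.geom o_minus o_plus) plus_point"
    unfolding plus_point_def
    by (rule emb.graph_linear_map[OF base_compl plus_hom_point_hom plus.module_axioms]; (elim o_plusE)?; simp)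
  moreover have "linear_map K B (U_module emb.geom o_plus o_minus) minus_point"
    unfolding minus_point_def
    by (rule emb.graph_linear_map[OF emb.compl_sym[OF base_compl] minus_hom_point_hom minus.module_axioms]; (elim o_minusE)?; simp)
  ultimately show "associative_pair_iso K A B tp tm (U_module emb.geom o_minus o_plus) (U_module emb.geom o_plus o_minus)
     (pair_product emb.geom o_plus o_minus) (pair_product emb.geom o_plus o_minus) plus_point minus_point"
    using bij_betw_plus_point bij_betw_minus_point
    by (simp add: associative_pair_iso_def pair_product_def plus_point_product minus_point_product
        U_module_def linearization_def)
qed

end

theorem theorem3p4:
  fixes K :: "('k, 'r) ring_scheme"
  assumes "cring K"
  shows
    "(\<forall>(A :: ('k, 'a, 'm) module_scheme) (B :: ('k, 'b, 'n) module_scheme) tp tm.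
        associative_pair K A B tp tm \<longrightarrow>
        (\<exists>(X :: (('a, 'b) pair_point, 'k) geometry) p m f g.
           associative_geometry K X \<and> base_point X p m \<and>
           associative_pair_iso K A B tp tm
             (U_module X m p) (U_module X p m) (pair_product X p m) (pair_product X p m) f g))
     \<and>
     (\<forall>A :: ('k, 'c, 'l) module_scheme.
        unital_assoc_algebra K A \<longrightarrow>
        (\<exists>(X :: ('c algebra_point, 'k) geometry) p e m f.
           associative_geometry K X \<and> transversal_triple X p e m \<and>
           algebra_iso K A (triple_algebra X p e m) f))"
  using associative_pair.exists_geometry_pair unital_assoc_algebra.exists_geometry_algebra by blast

end
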